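(* Let $K$ be a field of characteristic $0$, $d\ge2$, and let $\beta=(\beta_1,\beta_2)\in K^2$ satisfy $\beta_1\beta_2(\beta_1+\beta_2)(\beta_1-\beta_2)\ne0$. In $G_d(\mathfrak V_\beta)$ the consequences of degree $n+1$ of the following polynomials of degree $n$ are equivalent to the polynomials listed (with $\gamma_1,\gamma_2\in K$): (i) for $w_{(1)}=x_1$: $w_{(2)}^{(1)}=y_1z_1$, $w_{(1^2)}^{(0)}=y_1z_2-y_2z_1$; (ii) for $w_{(2)}^{(1)}=y_1z_1$: $w_{(3)}^{(2)}=y_1^2z_1$, $w_{(3)}^{(1)}=y_1z_1^2$, $w_{(2,1)}^{(1)}$; (iii) for $w_{(1^2)}^{(0)}=y_1z_2-y_2z_1$: $w_{(3)}^{(2)}-w_{(3)}^{(1)}=y_1z_1(y_1-z_1)$, $w_{(2,1)}^{(1)}$; (iv) for $w_{(3)}=\gamma_1w_{(3)}^{(2)}+\gamma_2w_{(3)}^{(1)}$, $\gamma_1+\gamma_2\ne0$: $w_{(4)}^{(3)}$, $w_{(4)}^{(2)}$, $w_{(3,1)}^{(2)}$; (v) for $w_{(3)}=w_{(3)}^{(2)}-w_{(3)}^{(1)}$: $w_{(4)}^{(3)}-w_{(4)}^{(2)}$; (vi) for $w_{(2,1)}^{(1)}$: $w_{(4)}^{(3)}-w_{(4)}^{(2)}$; (vii) for $w_{(4)}=\gamma_1w_{(4)}^{(2)}+\gamma_2w_{(4)}^{(1)}$, $\gamma_1+\gamma_2\ne0$: $w_{(5)}^{(4)}$; (viii) for $w_{(4)}=w_{(4)}^{(2)}-w_{(4)}^{(1)}$: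 there are no (nonzero) consequences of degree $5$; (ix) for $w_{(n)}^{(n-1)}$, $n\ge5$: $w_{(n+1)}^{(n)}$.
   Context: A bicommutative algebra is a nonassociative $K$-algebra satisfying $(x_1x_2)x_3=(x_1x_3)x_2$ and $x_1(x_2x_3)=x_2(x_1x_3)$; $\mathfrak B$ is the variety of all of them. The free bicommutative algebra $F_d(\mathfrak B)$ on $x_1,\dots,x_d$ is identified (via $x_i\mapsto x_i$) with the algebra $G_d$ having as basis $x_1,\dots,x_d$ together with all monomials $Y^aZ^b=y_1^{a_1}\cdots y_d^{a_d}z_1^{b_1}\cdots z_d^{b_d}$ in the polynomial algebra $K[y_1,\dots,y_d,z_1,\dots,z_d]$ with $|a|\ge1$ and $|b|\ge1$, and multiplication $x_ix_j=y_iz_j$, $x_i(Y^aZ^b)=y_iY^aZ^b$, $(Y^aZ^b)x_i=Y^aZ^bz_i$, $(Y^aZ^b)(Y^cZ^e)=Y^{a+c}Z^{b+e}$. The group $GL_d(K)$ acts on $G_d$ by automorphisms extending its linear action on the span of $x_1,\dots,x_d$. Put $w_{(1)}=x_1$, $w_{(n)}^{(j)}=y_1^jz_1^{n-j}$ ($1\le j\le n-1$), and $w_{(\lambda_1,\lambda_2)}^{(j)}=y_1^j(y_1z_2-y_2z_1)^{\lambda_2}z_1^{\lambda_1-\lambda_2-j}$ for $\lambda_2>0$, $0\le j\le\lambda_1-\lambda_2$; $(1^2)=(1,1)$. $\mathfrak V_\beta$ is the variety of bicommutative algebras defined by the identity $\beta_1x(xy-yx)+\beta_2(xy-yx)x=0$,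 and $G_d(\mathfrak V_\beta)\cong F_d(\mathfrak V_\beta)$ is the factor algebra of $G_d$ modulo the T-ideal (ideal closed under all endomorphisms) generated by $(\beta_1y_1+\beta_2z_1)(y_1z_2-y_2z_1)$; elements of $G_d$ denote also their images (which may be zero). For a homogeneous $f$ of degree $n$ in $G_d(\mathfrak V_\beta)$, its consequences of degree $n+1$ are the elements of the degree $n+1$ homogeneous component of the T-ideal of $G_d(\mathfrak V_\beta)$ generated by $f$. They are "equivalent to" a list of polynomials if this component equals the $GL_d(K)$-submodule generated by the images of the polynomials in the list. *)

theory Defs
  imports
    "HOL-Library.Poly_Mapping"
    "HOL-Library.Product_Plus"
    "Jordan_Normal_Form.Matrix"
begin

section \<open>Nonassociative algebras and T-ideals\<close>

text \<open>Algebras over the field \<open>'k\<close> are given on explicit carriers, because the factor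
  algebras below depend on the number of generators and on the parameters.\<close>

record ('k, 'a) nalg =
  acarrier :: "'a set"
  azero :: 'a
  aplus :: "'a \<Rightarrow> 'a \<Rightarrow> 'a"
  ascale :: "'k \<Rightarrow> 'a \<Rightarrow> 'a"
  amult :: "'a \<Rightarrow> 'a \<Rightarrow> 'a"

definition asubspace :: "('k, 'a) nalg \<Rightarrow> 'a set \<Rightarrow> bool" where
  "asubspace A W \<longleftrightarrow> W \<subseteq> acarrier A \<and> azero A \<in> W \<and>
     (\<forall>u\<in>W. \<forall>v\<in>W. aplus A u v \<in> W) \<and> (\<forall>c. \<forall>u\<in>W. ascale A c u \<in> W)"

definition aideal :: "('k, 'a) nalg \<Rightarrow> 'a set \<Rightarrow> bool" where
  "aideal A I \<longleftrightarrow> asubspace A I \<and>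
     (\<forall>a\<in>acarrier A. \<forall>u\<in>I. amult A a u \<in> I \<and> amult A u a \<in> I)"

definition aendo :: "('k, 'a) nalg \<Rightarrow> ('a \<Rightarrow> 'a) \<Rightarrow> bool" where
  "aendo A \<phi> \<longleftrightarrow> \<phi> ` acarrier A \<subseteq> acarrier A \<and>
     (\<forall>a\<in>acarrier A. \<forall>b\<in>acarrier A. \<phi> (aplus A a b) = aplus A (\<phi> a) (\<phi> b)) \<and>
     (\<forall>c. \<forall>a\<in>acarrier A. \<phi> (ascale A c a) = ascale A c (\<phi> a)) \<and>
     (\<forall>a\<in>acarrier A. \<forall>b\<in>acarrier A. \<phi> (amult A a b) = amult A (\<phi> a) (\<phi> b))"

definition T_ideal :: "('k, 'a) nalg \<Rightarrow> 'a set \<Rightarrow> bool" where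
  "T_ideal A I \<longleftrightarrow> aideal A I \<and> (\<forall>\<phi>. aendo A \<phi> \<longrightarrow> \<phi> ` I \<subseteq> I)"

definition T_ideal_gen :: "('k, 'a) nalg \<Rightarrow> 'a set \<Rightarrow> 'a set" where
  "T_ideal_gen A S = \<Inter>{I. T_ideal A I \<and> S \<subseteq> I}"

definition acoset :: "('k, 'a) nalg \<Rightarrow> 'a set \<Rightarrow> 'a \<Rightarrow> 'a set" where
  "acoset A I a = aplus A a ` I"

definition afactor :: "('k, 'a) nalg \<Rightarrow> 'a set \<Rightarrow> ('k, 'a set) nalg" where
  "afactor A I = \<lparr>
     acarrier = acoset A I ` acarrier A,
     azero = acoset A I (azero A),
     aplus = (\<lambda>C D. \<Union>c\<in>C. \<Union>d\<in>D. acoset A I (aplus A c d)),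
     ascale = (\<lambda>r C. \<Union>c\<in>C. acoset A I (ascale A r c)),
     amult = (\<lambda>C D. \<Union>c\<in>C. \<Union>d\<in>D. acoset A I (amult A c d)) \<rparr>"


section \<open>The algebra \<open>G\<^sub>d\<close>\<close>

text \<open>Indices run over \<open>{..<d}\<close>: index \<open>i\<close> stands for the variables
  \<open>x\<^sub>i\<^sub>+\<^sub>1\<close>, \<open>y\<^sub>i\<^sub>+\<^sub>1\<close>, \<open>z\<^sub>i\<^sub>+\<^sub>1\<close> of the usual notation.\<close>

datatype yz = Y nat | Z nat

type_synonym 'k yzpoly = "(yz \<Rightarrow>\<^sub>0 nat) \<Rightarrow>\<^sub>0 'k"

definition pconst :: "'k \<Rightarrow> 'k::comm_ring_1 yzpoly" where
  "pconst c = Poly_Mapping.single 0 c"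

definition pvar :: "yz \<Rightarrow> 'k::comm_ring_1 yzpoly" where
  "pvar t = Poly_Mapping.single (Poly_Mapping.single t 1) 1"

abbreviation py :: "nat \<Rightarrow> 'k::comm_ring_1 yzpoly" where "py i \<equiv> pvar (Y i)"
abbreviation pz :: "nat \<Rightarrow> 'k::comm_ring_1 yzpoly" where "pz i \<equiv> pvar (Z i)"

definition ydeg :: "nat \<Rightarrow> (yz \<Rightarrow>\<^sub>0 nat) \<Rightarrow> nat" where
  "ydeg d m = (\<Sum>i<d. Poly_Mapping.lookup m (Y i))"

definition zdeg :: "nat \<Rightarrow> (yz \<Rightarrow>\<^sub>0 nat) \<Rightarrow> nat" where
  "zdeg d m = (\<Sum>i<d. Poly_Mapping.lookup m (Z i))"

text \<open>A pair \<open>(v, p)\<close> is the element \<open>\<Sum>\<^sub>i v\<^sub>i x\<^sub>i + p\<close>.\<close>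

type_synonym 'k gelem = "(nat \<Rightarrow>\<^sub>0 'k) \<times> 'k yzpoly"

definition gx :: "nat \<Rightarrow> 'k::comm_ring_1 gelem" where
  "gx i = (Poly_Mapping.single i 1, 0)"

definition gpoly :: "'k::comm_ring_1 yzpoly \<Rightarrow> 'k gelem" where
  "gpoly p = (0, p)"

definition gcarrier :: "nat \<Rightarrow> 'k::comm_ring_1 gelem set" where
  "gcarrier d = {(v, p). Poly_Mapping.keys v \<subseteq> {..<d} \<and>
     (\<forall>m\<in>Poly_Mapping.keys p. Poly_Mapping.keys m \<subseteq> Y ` {..<d} \<union> Z ` {..<d} \<and>
        1 \<le> ydeg d m \<and> 1 \<le> zdeg d m)}"

definition gscale :: "'k \<Rightarrow> 'k::comm_ring_1 gelem \<Rightarrow> 'k gelem" where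
  "gscale c a = (Poly_Mapping.map ((*) c) (fst a), Poly_Mapping.map ((*) c) (snd a))"

definition linform :: "(nat \<Rightarrow> yz) \<Rightarrow> (nat \<Rightarrow>\<^sub>0 'k::comm_ring_1) \<Rightarrow> 'k yzpoly" where
  "linform t v = (\<Sum>i\<in>Poly_Mapping.keys v. pconst (Poly_Mapping.lookup v i) * pvar (t i))"

text \<open>A left factor \<open>x\<^sub>i\<close> acts as \<open>y\<^sub>i\<close> and a right factor \<open>x\<^sub>i\<close> as \<open>z\<^sub>i\<close>; the lemmas
  \<open>gmult_basis\<close> recover the multiplication table on the basis.\<close>

definition gmult :: "'k::comm_ring_1 gelem \<Rightarrow> 'k gelem \<Rightarrow> 'k gelem" where
  "gmult a b = (0, (linform Y (fst a) + snd a) * (linform Z (fst b) + snd b))"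

definition G :: "nat \<Rightarrow> ('k::comm_ring_1, 'k gelem) nalg" where
  "G d = \<lparr> acarrier = gcarrier d, azero = 0, aplus = (+), ascale = gscale, amult = gmult \<rparr>"

lemma gmult_basis:
  fixes p q :: "'k::comm_ring_1 yzpoly"
  shows "gmult (gx i) (gx j) = gpoly (py i * pz j :: 'k yzpoly)"
    and "gmult (gx i) (gpoly p) = gpoly (py i * p)"
    and "gmult (gpoly p) (gx i) = gpoly (p * pz i)"
    and "gmult (gpoly p) (gpoly q) = gpoly (p * q)"
  by (simp_all add: gmult_def gx_def gpoly_def linform_def pconst_def single_one)

lemma gmult_bicommutative:
  "gmult (gmult a b) c = gmult (gmult a c) b"
  "gmult a (gmult b c) = gmult b (gmult a c)"
  by (simp_all add: gmult_def linform_def mult_ac)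

definition ghom :: "nat \<Rightarrow> nat \<Rightarrow> 'k::comm_ring_1 gelem set" where
  "ghom d n = {(v, p) \<in> gcarrier d. (n \<noteq> 1 \<longrightarrow> v = 0) \<and>
     (\<forall>m\<in>Poly_Mapping.keys p. ydeg d m + zdeg d m = n)}"


section \<open>The action of the general linear group\<close>

definition GLd :: "nat \<Rightarrow> 'k::comm_ring_1 mat set" where
  "GLd d = {g \<in> carrier_mat d d. invertible_mat g}"

definition psubst :: "(yz \<Rightarrow> 'k yzpoly) \<Rightarrow> 'k::comm_ring_1 yzpoly \<Rightarrow> 'k yzpoly" where
  "psubst \<sigma> p = (\<Sum>m\<in>Poly_Mapping.keys p. pconst (Poly_Mapping.lookup p m) *
     (\<Prod>t\<in>Poly_Mapping.keys m. \<sigma> t ^ Poly_Mapping.lookup m t))"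

fun gl_var :: "nat \<Rightarrow> 'k::comm_ring_1 mat \<Rightarrow> yz \<Rightarrow> 'k yzpoly" where
  "gl_var d g (Y j) = (\<Sum>i<d. pconst (g $$ (i, j)) * py i)"
| "gl_var d g (Z j) = (\<Sum>i<d. pconst (g $$ (i, j)) * pz i)"

text \<open>The automorphism of \<open>G\<^sub>d\<close> with \<open>x\<^sub>j \<mapsto> \<Sum>\<^sub>i g\<^sub>i\<^sub>j x\<^sub>i\<close>; the multiplication
  forces the same substitution on the \<open>y\<^sub>j\<close> and on the \<open>z\<^sub>j\<close>.\<close>

definition gl_act :: "nat \<Rightarrow> 'k::comm_ring_1 mat \<Rightarrow> 'k gelem \<Rightarrow> 'k gelem" where
  "gl_act d g a =
     ((\<Sum>j<d. \<Sum>i<d. Poly_Mapping.single i (g $$ (i, j) * Poly_Mapping.lookup (fst a) j)),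
      psubst (gl_var d g) (snd a))"


section \<open>The relatively free algebra \<open>G\<^sub>d(V\<^sub>\<beta>)\<close>\<close>

definition skew12 :: "'k::comm_ring_1 yzpoly" where
  "skew12 = py 0 * pz 1 - py 1 * pz 0"

definition beta_poly :: "'k \<Rightarrow> 'k \<Rightarrow> 'k::comm_ring_1 gelem" where
  "beta_poly \<beta>\<^sub>1 \<beta>\<^sub>2 = gpoly ((pconst \<beta>\<^sub>1 * py 0 + pconst \<beta>\<^sub>2 * pz 0) * skew12)"

definition T_beta :: "nat \<Rightarrow> 'k \<Rightarrow> 'k \<Rightarrow> 'k::comm_ring_1 gelem set" where
  "T_beta d \<beta>\<^sub>1 \<beta>\<^sub>2 = T_ideal_gen (G d) {beta_poly \<beta>\<^sub>1 \<beta>\<^sub>2}"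

definition GV :: "nat \<Rightarrow> 'k \<Rightarrow> 'k \<Rightarrow> ('k::comm_ring_1, 'k gelem set) nalg" where
  "GV d \<beta>\<^sub>1 \<beta>\<^sub>2 = afactor (G d) (T_beta d \<beta>\<^sub>1 \<beta>\<^sub>2)"

definition gv :: "nat \<Rightarrow> 'k \<Rightarrow> 'k \<Rightarrow> 'k::comm_ring_1 gelem \<Rightarrow> 'k gelem set" where
  "gv d \<beta>\<^sub>1 \<beta>\<^sub>2 = acoset (G d) (T_beta d \<beta>\<^sub>1 \<beta>\<^sub>2)"

text \<open>As \<open>T_beta\<close> is stable under \<open>gl_act\<close>, the induced action on the factor algebra sends
  a coset to its image under \<open>gl_act\<close>.\<close>

definition GL_submodule :: "nat \<Rightarrow> 'k \<Rightarrow> 'k \<Rightarrow> 'k::comm_ring_1 gelem set set \<Rightarrow> bool" where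
  "GL_submodule d \<beta>\<^sub>1 \<beta>\<^sub>2 W \<longleftrightarrow> asubspace (GV d \<beta>\<^sub>1 \<beta>\<^sub>2) W \<and>
     (\<forall>g\<in>GLd d. \<forall>C\<in>W. gl_act d g ` C \<in> W)"

definition GL_submodule_gen ::
    "nat \<Rightarrow> 'k \<Rightarrow> 'k \<Rightarrow> 'k::comm_ring_1 gelem set set \<Rightarrow> 'k gelem set set" where
  "GL_submodule_gen d \<beta>\<^sub>1 \<beta>\<^sub>2 S = \<Inter>{W. GL_submodule d \<beta>\<^sub>1 \<beta>\<^sub>2 W \<and> S \<subseteq> W}"

definition consequences ::
    "nat \<Rightarrow> 'k \<Rightarrow> 'k \<Rightarrow> nat \<Rightarrow> 'k::comm_ring_1 gelem \<Rightarrow> 'k gelem set set" where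
  "consequences d \<beta>\<^sub>1 \<beta>\<^sub>2 k f =
     T_ideal_gen (GV d \<beta>\<^sub>1 \<beta>\<^sub>2) {gv d \<beta>\<^sub>1 \<beta>\<^sub>2 f} \<inter> gv d \<beta>\<^sub>1 \<beta>\<^sub>2 ` ghom d k"

definition consequences_equiv ::
    "nat \<Rightarrow> 'k \<Rightarrow> 'k \<Rightarrow> nat \<Rightarrow> 'k::comm_ring_1 gelem \<Rightarrow> 'k gelem set \<Rightarrow> bool" where
  "consequences_equiv d \<beta>\<^sub>1 \<beta>\<^sub>2 k f L \<longleftrightarrow>
     consequences d \<beta>\<^sub>1 \<beta>\<^sub>2 k f = GL_submodule_gen d \<beta>\<^sub>1 \<beta>\<^sub>2 (gv d \<beta>\<^sub>1 \<beta>\<^sub>2 ` L)"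


section \<open>Highest weight vectors\<close>

definition w1 :: "nat \<Rightarrow> nat \<Rightarrow> 'k::comm_ring_1 gelem" where
  "w1 n j = gpoly (py 0 ^ j * pz 0 ^ (n - j))"

definition w2 :: "nat \<Rightarrow> nat \<Rightarrow> nat \<Rightarrow> 'k::comm_ring_1 gelem" where
  "w2 l1 l2 j = gpoly (py 0 ^ j * skew12 ^ l2 * pz 0 ^ (l1 - l2 - j))"

end

theory Submission
  imports Defs "Jordan_Normal_Form.Char_Poly"
begin

text \<open>
  An ideal of \<open>G\<^sub>d\<close> that consists of polynomials is closed under multiplication by all
  \<open>y\<^sub>i\<close> and \<open>z\<^sub>i\<close>, and an endomorphism \<open>x\<^sub>i \<mapsto> A\<^sub>i\<close> of \<open>G\<^sub>d\<close> acts on polynomials as the substitution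
  \<open>y\<^sub>i \<mapsto> lft A\<^sub>i\<close>, \<open>z\<^sub>i \<mapsto> rgt A\<^sub>i\<close>. Polarizing the defining identity of the variety in
  characteristic 0 puts all \<open>(\<beta>\<^sub>1 lft A + \<beta>\<^sub>2 rgt A) (lft B rgt C - lft C rgt B)\<close> into its T-ideal.
  Inserting polynomials for \<open>A\<close>, \<open>B\<close>, \<open>C\<close> shows that modulo the T-ideal a monomial of degree 4 depends
  only on its \<open>y\<close>-degree and on the multiset of its indices, with one linear relation between
  the \<open>y\<close>-degrees, and that from degree 5 on it depends only on the multiset of its indices.

  The upper bounds on the consequences come from the homomorphism that identifies \<open>x\<^sub>i\<close>, \<open>y\<^sub>i\<close>
  and \<open>z\<^sub>i\<close>: its kernel is a T-ideal, so the consequences of an element of the kernel stay in it. In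
  every case the homogeneous component in question, or its intersection with this kernel, is
  generated by the listed elements as a module over the general linear group.
\<close>

text \<open>Modules over the general linear group are never decomposed here. A submodule is stable
  under invertible matrices only, whereas polarization inserts arbitrary linear elements. A
  parameter closes the gap: a matrix plus \<open>c\<close> times the identity is invertible for
  infinitely many \<open>c\<close>, the substituted element is a polynomial in \<open>c\<close>, and
  over an infinite field its coefficients lie in the submodule. The constant coefficient gives
  arbitrary tuples, the linear one gives derivatives. A derivative has several terms that differ in
  which factor carries the new index. They agree only up to multiples of commutators, so
  polarization works where these multiples already lie in the subspace. Endomorphisms of the factor
  algebra are not lifted. The lower bounds use those induced from \<open>G d\<close>; the upper
  bounds treat any endomorphism through chosen representatives, since the T-ideal lies in the kernel
  of \<open>collapse\<close>. That \<open>\<beta>\<^sub>1 + \<beta>\<^sub>2\<close> is nonzero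
  allows a polynomial to be inserted into the linear factor; that \<open>\<beta>\<^sub>1\<close> and
  \<open>\<beta>\<^sub>2\<close> are nonzero allows left and right operators to be
  exchanged.\<close>

abbreviation lookup where "lookup \<equiv> Poly_Mapping.lookup"
abbreviation keys where "keys \<equiv> Poly_Mapping.keys"

section \<open>Constants, linear forms and substitutions\<close>

lemma pconst_simps [simp]:
  "pconst (0 :: 'k::comm_ring_1) = 0" "pconst (1 :: 'k) = 1"
  by (simp_all add: pconst_def)

lemma pconst_add: "pconst (a + b) = pconst a + pconst (b :: 'k::comm_ring_1)"
  by (simp add: pconst_def single_add)

lemma pconst_mult: "pconst (a * b) = pconst a * pconst (b :: 'k::comm_ring_1)"
  by (simp add: pconst_def mult_single)

lemma pconst_uminus: "pconst (- a) = - pconst (a :: 'k::comm_ring_1)"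
  by (simp add: pconst_def single_uminus)

lemma pconst_diff: "pconst (a - b) = pconst a - pconst (b :: 'k::comm_ring_1)"
  by (simp add: pconst_def single_diff)

lemma pconst_of_nat: "pconst (of_nat n :: 'k::comm_ring_1) = of_nat n"
  by (simp add: pconst_def)

lemma map_scale_pconst: "Poly_Mapping.map ((*) c) p = pconst c * (p :: 'k::comm_ring_1 yzpoly)"
  by (simp add: mult_map_scale_conv_mult pconst_def)

lemma lookup_map_scale: "lookup (Poly_Mapping.map ((*) c) v) i = c * (lookup v i :: 'k::comm_ring_1)"
  by (transfer) (auto simp: when_def)

lemma keys_map_scale: "keys (Poly_Mapping.map ((*) c) v) \<subseteq> keys (v :: _ \<Rightarrow>\<^sub>0 'k::comm_ring_1)"
  by (auto simp: in_keys_iff lookup_map_scale)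

lemma pconst_mult_single: "pconst c * Poly_Mapping.single m a = Poly_Mapping.single m (c * a :: 'k::comm_ring_1)"
  by (simp add: pconst_def mult_single)

lemma poly_mapping_sum_singles:
  "(\<Sum>m\<in>keys p. Poly_Mapping.single m (lookup p m)) = p"
  by (rule poly_mapping_eqI)
     (auto simp: lookup_sum lookup_single when_def in_keys_iff if_distrib cong: if_cong)

text \<open>The single case keeps \<open>m\<close> inside the support of \<open>p\<close>, so a
  condition on all monomials of \<open>p\<close> is still available there, although the sums being
  combined are arbitrary.\<close>

lemma poly_mapping_add_induct [case_names zero single add]:
  fixes p :: "'a \<Rightarrow>\<^sub>0 'b::comm_monoid_add"
  assumes "P 0"
    and "\<And>m c. m \<in> keys p \<Longrightarrow> P (Poly_Mapping.single m c)"
    and "\<And>q r. P q \<Longrightarrow> P r \<Longrightarrow> P (q + r)"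
  shows "P p"
proof -
  have "P (\<Sum>m\<in>M. Poly_Mapping.single m (lookup p m))" if "M \<subseteq> keys p" "finite M" for M
    using that(2,1) by (induction M rule: finite_induct) (auto intro: assms)
  from this[of "keys p"] show ?thesis by (simp add: poly_mapping_sum_singles)
qed

lemma linform_add: "linform t (v + w) = linform t v + linform t (w :: nat \<Rightarrow>\<^sub>0 'k::comm_ring_1)"
  unfolding linform_def
  by (rule setsum_keys_plus_distrib) (simp_all add: pconst_add algebra_simps)

lemma linform_0 [simp]: "linform t 0 = 0"
  by (simp add: linform_def)

lemma linform_single [simp]:
  "linform t (Poly_Mapping.single i c) = pconst c * pvar (t i :: yz)" for c :: "'k::comm_ring_1"
  by (simp add: linform_def)

lemma linform_scale:
  "linform t (Poly_Mapping.map ((*) c) v) = pconst c * linform t (v :: nat \<Rightarrow>\<^sub>0 'k::comm_ring_1)"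
proof (induction v rule: poly_mapping_add_induct)
  case (single m a)
  have "Poly_Mapping.map ((*) c) (Poly_Mapping.single m a) = Poly_Mapping.single m (c * a)"
    by simp
  then show ?case by (simp add: pconst_mult mult_ac)
next
  case (add q r)
  have "Poly_Mapping.map ((*) c) (q + r) = Poly_Mapping.map ((*) c) q + Poly_Mapping.map ((*) c) r"
    by (rule poly_mapping_eqI) (simp add: lookup_map_scale lookup_add algebra_simps)
  then show ?case using add by (simp add: linform_add distrib_left)
qed (simp add: map_eq_zero_iff[THEN iffD2])

section \<open>Evaluation of monomials and the substitution homomorphism\<close>

definition mon_eval :: "('t \<Rightarrow> 'r) \<Rightarrow> ('t \<Rightarrow>\<^sub>0 nat) \<Rightarrow> 'r::comm_ring_1" where
  "mon_eval \<sigma> m = (\<Prod>t\<in>keys m. \<sigma> t ^ lookup m t)"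

lemma mon_eval_superset:
  assumes "finite S" "keys m \<subseteq> S"
  shows "mon_eval \<sigma> m = (\<Prod>t\<in>S. \<sigma> t ^ lookup m t)"
  unfolding mon_eval_def
  by (rule prod.mono_neutral_left) (use assms in \<open>auto simp: in_keys_iff\<close>)

lemma mon_eval_0 [simp]: "mon_eval \<sigma> 0 = 1"
  by (simp add: mon_eval_def)

lemma mon_eval_single [simp]: "mon_eval \<sigma> (Poly_Mapping.single t n) = \<sigma> t ^ n"
  by (simp add: mon_eval_def)

lemma mon_eval_add: "mon_eval \<sigma> (m + n) = mon_eval \<sigma> m * mon_eval \<sigma> n"
proof -
  let ?S = "keys m \<union> keys n"
  have "keys (m + n) \<subseteq> ?S" by (rule keys_add)
  then show ?thesis
    by (simp add: mon_eval_superset[of ?S] lookup_add power_add prod.distrib)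
qed

lemma psubst_add: "psubst \<sigma> (p + q) = psubst \<sigma> p + psubst \<sigma> q"
  unfolding psubst_def
  by (rule setsum_keys_plus_distrib) (simp_all add: pconst_add algebra_simps)

lemma psubst_0 [simp]: "psubst \<sigma> 0 = 0"
  by (simp add: psubst_def)

lemma psubst_single: "psubst \<sigma> (Poly_Mapping.single m c) = pconst c * mon_eval \<sigma> m"
  by (simp add: psubst_def mon_eval_def)

lemma psubst_mult: "psubst \<sigma> (p * q) = psubst \<sigma> p * psubst \<sigma> q"
proof (induction p rule: poly_mapping_add_induct)
  case (single m c)
  show ?case
    by (induction q rule: poly_mapping_add_induct)
       (simp_all add: mult_single psubst_single pconst_mult mon_eval_add psubst_add algebra_simps)
qed (simp_all add: psubst_add algebra_simps)

lemma psubst_pconst [simp]: "psubst \<sigma> (pconst c) = pconst c"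
  by (simp add: pconst_def[of c] psubst_single)

lemma psubst_1 [simp]: "psubst \<sigma> 1 = 1"
  using psubst_pconst[of \<sigma> 1] by simp

lemma psubst_pvar [simp]: "psubst \<sigma> (pvar t) = \<sigma> t"
  by (simp add: pvar_def psubst_single)

lemma psubst_uminus: "psubst \<sigma> (- p) = - psubst \<sigma> p"
  using psubst_add[of \<sigma> p "- p"] by (simp add: eq_neg_iff_add_eq_0 add.commute)

lemma psubst_diff: "psubst \<sigma> (p - q) = psubst \<sigma> p - psubst \<sigma> q"
  using psubst_add[of \<sigma> p "- q"] by (simp add: psubst_uminus)

lemma psubst_power: "psubst \<sigma> (p ^ n) = psubst \<sigma> p ^ n"
  by (induction n) (simp_all add: psubst_mult)

lemma psubst_sum: "psubst \<sigma> (\<Sum>i\<in>I. f i) = (\<Sum>i\<in>I. psubst \<sigma> (f i))"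
  by (induction I rule: infinite_finite_induct) (simp_all add: psubst_add)

lemmas psubst_simps = psubst_add psubst_mult psubst_diff psubst_power

lemma psubst_linform:
  "psubst \<sigma> (linform t v) = (\<Sum>i\<in>keys v. pconst (lookup v i) * \<sigma> (t i))"
  by (simp add: linform_def psubst_sum psubst_mult)

section \<open>Left and right operators\<close>

text \<open>A product sees its left factor only through \<open>lft\<close> and its right factor only
  through \<open>rgt\<close>. The two differ on the linear part alone, so they coincide once a
  polynomial is inserted into an identity.\<close>

definition lft :: "'k::comm_ring_1 gelem \<Rightarrow> 'k yzpoly" where
  "lft a = linform Y (fst a) + snd a"

definition rgt :: "'k::comm_ring_1 gelem \<Rightarrow> 'k yzpoly" where
  "rgt a = linform Z (fst a) + snd a"

lemma gmult_eq: "gmult a b = gpoly (lft a * rgt b)"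
  by (simp add: gmult_def lft_def rgt_def gpoly_def)

lemma gpoly_add: "gpoly (p + q) = gpoly p + gpoly q"
  by (simp add: gpoly_def)

lemma gpoly_0 [simp]: "gpoly 0 = 0"
  by (simp add: gpoly_def zero_prod_def)

lemma gpoly_diff: "gpoly (p - q) = gpoly p - gpoly q"
  by (simp add: gpoly_def)

lemma gscale_gpoly: "gscale c (gpoly p) = gpoly (pconst c * p)"
  by (simp add: gscale_def gpoly_def map_scale_pconst map_eq_zero_iff[THEN iffD2])

lemma lft_simps [simp]:
  "lft (a + b) = lft a + lft b" "lft (gscale c a) = pconst c * lft a"
  "lft (gx i) = py i" "lft (gpoly p) = p" "lft 0 = 0"
  by (simp_all add: lft_def linform_add gscale_def linform_scale map_scale_pconst gx_def gpoly_def
      algebra_simps)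

lemma rgt_simps [simp]:
  "rgt (a + b) = rgt a + rgt b" "rgt (gscale c a) = pconst c * rgt a"
  "rgt (gx i) = pz i" "rgt (gpoly p) = p" "rgt 0 = 0"
  by (simp_all add: rgt_def linform_add gscale_def linform_scale map_scale_pconst gx_def gpoly_def
      algebra_simps)

lemma lft_sum: "lft (\<Sum>i\<in>I. f i) = (\<Sum>i\<in>I. lft (f i))"
  by (induction I rule: infinite_finite_induct) simp_all

lemma rgt_sum: "rgt (\<Sum>i\<in>I. f i) = (\<Sum>i\<in>I. rgt (f i))"
  by (induction I rule: infinite_finite_induct) simp_all

lemma gscale_add: "gscale c (a + b) = gscale c a + gscale c b"
  by (auto simp: gscale_def lookup_map_scale lookup_add algebra_simps prod_eq_iff
      intro!: poly_mapping_eqI)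

lemma gscale_add_left: "gscale (c + e) a = gscale c a + gscale e a"
  by (auto simp: gscale_def lookup_map_scale lookup_add algebra_simps prod_eq_iff
      intro!: poly_mapping_eqI)

lemma gscale_gscale: "gscale c (gscale e a) = gscale (c * e) a"
  by (auto simp: gscale_def lookup_map_scale mult.assoc prod_eq_iff intro!: poly_mapping_eqI)

lemma gscale_simps [simp]: "gscale 0 a = 0" "gscale 1 a = a" "gscale c 0 = 0"
  by (auto simp: gscale_def lookup_map_scale prod_eq_iff intro!: poly_mapping_eqI)

lemma gscale_minus1: "gscale (- 1) a = - a"
  by (auto simp: gscale_def lookup_map_scale prod_eq_iff intro!: poly_mapping_eqI)

lemma gscale_sum: "gscale c (\<Sum>i\<in>I. f i) = (\<Sum>i\<in>I. gscale c (f i))"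
  by (induction I rule: infinite_finite_induct) (simp_all add: gscale_add)

lemma gelem_decomp: "(a :: 'a::comm_ring_1 gelem) = (\<Sum>i\<in>keys (fst a). gscale (lookup (fst a) i) (gx i)) + gpoly (snd a)"
proof -
  have "(\<Sum>i\<in>I. gscale (c i) (gx i)) = ((\<Sum>i\<in>I. Poly_Mapping.single i (c i)), 0)"
    for I and c :: "nat \<Rightarrow> 'a"
    by (induction I rule: infinite_finite_induct)
       (auto simp: gscale_def gx_def zero_prod_def map_eq_zero_iff[THEN iffD2])
  then show ?thesis
    by (simp add: gpoly_def poly_mapping_sum_singles)
qed


section \<open>The carrier\<close>

definition vars :: "nat \<Rightarrow> yz set" where
  "vars d = Y ` {..<d} \<union> Z ` {..<d}"

definition proper_mon :: "nat \<Rightarrow> (yz \<Rightarrow>\<^sub>0 nat) \<Rightarrow> bool" where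
  "proper_mon d m \<longleftrightarrow> keys m \<subseteq> vars d \<and> 1 \<le> ydeg d m \<and> 1 \<le> zdeg d m"

lemma mem_gcarrier:
  "a \<in> gcarrier d \<longleftrightarrow> keys (fst a) \<subseteq> {..<d} \<and> (\<forall>m\<in>keys (snd a). proper_mon d m)"
  by (cases a) (auto simp: gcarrier_def proper_mon_def vars_def)

lemma ydeg_add: "ydeg d (m + n) = ydeg d m + ydeg d n"
  by (simp add: ydeg_def lookup_add sum.distrib)

lemma zdeg_add: "zdeg d (m + n) = zdeg d m + zdeg d n"
  by (simp add: zdeg_def lookup_add sum.distrib)

lemma ydeg_single [simp]:
  "i < d \<Longrightarrow> ydeg d (Poly_Mapping.single (Y i) n) = n" "ydeg d (Poly_Mapping.single (Z i) n) = 0"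
  by (auto simp: ydeg_def lookup_single when_def)

lemma zdeg_single [simp]:
  "i < d \<Longrightarrow> zdeg d (Poly_Mapping.single (Z i) n) = n" "zdeg d (Poly_Mapping.single (Y i) n) = 0"
  by (auto simp: zdeg_def lookup_single when_def)

lemma gcarrier_0 [simp]: "0 \<in> gcarrier d"
  by (simp add: mem_gcarrier)

lemma gcarrier_add: "a \<in> gcarrier d \<Longrightarrow> b \<in> gcarrier d \<Longrightarrow> a + b \<in> gcarrier d"
  using keys_add[of "fst a" "fst b"] keys_add[of "snd a" "snd b"]
  unfolding mem_gcarrier fst_add snd_add by blast

lemma gcarrier_scale: "a \<in> gcarrier d \<Longrightarrow> gscale c a \<in> gcarrier d"
  using keys_map_scale[of c "fst a"] keys_map_scale[of c "snd a"]
  by (auto simp: mem_gcarrier gscale_def)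

lemma gcarrier_gx [simp]: "i < d \<Longrightarrow> gx i \<in> gcarrier d"
  by (simp add: mem_gcarrier gx_def)

lemma gcarrier_uminus: "a \<in> gcarrier d \<Longrightarrow> - a \<in> gcarrier d"
  by (metis gcarrier_scale gscale_minus1)

lemma gcarrier_diff: "a \<in> gcarrier d \<Longrightarrow> b \<in> gcarrier d \<Longrightarrow> a - b \<in> gcarrier d"
  using gcarrier_add[of a d "- b"] by (simp add: gcarrier_uminus)

lemma gcarrier_sum: "(\<And>i. i \<in> I \<Longrightarrow> f i \<in> gcarrier d) \<Longrightarrow> (\<Sum>i\<in>I. f i) \<in> gcarrier d"
  by (induction I rule: infinite_finite_induct) (auto intro: gcarrier_add)

text \<open>One half of properness: a left factor supplies a y to each monomial and, by the twin for
  \<open>rgt\<close>, a right factor supplies a z. Together they make every product proper.\<close>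

lemma lft_keys:
  assumes "a \<in> gcarrier d" "m \<in> keys (lft a)"
  shows "keys m \<subseteq> vars d \<and> 1 \<le> ydeg d m"
proof -
  have "keys (linform Y v) \<subseteq> (\<lambda>i. Poly_Mapping.single (Y i) 1) ` keys v" for v :: "nat \<Rightarrow>\<^sub>0 'a"
    unfolding linform_def pvar_def pconst_mult_single
    by (rule order_trans[OF keys_sum]) auto
  from this[of "fst a"] have "m \<in> (\<lambda>i. Poly_Mapping.single (Y i) 1) ` keys (fst a) \<union> keys (snd a)"
    using assms(2) keys_add[of "linform Y (fst a)" "snd a"] unfolding lft_def by blast
  then show ?thesis using assms(1) by (auto simp: mem_gcarrier proper_mon_def vars_def)
qed

lemma rgt_keys:
  assumes "a \<in> gcarrier d" "m \<in> keys (rgt a)"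
  shows "keys m \<subseteq> vars d \<and> 1 \<le> zdeg d m"
proof -
  have "keys (linform Z v) \<subseteq> (\<lambda>i. Poly_Mapping.single (Z i) 1) ` keys v" for v :: "nat \<Rightarrow>\<^sub>0 'a"
    unfolding linform_def pvar_def pconst_mult_single
    by (rule order_trans[OF keys_sum]) auto
  from this[of "fst a"] have "m \<in> (\<lambda>i. Poly_Mapping.single (Z i) 1) ` keys (fst a) \<union> keys (snd a)"
    using assms(2) keys_add[of "linform Z (fst a)" "snd a"] unfolding rgt_def by blast
  then show ?thesis using assms(1) by (auto simp: mem_gcarrier proper_mon_def vars_def)
qed

lemma gcarrier_mult: "a \<in> gcarrier d \<Longrightarrow> b \<in> gcarrier d \<Longrightarrow> gmult a b \<in> gcarrier d"
proof -
  assume a: "a \<in> gcarrier d" and b: "b \<in> gcarrier d"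
  have "proper_mon d m" if m: "m \<in> keys (lft a * rgt b)" for m
  proof -
    obtain s t where st: "s \<in> keys (lft a)" "t \<in> keys (rgt b)" "m = s + t"
      using m keys_mult[of "lft a" "rgt b"] by blast
    show ?thesis
      using lft_keys[OF a st(1)] rgt_keys[OF b st(2)] keys_add[of s t] st(3)
      by (auto simp: proper_mon_def ydeg_add zdeg_add)
  qed
  then show "gmult a b \<in> gcarrier d" by (simp add: gmult_eq mem_gcarrier gpoly_def)
qed

text \<open>Proper monomials are given by the nonempty lists of the indices of their \<open>y\<close>'s and \<open>z\<close>'s.\<close>

definition ymon :: "nat list \<Rightarrow> 'k::comm_ring_1 yzpoly" where
  "ymon as = prod_list (map py as)"

definition zmon :: "nat list \<Rightarrow> 'k::comm_ring_1 yzpoly" where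
  "zmon bs = prod_list (map pz bs)"

definition list_exp :: "nat list \<Rightarrow> nat list \<Rightarrow> yz \<Rightarrow>\<^sub>0 nat" where
  "list_exp as bs = sum_list (map (\<lambda>i. Poly_Mapping.single (Y i) 1) as) +
     sum_list (map (\<lambda>i. Poly_Mapping.single (Z i) 1) bs)"

lemma ymon_simps [simp]: "ymon [] = 1" "ymon (a # as) = py a * ymon as"
  by (simp_all add: ymon_def)

lemma zmon_simps [simp]: "zmon [] = 1" "zmon (a # as) = pz a * zmon as"
  by (simp_all add: zmon_def)

lemma single_list_exp:
  "Poly_Mapping.single (list_exp as bs) 1 = (ymon as * zmon bs :: 'k::comm_ring_1 yzpoly)"
proof -
  have "Poly_Mapping.single (sum_list (map (\<lambda>i. Poly_Mapping.single (f i) 1) as)) 1 =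
      (prod_list (map (\<lambda>i. pvar (f i)) as) :: 'k yzpoly)" for f :: "nat \<Rightarrow> yz" and as
  proof (induction as)
    case (Cons a as)
    have "Poly_Mapping.single (Poly_Mapping.single (f a) 1 + e) 1 =
        pvar (f a) * (Poly_Mapping.single e 1 :: 'k yzpoly)" for e
      by (simp add: pvar_def mult_single)
    then show ?case by (simp only: list.map sum_list.Cons prod_list.Cons Cons)
  qed simp
  moreover have "Poly_Mapping.single (m + n) 1 = Poly_Mapping.single m 1 *
      (Poly_Mapping.single n 1 :: 'k yzpoly)" for m n
    by (simp add: mult_single)
  ultimately show ?thesis by (simp only: list_exp_def ymon_def zmon_def)
qed

lemma single_nat_eq_sum_list:
  "Poly_Mapping.single t n = sum_list (replicate n (Poly_Mapping.single t (1 :: nat)))"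
proof (induction n)
  case (Suc n)
  have "Poly_Mapping.single t (Suc n) = Poly_Mapping.single t 1 + Poly_Mapping.single t n"
    by (simp flip: single_add)
  then show ?case by (simp only: Suc replicate_Suc sum_list.Cons)
qed simp

lemma deg_list_exp:
  "set as \<subseteq> {..<d} \<Longrightarrow> ydeg d (list_exp as bs) = length as"
  "set bs \<subseteq> {..<d} \<Longrightarrow> zdeg d (list_exp as bs) = length bs"
proof -
  have "ydeg d (\<Sum>i\<leftarrow>as. Poly_Mapping.single (Y i) 1) = length as" if "set as \<subseteq> {..<d}" for as
    using that by (induction as) (auto simp: ydeg_add, simp add: ydeg_def)
  moreover have "ydeg d (\<Sum>i\<leftarrow>bs. Poly_Mapping.single (Z i) 1) = 0" for bs
    by (induction bs) (auto simp: ydeg_add, simp add: ydeg_def)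
  moreover have "zdeg d (\<Sum>i\<leftarrow>bs. Poly_Mapping.single (Z i) 1) = length bs"
    if "set bs \<subseteq> {..<d}" for bs
    using that by (induction bs) (auto simp: zdeg_add, simp add: zdeg_def)
  moreover have "zdeg d (\<Sum>i\<leftarrow>as. Poly_Mapping.single (Y i) 1) = 0" for as
    by (induction as) (auto simp: zdeg_add, simp add: zdeg_def)
  ultimately show "set as \<subseteq> {..<d} \<Longrightarrow> ydeg d (list_exp as bs) = length as"
    "set bs \<subseteq> {..<d} \<Longrightarrow> zdeg d (list_exp as bs) = length bs"
    by (simp_all add: list_exp_def ydeg_add zdeg_add)
qed

lemma exponent_lists:
  assumes "keys m \<subseteq> vars d"
  obtains as bs where "m = list_exp as bs" "set as \<subseteq> {..<d}" "set bs \<subseteq> {..<d}"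
proof -
  have "\<exists>as bs. m = list_exp as bs \<and> set as \<subseteq> {..<d} \<and> set bs \<subseteq> {..<d}"
  proof (induction m rule: poly_mapping_add_induct)
    case zero
    show ?case by (rule exI[of _ "[]"], rule exI[of _ "[]"]) (simp add: list_exp_def)
  next
    case (single t n)
    then have "t \<in> vars d" using assms by blast
    then consider i where "t = Y i" "i < d" | i where "t = Z i" "i < d"
      unfolding vars_def by blast
    then show ?case
    proof cases
      case 1
      have "Poly_Mapping.single (Y i) n = list_exp (replicate n i) []"
        by (subst single_nat_eq_sum_list) (simp add: list_exp_def)
      then show ?thesis
        by - (rule exI[of _ "replicate n i"], rule exI[of _ "[]"], use 1 in auto)
    next
      case 2
      have "Poly_Mapping.single (Z i) n = list_exp [] (replicate n i)"
        by (subst single_nat_eq_sum_list) (simp add: list_exp_def)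
      then show ?thesis
        by - (rule exI[of _ "[]"], rule exI[of _ "replicate n i"], use 2 in auto)
    qed
  next
    case (add q r)
    then obtain as bs as' bs' where "q = list_exp as bs" "r = list_exp as' bs'"
      "set as \<subseteq> {..<d}" "set bs \<subseteq> {..<d}" "set as' \<subseteq> {..<d}" "set bs' \<subseteq> {..<d}"
      by blast
    then show ?case
      by - (rule exI[of _ "as @ as'"], rule exI[of _ "bs @ bs'"], simp add: list_exp_def add_ac)
  qed
  then show thesis using that by blast
qed

lemma proper_mon_lists:
  assumes "proper_mon d m"
  obtains as bs where "m = list_exp as bs" "set as \<subseteq> {..<d}" "set bs \<subseteq> {..<d}"
    "as \<noteq> []" "bs \<noteq> []" "length as + length bs = ydeg d m + zdeg d m"
proof -
  from assms obtain as bs where *: "m = list_exp as bs" "set as \<subseteq> {..<d}" "set bs \<subseteq> {..<d}"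
    by (meson proper_mon_def exponent_lists)
  with assms show thesis
    by (intro that[of as bs]) (auto simp: deg_list_exp proper_mon_def)
qed

section \<open>Endomorphisms\<close>

lemma G_simps [simp]:
  "acarrier (G d) = gcarrier d" "azero (G d) = 0" "aplus (G d) = (+)" "ascale (G d) = gscale"
  "amult (G d) = gmult"
  by (simp_all add: G_def)

text \<open>The \<open>gx i\<close> generate the algebra: starting from a product of two generators,
  right multiplications adjoin further z's, then left multiplications adjoin further y's, and every
  proper monomial is reached. Closure of \<open>S\<close> is demanded inside the carrier only,
  because the principle is also applied to maps that are homomorphic only there.\<close>

lemma gcarrier_generated:
  assumes zero: "0 \<in> S"
    and gx: "\<And>i. i < d \<Longrightarrow> gx i \<in> S"
    and add: "\<And>a b. a \<in> gcarrier d \<Longrightarrow> b \<in> gcarrier d \<Longrightarrow> a \<in> S \<Longrightarrow> b \<in> S \<Longrightarrow> a + b \<in> S"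
    and scale: "\<And>c a. a \<in> gcarrier d \<Longrightarrow> a \<in> S \<Longrightarrow> gscale c a \<in> S"
    and mult: "\<And>a b. a \<in> gcarrier d \<Longrightarrow> b \<in> gcarrier d \<Longrightarrow> a \<in> S \<Longrightarrow> b \<in> S \<Longrightarrow> gmult a b \<in> S"
    and a: "a \<in> gcarrier d"
  shows "a \<in> (S :: 'k::comm_ring_1 gelem set)"
proof -
  define T where "T = S \<inter> gcarrier d"
  have T: "0 \<in> T" "\<And>i. i < d \<Longrightarrow> gx i \<in> T" "\<And>a b. a \<in> T \<Longrightarrow> b \<in> T \<Longrightarrow> a + b \<in> T"
    "\<And>c a. a \<in> T \<Longrightarrow> gscale c a \<in> T" "\<And>a b. a \<in> T \<Longrightarrow> b \<in> T \<Longrightarrow> gmult a b \<in> T"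
    using assms by (auto simp: T_def gcarrier_add gcarrier_scale gcarrier_mult)
  have z: "gpoly (py i * zmon bs) \<in> T" if "i < d" "set bs \<subseteq> {..<d}" "bs \<noteq> []" for i bs
    using that(3,2)
  proof (induction bs rule: list_nonempty_induct)
    case (single b)
    then show ?case using T(5)[OF T(2) T(2), of i b] that(1) by (simp add: gmult_eq)
  next
    case (cons b bs)
    then show ?case using T(5)[OF _ T(2), of "gpoly (py i * zmon bs)" b]
      by (simp add: gmult_eq mult_ac)
  qed
  have yz: "gpoly (ymon as * zmon bs) \<in> T"
    if "as \<noteq> []" "set as \<subseteq> {..<d}" "set bs \<subseteq> {..<d}" "bs \<noteq> []" for as bs
    using that(1,2)
  proof (induction as rule: list_nonempty_induct)
    case (single b)
    then show ?case using z that by simp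
  next
    case (cons b as)
    then show ?case using T(5)[OF T(2), of b "gpoly (ymon as * zmon bs)"]
      by (simp add: gmult_eq mult_ac)
  qed
  have "gpoly p \<in> T" if "\<forall>m\<in>keys p. proper_mon d m" for p
  proof (induction p rule: poly_mapping_add_induct)
    case (single m c)
    with that obtain as bs where "m = list_exp as bs" "set as \<subseteq> {..<d}" "set bs \<subseteq> {..<d}"
      "as \<noteq> []" "bs \<noteq> []"
      by (metis proper_mon_lists)
    moreover have "Poly_Mapping.single m c = pconst c * Poly_Mapping.single m 1"
      by (simp add: pconst_mult_single)
    ultimately show ?case
      using T(4)[OF yz, of as bs c] by (simp add: gscale_gpoly single_list_exp)
  qed (simp_all add: T gpoly_add)
  then have "gpoly (snd a) \<in> T" using a by (simp add: mem_gcarrier)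
  moreover have "(\<Sum>i\<in>I. gscale (c i) (gx i)) \<in> T" if "I \<subseteq> {..<d}" for I c
    using that by (induction I rule: infinite_finite_induct) (auto intro: T)
  ultimately have "(\<Sum>i\<in>keys (fst a). gscale (lookup (fst a) i) (gx i)) + gpoly (snd a) \<in> T"
    using a by (intro T(3)) (auto simp: mem_gcarrier)
  then show ?thesis using gelem_decomp[of a] by (simp add: T_def)
qed

definition subst_var :: "(nat \<Rightarrow> 'k gelem) \<Rightarrow> yz \<Rightarrow> 'k::comm_ring_1 yzpoly" where
  "subst_var A t = (case t of Y i \<Rightarrow> lft (A i) | Z i \<Rightarrow> rgt (A i))"

lemma subst_var_simps [simp]: "subst_var A (Y i) = lft (A i)" "subst_var A (Z i) = rgt (A i)"
  by (simp_all add: subst_var_def)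

definition subst_endo :: "(nat \<Rightarrow> 'k gelem) \<Rightarrow> 'k gelem \<Rightarrow> 'k::comm_ring_1 gelem" where
  "subst_endo A a = (\<Sum>i\<in>keys (fst a). gscale (lookup (fst a) i) (A i)) +
     gpoly (psubst (subst_var A) (snd a))"

lemma subst_endo_gpoly: "subst_endo A (gpoly p) = gpoly (psubst (subst_var A) p)"
  by (simp add: subst_endo_def gpoly_def)

lemma subst_endo_gx: "subst_endo A (gx i) = A i"
  by (simp add: subst_endo_def gx_def)

lemma subst_endo_add: "subst_endo A (a + b) = subst_endo A a + subst_endo A b"
proof -
  have "(\<Sum>i\<in>keys (v + w). gscale (lookup (v + w) i) (A i)) =
    (\<Sum>i\<in>keys v. gscale (lookup v i) (A i)) + (\<Sum>i\<in>keys w. gscale (lookup w i) (A i))" for v w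
    by (rule setsum_keys_plus_distrib) (simp_all add: gscale_add_left)
  then show ?thesis by (simp add: subst_endo_def psubst_add gpoly_add algebra_simps)
qed

lemma subst_endo_scale: "subst_endo A (gscale c a) = gscale c (subst_endo A a)"
proof -
  have "(\<Sum>i\<in>keys (Poly_Mapping.map ((*) c) v). gscale (lookup (Poly_Mapping.map ((*) c) v) i) (A i)) =
    (\<Sum>i\<in>keys v. gscale (lookup (Poly_Mapping.map ((*) c) v) i) (A i))" for v
    by (rule sum.mono_neutral_left) (auto simp: keys_map_scale in_keys_iff simp del: keys_map_scale
        dest: subsetD[OF keys_map_scale])
  then show ?thesis
    by (simp add: subst_endo_def gscale_add gscale_sum gscale_gscale gscale_gpoly lookup_map_scale)
       (simp add: gscale_def map_scale_pconst psubst_mult lookup_map_scale)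
qed

text \<open>The left operator meets the linear part through the variables \<open>Y i\<close>, which
  \<open>subst_var A\<close> sends to \<open>lft (A i)\<close>. With the twin for \<open>rgt\<close>
  this gives multiplicativity of \<open>subst_endo\<close> at once.\<close>

lemma lft_subst_endo: "lft (subst_endo A a) = psubst (subst_var A) (lft a)"
  by (simp add: subst_endo_def lft_sum) (simp add: lft_def psubst_add psubst_linform)

lemma rgt_subst_endo: "rgt (subst_endo A a) = psubst (subst_var A) (rgt a)"
  by (simp add: subst_endo_def rgt_sum) (simp add: rgt_def psubst_add psubst_linform)

lemma subst_endo_mult: "subst_endo A (gmult a b) = gmult (subst_endo A a) (subst_endo A b)"
  by (simp add: gmult_eq lft_subst_endo rgt_subst_endo subst_endo_gpoly psubst_mult)

lemma subst_endo_carrier: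
  assumes "\<And>i. i < d \<Longrightarrow> A i \<in> gcarrier d" "a \<in> gcarrier d"
  shows "subst_endo A a \<in> gcarrier d"
proof -
  have "a \<in> {a. subst_endo A a \<in> gcarrier d}"
    by (rule gcarrier_generated[OF _ _ _ _ _ assms(2)])
       (use assms(1) in \<open>auto simp: subst_endo_gx subst_endo_add subst_endo_scale subst_endo_mult
          gcarrier_add gcarrier_scale gcarrier_mult subst_endo_gpoly[of A 0, simplified]\<close>)
  then show ?thesis by simp
qed

lemma aendo_subst_endo:
  assumes "\<And>i. i < d \<Longrightarrow> A i \<in> gcarrier d"
  shows "aendo (G d) (subst_endo A)"
  using subst_endo_carrier[of d A] assms
  by (auto simp: aendo_def subst_endo_add subst_endo_scale subst_endo_mult)


section \<open>T-ideals and factor algebras\<close>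

lemma T_idealD:
  assumes "T_ideal A I"
  shows "u \<in> I \<Longrightarrow> u \<in> acarrier A" "azero A \<in> I" "u \<in> I \<Longrightarrow> v \<in> I \<Longrightarrow> aplus A u v \<in> I"
    "u \<in> I \<Longrightarrow> ascale A c u \<in> I" "a \<in> acarrier A \<Longrightarrow> u \<in> I \<Longrightarrow> amult A a u \<in> I"
    "a \<in> acarrier A \<Longrightarrow> u \<in> I \<Longrightarrow> amult A u a \<in> I" "aendo A \<phi> \<Longrightarrow> u \<in> I \<Longrightarrow> \<phi> u \<in> I"
  using assms by (auto simp: T_ideal_def aideal_def asubspace_def image_subset_iff)

lemma T_idealI:
  assumes "\<And>u. u \<in> I \<Longrightarrow> u \<in> acarrier A" "azero A \<in> I"
    "\<And>u v. u \<in> I \<Longrightarrow> v \<in> I \<Longrightarrow> aplus A u v \<in> I" "\<And>c u. u \<in> I \<Longrightarrow> ascale A c u \<in> I"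
    "\<And>a u. a \<in> acarrier A \<Longrightarrow> u \<in> I \<Longrightarrow> amult A a u \<in> I"
    "\<And>a u. a \<in> acarrier A \<Longrightarrow> u \<in> I \<Longrightarrow> amult A u a \<in> I"
    "\<And>\<phi> u. aendo A \<phi> \<Longrightarrow> u \<in> I \<Longrightarrow> \<phi> u \<in> I"
  shows "T_ideal A I"
  by (simp add: assms(1-6) T_ideal_def aideal_def asubspace_def subset_iff)
     (use assms(7) in blast)

text \<open>The hypotheses put the whole carrier among the T-ideals that are intersected; an empty
  intersection would be the full type.\<close>

lemma T_ideal_T_ideal_gen:
  assumes "T_ideal A (acarrier A)" "S \<subseteq> acarrier A"
  shows "T_ideal A (T_ideal_gen A S)"
proof (rule T_idealI)
  show "u \<in> acarrier A" if "u \<in> T_ideal_gen A S" for u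
    using assms that by (auto simp: T_ideal_gen_def)
qed (unfold T_ideal_gen_def, (blast intro: T_idealD(2-7))+)

lemma T_ideal_gen_superset: "S \<subseteq> T_ideal_gen A S"
  by (auto simp: T_ideal_gen_def)

lemma T_ideal_gen_least: "T_ideal A I \<Longrightarrow> S \<subseteq> I \<Longrightarrow> T_ideal_gen A S \<subseteq> I"
  by (auto simp: T_ideal_gen_def)

lemma T_ideal_gcarrier: "T_ideal (G d) (gcarrier d)"
  by (auto simp: T_ideal_def aideal_def asubspace_def aendo_def gcarrier_add gcarrier_scale
      gcarrier_mult)

lemma aidealD:
  assumes "aideal (G d) I"
  shows "I \<subseteq> gcarrier d" "0 \<in> I" "u \<in> I \<Longrightarrow> v \<in> I \<Longrightarrow> u + v \<in> I" "u \<in> I \<Longrightarrow> gscale c u \<in> I"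
    "a \<in> gcarrier d \<Longrightarrow> u \<in> I \<Longrightarrow> gmult a u \<in> I" "a \<in> gcarrier d \<Longrightarrow> u \<in> I \<Longrightarrow> gmult u a \<in> I"
  using assms by (auto simp: aideal_def asubspace_def)

lemma aideal_diff: "aideal (G d) I \<Longrightarrow> u \<in> I \<Longrightarrow> v \<in> I \<Longrightarrow> u - v \<in> I"
  using aidealD(3)[of d I u "gscale (-1) v"] aidealD(4)[of d I v "-1"]
  by (simp add: gscale_minus1)

lemma T_ideal_subst_endo:
  "T_ideal (G d) I \<Longrightarrow> (\<And>i. i < d \<Longrightarrow> A i \<in> gcarrier d) \<Longrightarrow> a \<in> I \<Longrightarrow> subst_endo A a \<in> I"
  using aendo_subst_endo unfolding T_ideal_def by blast

lemma mem_acoset: "x \<in> acoset (G d) I a \<longleftrightarrow> x - a \<in> I"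
  by (auto simp: acoset_def image_iff intro: bexI[of _ "x - a"])

lemma acoset_eq_iff:
  assumes "aideal (G d) I"
  shows "acoset (G d) I a = acoset (G d) I b \<longleftrightarrow> a - b \<in> I"
proof
  assume "acoset (G d) I a = acoset (G d) I b"
  moreover have "a \<in> acoset (G d) I a" using aidealD[OF assms] by (simp add: mem_acoset)
  ultimately show "a - b \<in> I" by (simp add: mem_acoset)
next
  assume ab: "a - b \<in> I"
  have "x - a \<in> I \<longleftrightarrow> x - b \<in> I" for x
    using aidealD(3)[OF assms _ ab, of "x - a"] aideal_diff[OF assms _ ab, of "x - b"] by auto
  then show "acoset (G d) I a = acoset (G d) I b" by (auto simp: mem_acoset)
qed

lemma mem_acoset_self: "aideal (G d) I \<Longrightarrow> a \<in> acoset (G d) I a"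
  by (simp add: mem_acoset aidealD)

lemma mem_acoset_carrier:
  "aideal (G d) I \<Longrightarrow> a \<in> gcarrier d \<Longrightarrow> x \<in> acoset (G d) I a \<Longrightarrow> x \<in> gcarrier d"
  using gcarrier_add[of a d "x - a"] aidealD(1) by (fastforce simp: mem_acoset)

text \<open>The unions over representatives in \<open>afactor\<close> are unions of equal cosets
  because \<open>I\<close> is an ideal, and since cosets are nonempty each union is a single
  coset.\<close>

lemma afactor_simps:
  assumes I: "aideal (G d) I" and a: "a \<in> gcarrier d" and b: "b \<in> gcarrier d"
  shows "aplus (afactor (G d) I) (acoset (G d) I a) (acoset (G d) I b) = acoset (G d) I (a + b)"
    and "ascale (afactor (G d) I) c (acoset (G d) I a) = acoset (G d) I (gscale c a)"
    and "amult (afactor (G d) I) (acoset (G d) I a) (acoset (G d) I b) = acoset (G d) I (gmult a b)"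
proof -
  let ?c = "acoset (G d) I"
  have 1: "?c (x + y) = ?c (a + b)" if "x \<in> ?c a" "y \<in> ?c b" for x y
    using aidealD(3)[OF I, of "x - a" "y - b"] that
    by (subst acoset_eq_iff[OF I]) (simp add: mem_acoset algebra_simps)
  have 2: "?c (gscale c x) = ?c (gscale c a)" if "x \<in> ?c a" for x
  proof -
    have "gscale c x - gscale c a = gscale c (x - a)"
      using gscale_add[of c "x - a" a] by simp
    then show ?thesis using aidealD(4)[OF I] that
      by (subst acoset_eq_iff[OF I]) (simp add: mem_acoset)
  qed
  have 3: "?c (gmult x y) = ?c (gmult a b)" if "x \<in> ?c a" "y \<in> ?c b" for x y
  proof -
    have *: "lft x = lft (x - a) + lft a" "rgt y = rgt (y - b) + rgt b"
      by (simp_all flip: lft_simps rgt_simps)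
    have "gmult x y - gmult a b = gmult (x - a) y + gmult a (y - b)"
      by (simp add: gmult_eq * flip: gpoly_add gpoly_diff) (simp add: algebra_simps)
    moreover have "gmult (x - a) y \<in> I" "gmult a (y - b) \<in> I"
      using that aidealD(5,6)[OF I] mem_acoset_carrier[OF I b that(2)] a
      by (simp_all add: mem_acoset)
    ultimately show ?thesis using aidealD(3)[OF I] by (simp add: acoset_eq_iff[OF I])
  qed
  have ne: "?c a \<noteq> {}" "?c b \<noteq> {}" using mem_acoset_self[OF I] by blast+
  show "aplus (afactor (G d) I) (?c a) (?c b) = ?c (a + b)"
    using ne by (simp add: afactor_def 1 cong: SUP_cong_simp)
  show "ascale (afactor (G d) I) c (?c a) = ?c (gscale c a)"
    using ne by (simp add: afactor_def 2 cong: SUP_cong_simp)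
  show "amult (afactor (G d) I) (?c a) (?c b) = ?c (gmult a b)"
    using ne by (simp add: afactor_def 3 cong: SUP_cong_simp)
qed

lemma afactor_carrier:
  "acarrier (afactor (G d) I) = acoset (G d) I ` gcarrier d"
  "azero (afactor (G d) I) = acoset (G d) I 0"
  by (simp_all add: afactor_def)

lemma T_ideal_afactor_carrier:
  assumes "aideal (G d) I"
  shows "T_ideal (afactor (G d) I) (acarrier (afactor (G d) I))"
  by (simp add: T_ideal_def aideal_def asubspace_def aendo_def afactor_carrier
      afactor_simps[OF assms] gcarrier_add gcarrier_scale gcarrier_mult)

lemma aendo_afactor:
  assumes I: "aideal (G d) I" and \<phi>: "aendo (G d) \<phi>" "\<phi> ` I \<subseteq> I"
  obtains \<Phi> where "aendo (afactor (G d) I) \<Phi>"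
    "\<And>a. a \<in> gcarrier d \<Longrightarrow> \<Phi> (acoset (G d) I a) = acoset (G d) I (\<phi> a)"
proof -
  let ?c = "acoset (G d) I"
  define \<Phi> where "\<Phi> C = ?c (\<phi> (SOME a. a \<in> gcarrier d \<and> C = ?c a))" for C
  have \<phi>': "\<phi> (a + b) = \<phi> a + \<phi> b" "\<phi> (gscale c a) = gscale c (\<phi> a)" "\<phi> (gmult a b) = gmult (\<phi> a) (\<phi> b)"
    "\<phi> a \<in> gcarrier d" if "a \<in> gcarrier d" "b \<in> gcarrier d" for a b c
    using \<phi>(1) that by (auto simp: aendo_def)
  have *: "\<Phi> (?c a) = ?c (\<phi> a)" if a: "a \<in> gcarrier d" for a
  proof -
    define b where "b = (SOME b. b \<in> gcarrier d \<and> ?c a = ?c b)"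
    have b: "b \<in> gcarrier d \<and> ?c a = ?c b"
      unfolding b_def by (rule someI[of _ a]) (use a in simp)
    then have "b - a \<in> I" using acoset_eq_iff[OF I, of b a] by simp
    \<comment> \<open>Additivity of \<open>\<phi>\<close> is available on the carrier only, so the
      difference is split off as a summand that lies in \<open>I\<close> and hence in the
      carrier.\<close>
    moreover from this have "\<phi> b = \<phi> (b - a) + \<phi> a"
      using \<phi>'(1)[of "b - a" a] a aidealD(1)[OF I] by auto
    ultimately have "\<phi> b - \<phi> a \<in> I" using \<phi>(2) by auto
    then show ?thesis unfolding \<Phi>_def b_def[symmetric] by (simp only: acoset_eq_iff[OF I])
  qed
  have "aendo (afactor (G d) I) \<Phi>"
    unfolding aendo_def
    by (simp add: afactor_carrier image_subset_iff afactor_simps[OF I] * \<phi>' gcarrier_add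
        gcarrier_scale gcarrier_mult)
  then show thesis using that * by blast
qed

text \<open>Every endomorphism of \<open>G d\<close> preserves the T-ideal \<open>I\<close> and
  therefore descends. This moves T-ideals of the factor algebra back to \<open>G d\<close>, where
  consequences can be derived by computing with polynomials.\<close>

lemma T_ideal_preimage:
  assumes I: "T_ideal (G d) I" and T: "T_ideal (afactor (G d) I) T"
  shows "T_ideal (G d) {a \<in> gcarrier d. acoset (G d) I a \<in> T}"
    and "I \<subseteq> {a \<in> gcarrier d. acoset (G d) I a \<in> T}"
proof -
  let ?c = "acoset (G d) I"
  have I': "aideal (G d) I" using I by (simp add: T_ideal_def)
  have T0: "?c 0 \<in> T"
    and Tadd: "u \<in> T \<Longrightarrow> v \<in> T \<Longrightarrow> aplus (afactor (G d) I) u v \<in> T"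
    and Tscale: "u \<in> T \<Longrightarrow> ascale (afactor (G d) I) c u \<in> T"
    and Tmult: "a \<in> acarrier (afactor (G d) I) \<Longrightarrow> u \<in> T \<Longrightarrow>
       amult (afactor (G d) I) a u \<in> T \<and> amult (afactor (G d) I) u a \<in> T" for u v c a
    using T by (auto simp: T_ideal_def aideal_def asubspace_def afactor_carrier)
  show "I \<subseteq> {a \<in> gcarrier d. ?c a \<in> T}"
  proof
    fix a assume a: "a \<in> I"
    then have "?c a = ?c 0" by (simp add: acoset_eq_iff[OF I'])
    then show "a \<in> {a \<in> gcarrier d. ?c a \<in> T}" using a T0 aidealD(1)[OF I'] by auto
  qed
  have endo: "?c (\<phi> a) \<in> T" if \<phi>: "aendo (G d) \<phi>" and a: "a \<in> gcarrier d" "?c a \<in> T" for \<phi> a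
  proof -
    have "\<phi> ` I \<subseteq> I" using I \<phi> by (simp add: T_ideal_def)
    with aendo_afactor[OF I' \<phi>] obtain \<Phi> where
      "aendo (afactor (G d) I) \<Phi>" "\<Phi> (?c a) = ?c (\<phi> a)" using a(1) by metis
    then show ?thesis using T_idealD(7)[OF T] a(2) by metis
  qed
  have carr: "\<phi> a \<in> gcarrier d" if "aendo (G d) \<phi>" "a \<in> gcarrier d" for \<phi> a
    using that by (auto simp: aendo_def)
  have mult: "?c (gmult a u) \<in> T" "?c (gmult u a) \<in> T"
    if "a \<in> gcarrier d" "u \<in> gcarrier d" "?c u \<in> T" for a u
    using Tmult[of "?c a" "?c u"] that afactor_simps(3)[OF I'] by (auto simp: afactor_carrier)
  have add: "?c (u + v) \<in> T" if "v \<in> gcarrier d" "u \<in> gcarrier d" "?c u \<in> T" "?c v \<in> T" for u v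
    using Tadd[of "?c u" "?c v"] that afactor_simps(1)[OF I'] by auto
  have scale: "?c (gscale c u) \<in> T" if "u \<in> gcarrier d" "?c u \<in> T" for u c
    using Tscale[of "?c u" c] that afactor_simps(2)[OF I'] by auto
  show "T_ideal (G d) {a \<in> gcarrier d. ?c a \<in> T}"
    by (rule T_idealI)
       (simp_all add: T0 endo carr mult add scale gcarrier_add gcarrier_scale gcarrier_mult)
qed


section \<open>The general linear group\<close>

definition gl_tuple :: "nat \<Rightarrow> 'k::comm_ring_1 mat \<Rightarrow> nat \<Rightarrow> 'k gelem" where
  "gl_tuple d g j = (\<Sum>i<d. gscale (g $$ (i, j)) (gx i))"

lemma gl_tuple_carrier: "gl_tuple d g j \<in> gcarrier d"
  by (auto simp: gl_tuple_def intro!: gcarrier_sum gcarrier_scale)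

text \<open>The carrier condition reconciles two sums over the linear part: \<open>gl_act\<close>
  runs over the indices below \<open>d\<close>, \<open>subst_endo\<close> over the support.\<close>

lemma gl_act_eq:
  assumes "a \<in> gcarrier d"
  shows "gl_act d g a = subst_endo (gl_tuple d g) a"
proof -
  have "gl_var d g = subst_var (gl_tuple d g)"
  proof
    fix t show "gl_var d g t = subst_var (gl_tuple d g) t"
      by (cases t) (simp_all add: gl_tuple_def lft_sum rgt_sum)
  qed
  moreover have "(\<Sum>j<d. \<Sum>i<d. Poly_Mapping.single i (g $$ (i, j) * lookup (fst a) j)) =
      (\<Sum>j\<in>keys (fst a). fst (gscale (lookup (fst a) j) (gl_tuple d g j)))"
  proof -
    have e: "(\<Sum>i<d. Poly_Mapping.single i (g $$ (i, j) * c)) = fst (gscale c (gl_tuple d g j))" for j c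
      by (simp add: gl_tuple_def gscale_sum gscale_gscale fst_sum)
         (simp add: gscale_def gx_def mult.commute)
    show ?thesis unfolding e
      by (rule sum.mono_neutral_right) (use assms in \<open>auto simp: mem_gcarrier in_keys_iff\<close>)
  qed
  moreover have "snd (gl_tuple d g j) = 0" for j
    by (simp add: gl_tuple_def snd_sum gscale_def gx_def map_eq_zero_iff[THEN iffD2])
  ultimately show ?thesis
    by (simp add: gl_act_def subst_endo_def gpoly_def prod_eq_iff fst_sum snd_sum)
       (simp add: gscale_def map_eq_zero_iff[THEN iffD2])
qed

text \<open>Both sides respect the operations, so generators suffice; on \<open>gx j\<close> the
  composite has the entries of column \<open>j\<close> of \<open>g * h\<close> as
  coefficients.\<close>

lemma subst_endo_gl_inverse:
  fixes g h :: "'k::comm_ring_1 mat"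
  assumes g: "g \<in> carrier_mat d d" and h: "h \<in> carrier_mat d d" and gh: "g * h = 1\<^sub>m d"
    and a: "a \<in> gcarrier d"
  shows "subst_endo (gl_tuple d g) (subst_endo (gl_tuple d h) a) = a"
proof -
  let ?g = "subst_endo (gl_tuple d g)" and ?h = "subst_endo (gl_tuple d h)"
  have gsum: "?g (\<Sum>i\<in>I. f i) = (\<Sum>i\<in>I. ?g (f i))" for I and f :: "nat \<Rightarrow> 'k gelem"
    by (induction I rule: infinite_finite_induct)
       (simp_all add: subst_endo_add subst_endo_gpoly[of _ 0, simplified])
  have gen: "?g (?h (gx j)) = gx j" if j: "j < d" for j
  proof -
    have "?g (?h (gx j)) = (\<Sum>i<d. \<Sum>k<d. gscale (h $$ (i, j) * g $$ (k, i)) (gx k))"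
      by (simp add: subst_endo_gx gl_tuple_def[of d h] gsum subst_endo_scale)
         (simp add: gl_tuple_def gscale_sum gscale_gscale)
    also have "\<dots> = (\<Sum>k<d. \<Sum>i<d. gscale (h $$ (i, j) * g $$ (k, i)) (gx k))"
      by (rule sum.swap)
    also have "\<dots> = (\<Sum>k<d. gscale (\<Sum>i<d. h $$ (i, j) * g $$ (k, i)) (gx k))"
    proof -
      have "gscale (\<Sum>i\<in>I. c i) b = (\<Sum>i\<in>I. gscale (c i) b)" for I b and c :: "nat \<Rightarrow> 'k"
        by (induction I rule: infinite_finite_induct) (simp_all add: gscale_add_left)
      then show ?thesis by simp
    qed
    also have "\<dots> = (\<Sum>k<d. gscale (if k = j then 1 else 0) (gx k))"
    proof (rule sum.cong[OF refl])
      fix k assume k: "k \<in> {..<d}"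
      have "(\<Sum>i<d. h $$ (i, j) * g $$ (k, i)) = (g * h) $$ (k, j)"
        using g h k j by (simp add: scalar_prod_def mult.commute atLeast0LessThan)
      then show "gscale (\<Sum>i<d. h $$ (i, j) * g $$ (k, i)) (gx k) = gscale (if k = j then 1 else 0) (gx k)"
        using k j by (simp add: gh)
    qed
    also have "\<dots> = gx j" using j by (simp add: if_distrib[of "\<lambda>c. gscale c _"] cong: if_cong)
    finally show ?thesis .
  qed
  have "a \<in> {a. ?g (?h a) = a}"
    by (rule gcarrier_generated[OF _ _ _ _ _ a])
       (auto simp: gen subst_endo_add subst_endo_scale subst_endo_mult
          subst_endo_gpoly[of _ 0, simplified])
  then show ?thesis by simp
qed

text \<open>That the image is the full coset, and not only a part of it, uses that \<open>I\<close>
  is stable under the substitution of the inverse matrix as well.\<close>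

lemma gl_act_acoset:
  assumes I: "T_ideal (G d) I" and g: "g \<in> GLd d" and a: "a \<in> gcarrier d"
  shows "gl_act d g ` acoset (G d) I a = acoset (G d) I (subst_endo (gl_tuple d g) a)"
proof -
  let ?g = "subst_endo (gl_tuple d g)"
  have I': "aideal (G d) I" using I by (simp add: T_ideal_def)
  have gc: "g \<in> carrier_mat d d" and "invertible_mat g" using g by (auto simp: GLd_def)
  then obtain h where h: "inverts_mat g h" "inverts_mat h g" by (auto simp: invertible_mat_def)
  then have gh: "g * h = 1\<^sub>m d" and hg: "h * g = 1\<^sub>m (dim_row h)" using gc by (auto simp: inverts_mat_def)
  \<comment> \<open>\<open>inverts_mat\<close> does not prescribe the size of \<open>h\<close>; it
    is read off from the two products.\<close>
  have hc: "h \<in> carrier_mat d d"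
  proof
    show "dim_col h = d" using arg_cong[OF gh, of dim_col] by simp
    show "dim_row h = d" using arg_cong[OF hg, of dim_col] gc by simp
  qed
  let ?h = "subst_endo (gl_tuple d h)"
  have inI: "?g i \<in> I" "?h i \<in> I" if "i \<in> I" for i
    using T_ideal_subst_endo[OF I _ that] gl_tuple_carrier by blast+
  have "gl_act d g ` acoset (G d) I a = ?g ` acoset (G d) I a"
    by (rule image_cong) (auto intro: gl_act_eq mem_acoset_carrier[OF I' a])
  also have "\<dots> = acoset (G d) I (?g a)"
  proof (intro equalityI subsetI)
    fix x assume "x \<in> ?g ` acoset (G d) I a"
    then obtain i where i: "i \<in> I" "x = ?g (a + i)" by (auto simp: acoset_def)
    then show "x \<in> acoset (G d) I (?g a)" using inI by (simp add: mem_acoset subst_endo_add)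
  next
    fix x assume x: "x \<in> acoset (G d) I (?g a)"
    then have i: "x - ?g a \<in> I" by (simp add: mem_acoset)
    have "x = ?g (a + ?h (x - ?g a))"
      using subst_endo_gl_inverse[OF gc hc gh, of "x - ?g a"] aidealD(1)[OF I'] i
      by (auto simp: subst_endo_add)
    moreover have "a + ?h (x - ?g a) \<in> acoset (G d) I a" using inI i by (simp add: mem_acoset)
    ultimately show "x \<in> ?g ` acoset (G d) I a" by blast
  qed
  finally show ?thesis .
qed


section \<open>The commutative quotient\<close>

text \<open>\<open>collapse\<close> is the homomorphism from \<open>G\<^sub>d\<close> to polynomials that
  identifies \<open>x\<^sub>i\<close>, \<open>y\<^sub>i\<close> and \<open>z\<^sub>i\<close>. Its kernel is a T-ideal because every
  homomorphism from \<open>G\<^sub>d\<close> to a commutative associative algebra factors through it.\<close>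

definition collapse_var :: "yz \<Rightarrow> 'k::comm_ring_1 yzpoly" where
  "collapse_var t = (case t of Y i \<Rightarrow> py i | Z i \<Rightarrow> py i)"

lemma collapse_var_simps [simp]: "collapse_var (Y i) = py i" "collapse_var (Z i) = py i"
  by (simp_all add: collapse_var_def)

definition collapse :: "'k::comm_ring_1 gelem \<Rightarrow> 'k yzpoly" where
  "collapse a = psubst collapse_var (lft a)"

lemma collapse_rgt: "collapse a = psubst collapse_var (rgt a)"
  by (simp add: collapse_def lft_def rgt_def psubst_add psubst_linform)

lemma collapse_simps [simp]:
  "collapse (a + b) = collapse a + collapse b" "collapse (gscale c a) = pconst c * collapse a"
  "collapse (gx i) = py i" "collapse 0 = 0" "collapse (gpoly p) = psubst collapse_var p"
  "collapse (gmult a b) = collapse a * collapse b"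
  by (simp_all add: collapse_def psubst_add psubst_mult gmult_eq
      flip: collapse_rgt[unfolded collapse_def])

lemma collapse_skew12 [simp]: "psubst collapse_var skew12 = 0"
  by (simp add: skew12_def psubst_diff psubst_mult mult.commute)

lemma collapse_factor:
  fixes h :: "'k::comm_ring_1 gelem \<Rightarrow> 'k yzpoly"
  assumes add: "\<And>a b. a \<in> gcarrier d \<Longrightarrow> b \<in> gcarrier d \<Longrightarrow> h (a + b) = h a + h b"
    and scale: "\<And>c a. a \<in> gcarrier d \<Longrightarrow> h (gscale c a) = pconst c * h a"
    and mult: "\<And>a b. a \<in> gcarrier d \<Longrightarrow> b \<in> gcarrier d \<Longrightarrow> h (gmult a b) = h a * h b"
    and a: "a \<in> gcarrier d" "collapse a = 0"
  shows "h a = 0"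
proof -
  \<comment> \<open>The image of \<open>collapse\<close> consists of polynomials in the
    \<open>py i\<close>, so the values at the \<open>Y i\<close> determine the factorization; 0 is a
    default at the \<open>Z i\<close>.\<close>
  let ?\<tau> = "\<lambda>t. case t of Y i \<Rightarrow> h (gx i) | Z i \<Rightarrow> 0"
  have "h 0 = 0" using scale[of 0 0] by simp
  then have "a \<in> {a. h a = psubst ?\<tau> (collapse a)}"
    by (intro gcarrier_generated[OF _ _ _ _ _ a(1)])
       (auto simp: add scale mult psubst_add psubst_mult simp del: collapse_simps(5))
  then show ?thesis using a(2) by simp
qed

lemma T_ideal_collapse: "T_ideal (G d) {a \<in> gcarrier d. collapse a = (0 :: 'k::comm_ring_1 yzpoly)}"
proof -
  have "collapse (\<phi> a) = 0" if \<phi>: "aendo (G d) \<phi>" and a: "a \<in> gcarrier d" "collapse a = 0"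
    for \<phi> and a :: "'k gelem"
    by (rule collapse_factor[OF _ _ _ a]) (use \<phi> in \<open>auto simp: aendo_def\<close>)
  then show ?thesis
    by (intro T_idealI) (auto simp: aendo_def gcarrier_add gcarrier_scale gcarrier_mult)
qed

text \<open>Choosing a representative \<open>r a\<close> of each image coset yields a map that is a
  homomorphism only modulo \<open>I\<close>. As \<open>collapse\<close> vanishes on
  \<open>I\<close>, following \<open>r\<close> by \<open>collapse\<close> gives a true homomorphism
  into polynomials, and \<open>collapse_factor\<close> applies without any lifting of the
  endomorphism.\<close>

lemma T_ideal_afactor_collapse:
  fixes I :: "'k::comm_ring_1 gelem set"
  assumes I: "aideal (G d) I" and I0: "\<And>a. a \<in> I \<Longrightarrow> collapse a = 0"
  shows "T_ideal (afactor (G d) I) (acoset (G d) I ` {a \<in> gcarrier d. collapse a = 0})"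
proof -
  let ?c = "acoset (G d) I" and ?A = "afactor (G d) I"
  have endo: "\<psi> (?c a) \<in> ?c ` {a \<in> gcarrier d. collapse a = 0}"
    if \<psi>: "aendo ?A \<psi>" and a: "a \<in> gcarrier d" "collapse a = 0" for \<psi> a
  proof -
    define r where "r a = (SOME b. b \<in> gcarrier d \<and> \<psi> (?c a) = ?c b)" for a
    have r: "r a \<in> gcarrier d \<and> \<psi> (?c a) = ?c (r a)" if "a \<in> gcarrier d" for a
    proof -
      have "\<psi> (?c a) \<in> ?c ` gcarrier d" using \<psi> that by (simp add: aendo_def afactor_carrier image_subset_iff)
      then have "\<exists>b. b \<in> gcarrier d \<and> \<psi> (?c a) = ?c b" by blast
      then show ?thesis unfolding r_def by (rule someI_ex)
    qed
    have eq: "collapse (r x) = collapse y" if "x \<in> gcarrier d" "\<psi> (?c x) = ?c y" for x y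
    proof -
      have "r x - y \<in> I" using r[OF that(1)] that(2) acoset_eq_iff[OF I] by metis
      moreover have "r x = (r x - y) + y" by simp
      ultimately show ?thesis using I0 by (metis add_0 collapse_simps(1))
    qed
    have \<psi>': "\<psi> (aplus ?A (?c a) (?c b)) = aplus ?A (\<psi> (?c a)) (\<psi> (?c b))"
      "\<psi> (ascale ?A c (?c a)) = ascale ?A c (\<psi> (?c a))"
      "\<psi> (amult ?A (?c a) (?c b)) = amult ?A (\<psi> (?c a)) (\<psi> (?c b))"
      if "a \<in> gcarrier d" "b \<in> gcarrier d" for a b c
      using \<psi> that by (auto simp: aendo_def afactor_carrier)
    have "collapse (r a) = 0"
    proof (rule collapse_factor[OF _ _ _ a])
      fix a b :: "'k gelem" and c :: 'k
      assume a: "a \<in> gcarrier d"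
      show "collapse (r (gscale c a)) = pconst c * collapse (r a)"
        using eq[of "gscale c a" "gscale c (r a)"] \<psi>'(2)[OF a a, of c] r[OF a] a
        by (simp add: afactor_simps[OF I] gcarrier_scale)
      assume b: "b \<in> gcarrier d"
      show "collapse (r (a + b)) = collapse (r a) + collapse (r b)"
        using eq[of "a + b" "r a + r b"] \<psi>'(1)[OF a b] r[OF a] r[OF b] a b
        by (simp add: afactor_simps[OF I] gcarrier_add)
      show "collapse (r (gmult a b)) = collapse (r a) * collapse (r b)"
        using eq[of "gmult a b" "gmult (r a) (r b)"] \<psi>'(3)[OF a b] r[OF a] r[OF b] a b
        by (simp add: afactor_simps[OF I] gcarrier_mult)
    qed
    then show ?thesis using r[OF a(1)] by auto
  qed
  have "asubspace ?A (?c ` {a \<in> gcarrier d. collapse a = 0})"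
  proof -
    have "aplus ?A (?c a) (?c b) \<in> ?c ` {a \<in> gcarrier d. collapse a = 0}"
      "ascale ?A c (?c a) \<in> ?c ` {a \<in> gcarrier d. collapse a = 0}"
      if "a \<in> gcarrier d" "collapse a = 0" "b \<in> gcarrier d" "collapse b = 0" for a b c
      using that by (simp_all add: afactor_simps[OF I] gcarrier_add gcarrier_scale)
    then show ?thesis
      unfolding asubspace_def afactor_carrier by (blast intro: gcarrier_0 collapse_simps(4))
  qed
  moreover have "amult ?A (?c a) (?c u) \<in> ?c ` {a \<in> gcarrier d. collapse a = 0} \<and>
      amult ?A (?c u) (?c a) \<in> ?c ` {a \<in> gcarrier d. collapse a = 0}"
    if "a \<in> gcarrier d" "u \<in> gcarrier d" "collapse u = 0" for a u
    using that by (simp add: afactor_simps[OF I] gcarrier_mult)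
  ultimately show ?thesis
    using endo by (simp add: T_ideal_def aideal_def afactor_carrier image_subset_iff)
qed

section \<open>Extracting coefficients\<close>

definition psubspace :: "'k::comm_ring_1 yzpoly set \<Rightarrow> bool" where
  "psubspace V \<longleftrightarrow> 0 \<in> V \<and> (\<forall>p\<in>V. \<forall>q\<in>V. p + q \<in> V) \<and> (\<forall>c. \<forall>p\<in>V. pconst c * p \<in> V)"

lemma psubspaceD:
  assumes "psubspace V"
  shows "0 \<in> V" "p \<in> V \<Longrightarrow> q \<in> V \<Longrightarrow> p + q \<in> V" "p \<in> V \<Longrightarrow> pconst c * p \<in> V"
  using assms by (auto simp: psubspace_def)

lemma psubspace_uminus: "psubspace V \<Longrightarrow> p \<in> V \<Longrightarrow> - p \<in> V"
  using psubspaceD(3)[of V p "-1"] by (simp add: pconst_uminus)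

lemma psubspace_diff: "psubspace V \<Longrightarrow> p \<in> V \<Longrightarrow> q \<in> V \<Longrightarrow> p - q \<in> V"
  using psubspaceD(2)[of V p "- q"] by (simp add: psubspace_uminus)

lemma psubspace_of_nat: "psubspace V \<Longrightarrow> p \<in> V \<Longrightarrow> of_nat n * p \<in> V"
  by (metis pconst_of_nat psubspaceD(3))

lemma psubspace_cancel:
  assumes "psubspace V" "pconst c * p \<in> V" "(c :: 'k::field) \<noteq> 0"
  shows "p \<in> V"
proof -
  have "pconst (inverse c) * (pconst c * p) \<in> V" using assms by (simp add: psubspaceD)
  moreover have "pconst (inverse c) * pconst c = 1"
    using assms(3) by (simp flip: pconst_mult)
  ultimately show ?thesis by (metis mult.assoc mult_1)
qed

lemma psubspace_cancel_of_nat: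
  assumes "psubspace (V :: 'k::field_char_0 yzpoly set)" "of_nat n * p \<in> V" "n \<noteq> 0"
  shows "p \<in> V"
  using psubspace_cancel[of V "of_nat n" p] assms by (simp add: pconst_of_nat)

text \<open>A Vandermonde argument by divided differences: for fixed \<open>c\<close>, the quotient
  of \<open>poly q e - poly q c\<close> by \<open>e - c\<close> is the value at \<open>e\<close> of
  the synthetic quotient, which has lower degree and again takes values in \<open>V\<close> for
  infinitely many \<open>e\<close>.\<close>

lemma coeff_in_psubspace:
  fixes q :: "'k::field yzpoly poly"
  assumes V: "psubspace V" and S: "infinite S" and q: "\<And>c. c \<in> S \<Longrightarrow> poly q (pconst c) \<in> V"
  shows "coeff q n \<in> V"
  using S q
proof (induction "Polynomial.degree q" arbitrary: q S n rule: less_induct)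
  case (less q)
  from less.prems(1) obtain c where c: "c \<in> S" by (metis finite.emptyI equals0I)
  show ?case
  proof (cases "Polynomial.degree q = 0")
    case True
    then obtain a where "q = [:a:]" by (metis degree_eq_zeroE)
    then show ?thesis using less.prems(2)[OF c] psubspaceD(1)[OF V]
      by (cases n) auto
  next
    case False
    let ?q = "synthetic_div q (pconst c)"
    have eq: "[:- pconst c, 1:] * ?q + [:poly q (pconst c):] = q" by (rule synthetic_div_correct')
    have "coeff ?q m \<in> V" for m
    proof (rule less.hyps[of _ "S - {c}"])
      fix e assume e: "e \<in> S - {c}"
      have "poly q (pconst e) - poly q (pconst c) = pconst (e - c) * poly ?q (pconst e)"
        by (subst eq[symmetric], simp add: pconst_diff algebra_simps)
      moreover have "poly q (pconst e) - poly q (pconst c) \<in> V"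
        using psubspace_diff[OF V] less.prems(2) c e by blast
      ultimately show "poly ?q (pconst e) \<in> V"
        using psubspace_cancel[OF V, of "e - c"] e by simp
    qed (use False less.prems(1) in \<open>simp_all add: degree_synthetic_div\<close>)
    note Q = this
    have "coeff q n = coeff ([:- pconst c, 1:] * ?q + [:poly q (pconst c):]) n"
      by (simp only: eq)
    also have "\<dots> = (case n of 0 \<Rightarrow> poly q (pconst c) | Suc m \<Rightarrow> coeff ?q m) - pconst c * coeff ?q n"
      by (simp add: coeff_pCons split: nat.split)
    also have "\<dots> \<in> V"
      using less.prems(2)[OF c] Q
      by (intro psubspace_diff[OF V] psubspaceD(3)[OF V]) (simp_all split: nat.split)
    finally show ?thesis .
  qed
qed

lemma coeff_mult_1: "coeff (p * q) 1 = coeff p 0 * coeff q 1 + coeff p 1 * coeff q 0"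
  for p :: "'r::comm_ring_1 poly"
  by (simp add: coeff_mult)

lemma coeff_mult_0': "coeff (p * q) 0 = coeff p 0 * coeff q 0" for p :: "'r::comm_ring_1 poly"
  by (simp add: coeff_mult)

text \<open>The value at parameter 0 and the first derivative; these are the coefficients that will
  be extracted with \<open>coeff_in_psubspace\<close>.\<close>

lemma coeff_linear_power:
  "coeff ([:a, b:] ^ n) 0 = a ^ n" "coeff ([:a, b:] ^ n) 1 = of_nat n * a ^ (n - 1) * b"
  for a :: "'r::comm_ring_1"
proof -
  show *: "coeff ([:a, b:] ^ n) 0 = a ^ n" for n
    by (induction n) (simp_all add: coeff_mult_0' del: mult_pCons_left)
  show "coeff ([:a, b:] ^ n) 1 = of_nat n * a ^ (n - 1) * b"
  proof (induction n)
    case (Suc n)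
    then show ?case unfolding power_Suc coeff_mult_1 *
      by (cases n) (simp_all add: algebra_simps)
  qed simp
qed


section \<open>Polarization\<close>

definition lin :: "nat \<Rightarrow> 'k::comm_ring_1 gelem set" where
  "lin d = {a \<in> gcarrier d. snd a = 0}"

lemma lin_add: "a \<in> lin d \<Longrightarrow> b \<in> lin d \<Longrightarrow> a + b \<in> lin d"
  by (simp add: lin_def gcarrier_add)

lemma lin_scale: "a \<in> lin d \<Longrightarrow> gscale c a \<in> lin d"
  by (simp add: lin_def gcarrier_scale) (simp add: gscale_def map_eq_zero_iff[THEN iffD2])

lemma lin_gx: "i < d \<Longrightarrow> gx i \<in> lin d"
  by (simp add: lin_def) (simp add: gx_def)

lemma lin_carrier: "a \<in> lin d \<Longrightarrow> a \<in> gcarrier d"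
  by (simp add: lin_def)

text \<open>The polynomial of the commutator \<open>gmult A B - gmult B A\<close>.\<close>

definition skew :: "'k::comm_ring_1 gelem \<Rightarrow> 'k gelem \<Rightarrow> 'k yzpoly" where
  "skew A B = lft A * rgt B - lft B * rgt A"

text \<open>The cyclic sum of \<open>(c\<^sub>1 lft A + c\<^sub>2 rgt A) * skew B C\<close> is a determinant with
  linearly dependent rows, hence zero.\<close>

lemma skew_polarization:
  fixes V :: "'k::field_char_0 yzpoly set"
  assumes V: "psubspace V" and D: "\<And>a b. a \<in> D \<Longrightarrow> b \<in> D \<Longrightarrow> a + b \<in> D"
    and sq: "\<And>A B. A \<in> D \<Longrightarrow> B \<in> D \<Longrightarrow> (pconst c1 * lft A + pconst c2 * rgt A) * skew A B \<in> V"
    and ABC: "A \<in> D" "B \<in> D" "C \<in> D"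
  shows "(pconst c1 * lft A + pconst c2 * rgt A) * skew B C \<in> V"
proof -
  define l where "l A = pconst c1 * lft A + pconst c2 * rgt A" for A :: "'k gelem"
  have pol: "l A * skew C B + l C * skew A B \<in> V" if "A \<in> D" "B \<in> D" "C \<in> D" for A B C
  proof -
    have "l (A + C) * skew (A + C) B - l A * skew A B - l C * skew C B \<in> V"
      unfolding l_def using that D by (intro psubspace_diff[OF V] sq) auto
    moreover have "l (A + C) * skew (A + C) B - l A * skew A B - l C * skew C B =
        l A * skew C B + l C * skew A B"
      by (simp add: l_def skew_def algebra_simps)
    ultimately show ?thesis by simp
  qed
  \<comment> \<open>Both brackets are instances of \<open>pol\<close>. Their difference is
    \<open>l A * skew B C\<close> taken twice plus \<open>l B * skew A C - l C * skew A B\<close>,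
    and the cyclic identity turns the latter into a third copy.\<close>
  have "(l A * skew B C + l B * skew A C) - (l A * skew C B + l C * skew A B) \<in> V"
    using ABC by (intro psubspace_diff[OF V] pol)
  also have "(l A * skew B C + l B * skew A C) - (l A * skew C B + l C * skew A B) =
      of_nat 3 * (l A * skew B C)"
    by (simp add: l_def skew_def algebra_simps)
  finally show ?thesis using psubspace_cancel_of_nat[OF V, of 3] by (simp add: l_def)
qed

section \<open>From pure powers of one linear element to all monomials of the same bidegree\<close>

definition lin_forms :: "nat \<Rightarrow> 'k::comm_ring_1 yzpoly set" where
  "lin_forms d = lft ` lin d \<union> rgt ` lin d"

text \<open>In degree \<open>n + 2\<close> this says that, modulo \<open>V\<close>, the indices of a
  y and a z may be exchanged in the presence of any \<open>n\<close> further linear factors.\<close>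

definition kills_skew :: "nat \<Rightarrow> nat \<Rightarrow> 'k::comm_ring_1 yzpoly set \<Rightarrow> bool" where
  "kills_skew d n V \<longleftrightarrow> (\<forall>qs A B. set qs \<subseteq> lin_forms d \<longrightarrow> length qs = n \<longrightarrow> A \<in> lin d \<longrightarrow>
     B \<in> lin d \<longrightarrow> prod_list qs * skew A B \<in> V)"

lemma lin_forms_vars:
  assumes "i < d"
  shows "py i \<in> (lin_forms d :: 'k::comm_ring_1 yzpoly set)" "pz i \<in> (lin_forms d :: 'k yzpoly set)"
proof -
  have "lft (gx i) \<in> (lin_forms d :: 'k yzpoly set)" "rgt (gx i) \<in> (lin_forms d :: 'k yzpoly set)"
    unfolding lin_forms_def using lin_gx[OF assms] by blast+
  then show "py i \<in> (lin_forms d :: 'k yzpoly set)" "pz i \<in> (lin_forms d :: 'k yzpoly set)"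
    by simp_all
qed

lemma kills_skewD:
  fixes V :: "'k::comm_ring_1 yzpoly set"
  assumes "kills_skew d n V" "A \<in> lin d" "B \<in> lin d" "set as \<subseteq> {..<d}" "set bs \<subseteq> {..<d}"
    "a + b + length as + length bs = n"
  shows "lft A ^ a * rgt A ^ b * (ymon as * zmon bs) * skew A B \<in> V"
proof -
  let ?qs = "replicate a (lft A) @ replicate b (rgt A) @ map py as @ map pz bs"
  have "lft A \<in> lin_forms d" "rgt A \<in> lin_forms d"
    unfolding lin_forms_def using assms(2) by blast+
  moreover have "py ` set as \<subseteq> (lin_forms d :: 'k yzpoly set)"
    "pz ` set bs \<subseteq> (lin_forms d :: 'k yzpoly set)"
    using assms(4,5) lin_forms_vars by blast+
  ultimately have "set ?qs \<subseteq> lin_forms d"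
    by (simp add: set_replicate_conv_if)
  moreover have "length ?qs = n" using assms(6) by simp
  ultimately have "prod_list ?qs * skew A B \<in> V"
    using assms(1-3) unfolding kills_skew_def by blast
  then show ?thesis by (simp add: prod_list_replicate ymon_def zmon_def mult.assoc)
qed

context
  fixes d n :: nat and e1 e2 :: "'k::field_char_0" and V :: "'k yzpoly set"
  assumes V: "psubspace V" and ks: "kills_skew d n V"
begin

text \<open>A stage of the polarization: \<open>as\<close> and \<open>bs\<close> hold the indices
  already split off, while the powers of \<open>lft A\<close> and \<open>rgt A\<close> are still to
  be treated. The linear factor with coefficients \<open>e1\<close>, \<open>e2\<close> stays tied to
  \<open>A\<close> until the end.\<close>

definition polar_form :: "nat \<Rightarrow> nat \<Rightarrow> nat list \<Rightarrow> nat list \<Rightarrow> bool" where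
  "polar_form a b as bs \<longleftrightarrow> (\<forall>A\<in>lin d. lft A ^ a * rgt A ^ b *
     (pconst e1 * lft A + pconst e2 * rgt A) * (ymon as * zmon bs) \<in> V)"

text \<open>The derivative in the direction \<open>gx i\<close>: replace \<open>A\<close> by
  \<open>A + gscale c (gx i)\<close> and take the coefficient of \<open>c\<close>.\<close>

lemma polar_form_derivative:
  assumes P: "polar_form a b as bs" and A: "A \<in> lin d" and i: "i < d"
  defines "M \<equiv> ymon as * zmon bs" and "E \<equiv> pconst e1 * lft A + pconst e2 * rgt A"
  shows "(of_nat a * lft A ^ (a - 1) * py i * rgt A ^ b * E +
      of_nat b * lft A ^ a * rgt A ^ (b - 1) * pz i * E +
      lft A ^ a * rgt A ^ b * (pconst e1 * py i + pconst e2 * pz i)) * M \<in> V"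
proof -
  let ?q = "[:lft A, py i:] ^ a * [:rgt A, pz i:] ^ b * [:E, pconst e1 * py i + pconst e2 * pz i:] * [:M:]"
  have "poly ?q (pconst c) \<in> V" for c
  proof -
    have "A + gscale c (gx i) \<in> lin d" using A i by (simp add: lin_add lin_scale lin_gx)
    with P have "lft (A + gscale c (gx i)) ^ a * rgt (A + gscale c (gx i)) ^ b *
       (pconst e1 * lft (A + gscale c (gx i)) + pconst e2 * rgt (A + gscale c (gx i))) * M \<in> V"
      unfolding polar_form_def M_def by blast
    then show ?thesis by (simp add: poly_power E_def algebra_simps)
  qed
  then have "coeff ?q 1 \<in> V"
    by (intro coeff_in_psubspace[OF V infinite_UNIV_char_0]) simp
  then show ?thesis
    unfolding coeff_mult_1 coeff_mult_0' coeff_linear_power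
    by (simp add: algebra_simps)
qed

text \<open>Trading \<open>lft A * pz i\<close> for \<open>py i * rgt A\<close>, at the cost of a
  multiple of \<open>skew A (gx i)\<close>, turns every summand of the derivative into a multiple of
  the term with \<open>py i\<close> split off. The multiplicities \<open>a + 1\<close>,
  \<open>b\<close> and 1 add up to \<open>a + b + 2\<close>, which is invertible in characteristic
  0; \<open>n\<close> counts the linear factors left beside each commutator.\<close>

lemma polar_form_left:
  assumes P: "polar_form (Suc a) b as bs" and i: "i < d" and n: "a + b + length as + length bs = n"
    and as: "set as \<subseteq> {..<d}" and bs: "set bs \<subseteq> {..<d}"
  shows "polar_form a b (i # as) bs"
  unfolding polar_form_def
proof
  fix A :: "'k gelem" assume A: "A \<in> lin d"
  define M :: "'k yzpoly" where "M = ymon as * zmon bs"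
  define X Z s E where "X = lft A" and "Z = rgt A" and "s = skew A (gx i)"
    and "E = pconst e1 * X + pconst e2 * Z"
  have s: "s = X * pz i - py i * Z" by (simp add: s_def skew_def X_def Z_def)
  have T1: "X ^ a * Z ^ b * M * s \<in> V"
    unfolding X_def Z_def M_def s_def by (rule kills_skewD[OF ks A lin_gx[OF i] as bs n])
  have T2: "X ^ Suc a * Z ^ (b - 1) * M * s \<in> V" if "b > 0"
    unfolding X_def Z_def M_def s_def
    by (rule kills_skewD[OF ks A lin_gx[OF i] as bs]) (use n that in simp)
  \<comment> \<open>For \<open>b = 0\<close> the truncated exponent \<open>b - 1\<close> spoils the
    degree, but then the factor \<open>of_nat b\<close> removes the term.\<close>
  have T3: "of_nat b * (pconst e1 * (X ^ Suc a * Z ^ (b - 1) * M * s)) \<in> V"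
    using T2 psubspaceD[OF V] psubspace_of_nat[OF V] by (cases "b = 0") auto
  have T4: "of_nat (Suc b) * (pconst e2 * (X ^ a * Z ^ b * M * s)) \<in> V"
    using T1 psubspaceD[OF V] psubspace_of_nat[OF V] by blast
  let ?D = "(of_nat (Suc a) * X ^ (Suc a - 1) * py i * Z ^ b * E +
      of_nat b * X ^ Suc a * Z ^ (b - 1) * pz i * E +
      X ^ Suc a * Z ^ b * (pconst e1 * py i + pconst e2 * pz i)) * M"
  have "?D \<in> V" using polar_form_derivative[OF P A i] by (simp only: X_def Z_def E_def M_def)
  moreover have "?D = of_nat (a + b + 2) * (X ^ a * Z ^ b * E * (py i * M)) +
      of_nat b * (pconst e1 * (X ^ Suc a * Z ^ (b - 1) * M * s)) +
      of_nat (Suc b) * (pconst e2 * (X ^ a * Z ^ b * M * s))"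
    unfolding s E_def by (cases b) (simp_all add: algebra_simps)
  ultimately have "of_nat (a + b + 2) * (X ^ a * Z ^ b * E * (py i * M)) +
      of_nat b * (pconst e1 * (X ^ Suc a * Z ^ (b - 1) * M * s)) +
      of_nat (Suc b) * (pconst e2 * (X ^ a * Z ^ b * M * s)) \<in> V" by simp
  from psubspace_diff[OF V psubspace_diff[OF V this T4] T3]
  have "of_nat (a + b + 2) * (X ^ a * Z ^ b * E * (py i * M)) \<in> V" by simp
  then have "X ^ a * Z ^ b * E * (py i * M) \<in> V"
    by (rule psubspace_cancel_of_nat[OF V]) simp
  then show "lft A ^ a * rgt A ^ b * (pconst e1 * lft A + pconst e2 * rgt A) *
      (ymon (i # as) * zmon bs) \<in> V"
    by (simp add: X_def Z_def E_def M_def mult.assoc)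
qed

text \<open>The mirror image: now \<open>py i * rgt A\<close> is traded for
  \<open>lft A * pz i\<close>, so the commutator terms enter with the opposite sign.\<close>

lemma polar_form_right:
  assumes P: "polar_form a (Suc b) as bs" and i: "i < d" and n: "a + b + length as + length bs = n"
    and as: "set as \<subseteq> {..<d}" and bs: "set bs \<subseteq> {..<d}"
  shows "polar_form a b as (i # bs)"
  unfolding polar_form_def
proof
  fix A :: "'k gelem" assume A: "A \<in> lin d"
  define M :: "'k yzpoly" where "M = ymon as * zmon bs"
  define X Z s E where "X = lft A" and "Z = rgt A" and "s = skew A (gx i)"
    and "E = pconst e1 * X + pconst e2 * Z"
  have s: "s = X * pz i - py i * Z" by (simp add: s_def skew_def X_def Z_def)
  have T1: "X ^ a * Z ^ b * M * s \<in> V"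
    unfolding X_def Z_def M_def s_def by (rule kills_skewD[OF ks A lin_gx[OF i] as bs n])
  have T2: "X ^ (a - 1) * Z ^ Suc b * M * s \<in> V" if "a > 0"
    unfolding X_def Z_def M_def s_def
    by (rule kills_skewD[OF ks A lin_gx[OF i] as bs]) (use n that in simp)
  have T3: "of_nat a * (pconst e2 * (X ^ (a - 1) * Z ^ Suc b * M * s)) \<in> V"
    using T2 psubspaceD[OF V] psubspace_of_nat[OF V] by (cases "a = 0") auto
  have T4: "of_nat (Suc a) * (pconst e1 * (X ^ a * Z ^ b * M * s)) \<in> V"
    using T1 psubspaceD[OF V] psubspace_of_nat[OF V] by blast
  let ?D = "(of_nat a * X ^ (a - 1) * py i * Z ^ Suc b * E +
      of_nat (Suc b) * X ^ a * Z ^ (Suc b - 1) * pz i * E +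
      X ^ a * Z ^ Suc b * (pconst e1 * py i + pconst e2 * pz i)) * M"
  have "?D \<in> V" using polar_form_derivative[OF P A i] by (simp only: X_def Z_def E_def M_def)
  moreover have "?D = of_nat (a + b + 2) * (X ^ a * Z ^ b * E * (pz i * M)) -
      of_nat a * (pconst e2 * (X ^ (a - 1) * Z ^ Suc b * M * s)) -
      of_nat (Suc a) * (pconst e1 * (X ^ a * Z ^ b * M * s))"
    unfolding s E_def by (cases a) (simp_all add: algebra_simps)
  ultimately have "of_nat (a + b + 2) * (X ^ a * Z ^ b * E * (pz i * M)) -
      of_nat a * (pconst e2 * (X ^ (a - 1) * Z ^ Suc b * M * s)) -
      of_nat (Suc a) * (pconst e1 * (X ^ a * Z ^ b * M * s)) \<in> V" by simp
  from psubspaceD(2)[OF V psubspaceD(2)[OF V this T4] T3]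
  have "of_nat (a + b + 2) * (X ^ a * Z ^ b * E * (pz i * M)) \<in> V" by simp
  then have "X ^ a * Z ^ b * E * (pz i * M) \<in> V"
    by (rule psubspace_cancel_of_nat[OF V]) simp
  then show "lft A ^ a * rgt A ^ b * (pconst e1 * lft A + pconst e2 * rgt A) *
      (ymon as * zmon (i # bs)) \<in> V"
    by (simp add: X_def Z_def E_def M_def mult_ac)
qed

lemma polar_form_lists:
  assumes "polar_form (length as) (length bs) [] []" "Suc n = length as + length bs"
    and "set as \<subseteq> {..<d}" "set bs \<subseteq> {..<d}"
  shows "polar_form 0 0 as bs"
proof -
  have left: "polar_form a b as []" 
    if "polar_form (length as + a) b [] []" "Suc n = length as + a + b" "set as \<subseteq> {..<d}" for a b
    using that
  proof (induction as arbitrary: a)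
    case (Cons i as)
    from Cons.prems have "polar_form (Suc a) b as []" by (intro Cons.IH) simp_all
    then show ?case by (rule polar_form_left) (use Cons.prems in simp_all)
  qed simp
  have right: "polar_form a b as bs"
    if "polar_form a (length bs + b) as []" "Suc n = length as + length bs + a + b"
      "set bs \<subseteq> {..<d}" for a b
    using that
  proof (induction bs arbitrary: b)
    case (Cons i bs)
    from Cons.prems have "polar_form a (Suc b) as bs" by (intro Cons.IH) simp_all
    then show ?case by (rule polar_form_right) (use Cons.prems assms(3) in simp_all)
  qed simp
  show ?thesis
    by (rule right) (use left[of 0 "length bs"] assms in simp_all)
qed

text \<open>Once all powers are split off, only the distinguished linear factor still depends on
  \<open>A\<close>, and setting \<open>A\<close> to \<open>gx i\<close> gives the claim.\<close>

lemma polarization: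
  assumes "\<And>A. A \<in> lin d \<Longrightarrow> lft A ^ length as * rgt A ^ length bs *
      (pconst e1 * lft A + pconst e2 * rgt A) \<in> V"
    and "Suc n = length as + length bs" "set as \<subseteq> {..<d}" "set bs \<subseteq> {..<d}" "i < d"
  shows "(pconst e1 * py i + pconst e2 * pz i) * (ymon as * zmon bs) \<in> V"
proof -
  have "polar_form (length as) (length bs) [] []" using assms(1) by (simp add: polar_form_def)
  from polar_form_lists[OF this assms(2-4)] show ?thesis
    using lin_gx[OF assms(5)] unfolding polar_form_def by fastforce
qed

end


section \<open>Homogeneous elements\<close>

lemma ymon_cong: "mset as = mset bs \<Longrightarrow> ymon as = ymon bs"
  unfolding ymon_def prod_mset_prod_list[symmetric] mset_map by simp

lemma ymon_append: "ymon (as @ bs) = ymon as * ymon bs"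
  by (simp add: ymon_def)

lemma ghom_span:
  assumes V: "psubspace V" and a: "a \<in> ghom d k"
    and mon: "\<And>as bs. set as \<subseteq> {..<d} \<Longrightarrow> set bs \<subseteq> {..<d} \<Longrightarrow> as \<noteq> [] \<Longrightarrow> bs \<noteq> [] \<Longrightarrow>
      length as + length bs = k \<Longrightarrow> ymon as * zmon bs \<in> V"
  shows "snd a \<in> V"
proof -
  have "q \<in> V" if "\<forall>m\<in>keys q. proper_mon d m \<and> ydeg d m + zdeg d m = k" for q
  proof (induction q rule: poly_mapping_add_induct)
    case (single m c)
    with that obtain as bs where "m = list_exp as bs" "set as \<subseteq> {..<d}" "set bs \<subseteq> {..<d}"
      "as \<noteq> []" "bs \<noteq> []" "length as + length bs = k"
      by (metis proper_mon_lists)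
    then have "pconst c * (ymon as * zmon bs) \<in> V" by (intro psubspaceD(3)[OF V] mon)
    then show ?case
      by (simp add: \<open>m = _\<close> pconst_mult_single flip: single_list_exp)
  qed (simp_all add: psubspaceD[OF V])
  moreover have "\<forall>m\<in>keys (snd a). proper_mon d m \<and> ydeg d m + zdeg d m = k"
    using a mem_gcarrier[of a d] by (auto simp: ghom_def)
  ultimately show ?thesis by blast
qed

section \<open>Normal forms of monomials and the kernel of \<open>collapse\<close> in a fixed
  degree\<close>

lemma list_exp_Nil_eq_iff: "list_exp as [] = list_exp bs [] \<longleftrightarrow> mset as = mset bs"
proof
  have "lookup (list_exp as []) (Y i) = count (mset as) i" for as i
    by (induction as) (auto simp: list_exp_def lookup_add lookup_single when_def)
  then show "list_exp as [] = list_exp bs [] \<Longrightarrow> mset as = mset bs"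
    by (metis multiset_eqI)
  show "mset as = mset bs \<Longrightarrow> list_exp as [] = list_exp bs []"
    unfolding list_exp_def sum_mset_sum_list[symmetric] mset_map by simp
qed

lemma mon_eval_collapse:
  "mon_eval collapse_var (list_exp as bs) = (Poly_Mapping.single (list_exp (as @ bs) []) 1 ::
     'k::comm_ring_1 yzpoly)"
proof -
  have "mon_eval collapse_var (\<Sum>i\<leftarrow>as. Poly_Mapping.single (f i) 1) =
      (prod_list (map (\<lambda>i. collapse_var (f i)) as) :: 'k yzpoly)" for f :: "nat \<Rightarrow> yz" and as
    by (induction as) (simp_all add: mon_eval_add)
  from this[of Y as] this[of Z bs] show ?thesis
    by (simp add: single_list_exp ymon_append list_exp_def[of as bs] mon_eval_add) (simp add: ymon_def)
qed

text \<open>The hypothesis \<open>diff\<close> changes a z into the y of the same index as long as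
  another z remains; repeating this leaves exactly one z.\<close>

lemma normal_form:
  fixes V :: "'k::comm_ring_1 yzpoly set"
  assumes V: "psubspace V"
    and diff: "\<And>as bs i. set as \<subseteq> {..<d} \<Longrightarrow> set bs \<subseteq> {..<d} \<Longrightarrow> i < d \<Longrightarrow> as \<noteq> [] \<Longrightarrow> bs \<noteq> [] \<Longrightarrow>
      Suc (length as + length bs) = k \<Longrightarrow> ymon as * zmon bs * (py i - pz i) \<in> V"
    and bs: "bs \<noteq> []" "set bs \<subseteq> {..<d}"
    and as: "set as \<subseteq> {..<d}" "as \<noteq> []" "length as + length bs = k"
  shows "\<exists>cs b. ymon as * zmon bs - ymon cs * pz b \<in> V \<and> mset (b # cs) = mset (as @ bs)"
  using bs as
proof (induction bs arbitrary: as rule: list_nonempty_induct)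
  case (single b)
  then show ?case using psubspaceD(1)[OF V] by (intro exI[of _ as] exI[of _ b]) simp
next
  case (cons b bs)
  then obtain cs c where cs: "ymon (b # as) * zmon bs - ymon cs * pz c \<in> V"
    "mset (c # cs) = mset ((b # as) @ bs)"
    using cons.IH[of "b # as"] by auto
  have "ymon as * zmon bs * (py b - pz b) \<in> V" using cons by (intro diff) auto
  from psubspace_diff[OF V cs(1) this] have "ymon as * zmon (b # bs) - ymon cs * pz c \<in> V"
    by (simp add: algebra_simps)
  then show ?case using cs(2) by (intro exI[of _ cs] exI[of _ c]) simp
qed

text \<open>Two normal forms with the same indices can differ only in which index sits on the single
  z. Exchanging the two indices in question costs a multiple of a commutator with \<open>n\<close>
  y's beside it.\<close>

lemma collapse_eq_imp_diff:
  fixes V :: "'k::comm_ring_1 yzpoly set"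
  assumes V: "psubspace V" and ks: "kills_skew d n V" and k: "k = n + 2"
    and diff: "\<And>as bs i. set as \<subseteq> {..<d} \<Longrightarrow> set bs \<subseteq> {..<d} \<Longrightarrow> i < d \<Longrightarrow> as \<noteq> [] \<Longrightarrow> bs \<noteq> [] \<Longrightarrow>
      Suc (length as + length bs) = k \<Longrightarrow> ymon as * zmon bs * (py i - pz i) \<in> V"
    and 1: "bs \<noteq> []" "set bs \<subseteq> {..<d}" "set as \<subseteq> {..<d}" "as \<noteq> []" "length as + length bs = k"
    and 2: "bs' \<noteq> []" "set bs' \<subseteq> {..<d}" "set as' \<subseteq> {..<d}" "as' \<noteq> []" "length as' + length bs' = k"
    and eq: "mset (as @ bs) = mset (as' @ bs')"
  shows "ymon as * zmon bs - ymon as' * zmon bs' \<in> V"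
proof -
  obtain cs b where cs: "ymon as * zmon bs - ymon cs * pz b \<in> V" "mset (b # cs) = mset (as @ bs)"
    using normal_form[OF V diff 1] by blast
  obtain cs' b' where cs': "ymon as' * zmon bs' - ymon cs' * pz b' \<in> V"
    "mset (b' # cs') = mset (as' @ bs')"
    using normal_form[OF V diff 2] by blast
  have m: "add_mset b (mset cs) = add_mset b' (mset cs')" using cs(2) cs'(2) eq by simp
  have "ymon cs * pz b - ymon cs' * pz b' \<in> V"
  proof (cases "b = b'")
    case True
    then show ?thesis using m psubspaceD(1)[OF V] by (simp add: ymon_cong[of cs cs'])
  next
    case False
    then obtain N where N: "mset cs = add_mset b' N" "mset cs' = add_mset b N"
      using m by (auto simp: add_eq_conv_ex)
    obtain es where es: "mset es = N" by (metis ex_mset)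
    have c: "ymon cs = (py b' * ymon es :: 'k yzpoly)" "ymon cs' = (py b * ymon es :: 'k yzpoly)"
      using N es by (simp_all add: ymon_cong[of cs "b' # es"] ymon_cong[of cs' "b # es"])
    have "set (b # cs) \<subseteq> {..<d}" "length (b # cs) = k"
      using 1(2,3,5) mset_eq_setD[OF cs(2)] mset_eq_length[OF cs(2)] by auto
    moreover have "set cs = insert b' (set es)" "length cs = Suc (length es)"
      using mset_eq_setD[of cs "b' # es"] mset_eq_length[of cs "b' # es"] N es by simp_all
    ultimately have *: "b < d" "b' < d" "set es \<subseteq> {..<d}" "length es = n" using k by auto
    have "ymon es * skew (gx b') (gx b) \<in> V"
    proof -
      have "set (map py es) \<subseteq> (lin_forms d :: 'k yzpoly set)" "length (map py es :: 'k yzpoly list) = n"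
        using *(3,4) lin_forms_vars(1) by auto
      then show ?thesis
        using ks lin_gx[OF *(1)] lin_gx[OF *(2)] unfolding kills_skew_def ymon_def by blast
    qed
    then show ?thesis by (simp add: c skew_def algebra_simps)
  qed
  from psubspace_diff[OF V psubspaceD(2)[OF V cs(1) this] cs'(1)] show ?thesis by simp
qed

text \<open>\<open>R\<close> is a linear section of \<open>collapse\<close> modulo \<open>V\<close>:
  it replaces each monomial in the image by a chosen preimage \<open>\<rho>\<close>. Every monomial
  \<open>p\<close> of degree \<open>k\<close> satisfies
  \<open>p - R (psubst collapse_var p) \<in> V\<close>, hence so does every homogeneous element by
  linearity, and on the kernel the correction is \<open>R 0 = 0\<close>.\<close>

lemma collapse_kernel:
  fixes V :: "'k::comm_ring_1 yzpoly set"
  assumes V: "psubspace V" and ks: "kills_skew d n V" and k: "k = n + 2"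
    and diff: "\<And>as bs i. set as \<subseteq> {..<d} \<Longrightarrow> set bs \<subseteq> {..<d} \<Longrightarrow> i < d \<Longrightarrow> as \<noteq> [] \<Longrightarrow> bs \<noteq> [] \<Longrightarrow>
      Suc (length as + length bs) = k \<Longrightarrow> ymon as * zmon bs * (py i - pz i) \<in> V"
    and a: "a \<in> ghom d k" "psubst collapse_var (snd a) = 0"
  shows "snd a \<in> V"
proof -
  define ok where "ok as bs \<longleftrightarrow> bs \<noteq> [] \<and> set bs \<subseteq> {..<d} \<and> set as \<subseteq> {..<d} \<and> as \<noteq> [] \<and>
    length as + length bs = k" for as bs
  define \<rho> where "\<rho> u = (SOME p. \<exists>as bs. p = (ymon as * zmon bs :: 'k yzpoly) \<and> ok as bs \<and>
    list_exp (as @ bs) [] = u)" for u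
  define R where "R q = (\<Sum>u\<in>keys q. pconst (lookup q u) * \<rho> u)" for q :: "'k yzpoly"
  have R_add: "R (p + q) = R p + R q" for p q
    unfolding R_def by (rule setsum_keys_plus_distrib) (simp_all add: pconst_add algebra_simps)
  have R_single: "R (Poly_Mapping.single u c) = pconst c * \<rho> u" for u c by (simp add: R_def)
  let ?W = "{p. p - R (psubst collapse_var p) \<in> V}"
  have W: "psubspace ?W"
  proof -
    have "R (pconst c * q) = pconst c * R q" for c q
      by (induction q rule: poly_mapping_add_induct)
         (simp_all add: pconst_mult_single R_single R_add pconst_mult algebra_simps, simp add: R_def)
    moreover have "R 0 = 0" by (simp add: R_def)
    ultimately show ?thesis
      using psubspaceD[OF V] unfolding psubspace_def
      by (simp add: psubst_add psubst_mult R_add add_diff_add flip: right_diff_distrib)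
  qed
  have "snd a \<in> ?W"
  proof (rule ghom_span[OF W a(1)])
    fix as bs :: "nat list"
    assume "set as \<subseteq> {..<d}" "set bs \<subseteq> {..<d}" "as \<noteq> []" "bs \<noteq> []" "length as + length bs = k"
    then have ok: "ok as bs" by (simp add: ok_def)
    let ?P = "\<lambda>p. \<exists>as' bs'. p = (ymon as' * zmon bs' :: 'k yzpoly) \<and> ok as' bs' \<and>
      list_exp (as' @ bs') [] = list_exp (as @ bs) []"
    have "?P (\<rho> (list_exp (as @ bs) []))"
      unfolding \<rho>_def by (rule someI[of ?P "ymon as * zmon bs"]) (use ok in blast)
    then obtain as' bs' where p: "\<rho> (list_exp (as @ bs) []) = ymon as' * zmon bs'" "ok as' bs'"
      "mset (as' @ bs') = mset (as @ bs)"
      by (auto simp only: list_exp_Nil_eq_iff)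
    have "ymon as * zmon bs - ymon as' * zmon bs' \<in> V"
      by (rule collapse_eq_imp_diff[OF V ks k diff])
         (use ok p(2,3) in \<open>simp_all add: ok_def\<close>)
    moreover have "psubst collapse_var (ymon as * zmon bs) =
        (Poly_Mapping.single (list_exp (as @ bs) []) 1 :: 'k yzpoly)"
      by (simp add: psubst_single mon_eval_collapse flip: single_list_exp)
    ultimately show "ymon as * zmon bs \<in> ?W" by (simp add: R_single p(1))
  qed
  then show ?thesis by (simp add: a(2) R_def)
qed

section \<open>Bigraded components, and the degrees of the listed elements\<close>

definition bihom :: "nat \<Rightarrow> nat \<Rightarrow> nat \<Rightarrow> 'k::comm_ring_1 yzpoly set" where
  "bihom d j l = {p. \<forall>m\<in>keys p. keys m \<subseteq> vars d \<and> ydeg d m = j \<and> zdeg d m = l}"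

lemma bihom_subspace: "psubspace (bihom d j l :: 'k::comm_ring_1 yzpoly set)"
proof -
  have "pconst c * p \<in> bihom d j l" if "p \<in> bihom d j l" for c and p :: "'k yzpoly"
    using that keys_map_scale[of c p] unfolding map_scale_pconst by (auto simp: bihom_def)
  moreover have "p + q \<in> bihom d j l" if "p \<in> bihom d j l" "q \<in> bihom d j l" for p q :: "'k yzpoly"
    using that keys_add[of p q] unfolding bihom_def by blast
  moreover have "0 \<in> bihom d j l" by (simp add: bihom_def)
  ultimately show ?thesis unfolding psubspace_def by blast
qed

lemma bihom_mult:
  assumes "p \<in> bihom d j l" "q \<in> bihom d j' l'"
  shows "p * q \<in> bihom d (j + j') (l + l')"
proof -
  have "keys m \<subseteq> vars d \<and> ydeg d m = j + j' \<and> zdeg d m = l + l'" if m: "m \<in> keys (p * q)" for m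
  proof -
    obtain s t where st: "s \<in> keys p" "t \<in> keys q" "m = s + t"
      using m keys_mult[of p q] by blast
    then have "keys s \<subseteq> vars d \<and> ydeg d s = j \<and> zdeg d s = l"
      "keys t \<subseteq> vars d \<and> ydeg d t = j' \<and> zdeg d t = l'"
      using assms unfolding bihom_def by blast+
    then show ?thesis
      using keys_add[of s t] st(3) by (simp add: ydeg_add zdeg_add) blast
  qed
  then show ?thesis by (simp add: bihom_def)
qed

lemma bihom_1: "1 \<in> bihom d 0 0"
  by (simp add: bihom_def ydeg_def zdeg_def)

lemma bihom_power: "p \<in> bihom d j l \<Longrightarrow> p ^ n \<in> bihom d (n * j) (n * l)"
  by (induction n) (use bihom_1 bihom_mult in auto)

lemma bihom_vars: "i < d \<Longrightarrow> py i \<in> bihom d 1 0" "i < d \<Longrightarrow> pz i \<in> bihom d 0 1"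
  by (simp_all add: bihom_def pvar_def vars_def)

lemma bihom_sum: "(\<And>i. i \<in> I \<Longrightarrow> f i \<in> bihom d j l) \<Longrightarrow> (\<Sum>i\<in>I. f i) \<in> bihom d j l"
  by (induction I rule: infinite_finite_induct) (auto simp: psubspaceD[OF bihom_subspace])

lemma bihom_ghom: "p \<in> bihom d j l \<Longrightarrow> 1 \<le> j \<Longrightarrow> 1 \<le> l \<Longrightarrow> gpoly p \<in> ghom d (j + l)"
  by (auto simp: bihom_def ghom_def gpoly_def gcarrier_def vars_def)

lemma ghom_add: "a \<in> ghom d k \<Longrightarrow> b \<in> ghom d k \<Longrightarrow> a + b \<in> ghom d k"
  using gcarrier_add[of a d b] keys_add[of "snd a" "snd b"] by (fastforce simp: ghom_def)

lemma ghom_scale: "a \<in> ghom d k \<Longrightarrow> gscale c a \<in> ghom d k"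
  using gcarrier_scale[of a d c] keys_map_scale[of c "snd a"]
  by (auto simp: ghom_def gscale_def map_eq_zero_iff)

lemma ghom_0: "0 \<in> ghom d k"
  by (simp add: ghom_def zero_prod_def) (simp flip: zero_prod_def)

lemma ghom_diff: "a \<in> ghom d k \<Longrightarrow> b \<in> ghom d k \<Longrightarrow> a - b \<in> ghom d k"
  using ghom_add[of a d k "gscale (-1) b"] ghom_scale[of b d k "-1"] by (simp add: gscale_minus1)

lemma ghom_carrier: "a \<in> ghom d k \<Longrightarrow> a \<in> gcarrier d"
  by (auto simp: ghom_def)

lemma ghom_gpoly: "a \<in> ghom d k \<Longrightarrow> 2 \<le> k \<Longrightarrow> a = gpoly (snd a)"
  by (auto simp: ghom_def gpoly_def)

text \<open>A linear change of the generators replaces each y by a combination of y's and each z by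
  one of z's, so even the bidegree is preserved.\<close>

lemma ghom_gl:
  fixes a :: "'k::comm_ring_1 gelem"
  assumes a: "a \<in> ghom d k" and k: "2 \<le> k"
  shows "subst_endo (gl_tuple d g) a \<in> ghom d k"
proof -
  let ?\<sigma> = "subst_var (gl_tuple d g)"
  let ?V = "{p. gpoly (psubst ?\<sigma> p) \<in> ghom d k}"
  have "psubspace ?V"
    by (simp add: psubspace_def ghom_0 psubst_add psubst_mult gpoly_add ghom_add ghom_scale
        flip: gscale_gpoly)
  then have "snd a \<in> ?V"
  proof (rule ghom_span[OF _ a])
    fix as bs :: "nat list"
    assume *: "set as \<subseteq> {..<d}" "set bs \<subseteq> {..<d}" "as \<noteq> []" "bs \<noteq> []" "length as + length bs = k"
    have l: "lft (gl_tuple d g i) \<in> bihom d 1 0" and r: "rgt (gl_tuple d g i) \<in> bihom d 0 1" for i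
      unfolding gl_tuple_def lft_sum rgt_sum lft_simps rgt_simps
      by (intro bihom_sum psubspaceD(3)[OF bihom_subspace] bihom_vars; simp)+
    have "psubst ?\<sigma> (ymon as) \<in> bihom d (length as) 0" for as
      by (induction as) (use bihom_1 bihom_mult[OF l] in \<open>auto simp: psubst_mult\<close>)
    moreover have "psubst ?\<sigma> (zmon bs) \<in> bihom d 0 (length bs)" for bs
      by (induction bs) (use bihom_1 bihom_mult[OF r] in \<open>auto simp: psubst_mult\<close>)
    ultimately have "psubst ?\<sigma> (ymon as * zmon bs) \<in> bihom d (length as + 0) (0 + length bs)"
      unfolding psubst_mult by (intro bihom_mult)
    from bihom_ghom[OF this] * show "ymon as * zmon bs \<in> ?V" by (simp add: Suc_le_eq)
  qed
  then show ?thesis by (subst ghom_gpoly[OF a k]) (simp add: subst_endo_gpoly)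
qed

lemma w1_ghom: "0 < d \<Longrightarrow> 1 \<le> j \<Longrightarrow> j < n \<Longrightarrow> w1 n j \<in> ghom d n"
  using bihom_ghom[OF bihom_mult[OF bihom_power[OF bihom_vars(1)] bihom_power[OF bihom_vars(2)]],
      of 0 d 0 j "n - j"] by (simp add: w1_def Suc_le_eq)

lemma skew12_bihom: "2 \<le> d \<Longrightarrow> skew12 \<in> (bihom d 1 1 :: 'a::comm_ring_1 yzpoly set)"
proof -
  assume "2 \<le> d"
  then have "py i * pz j \<in> (bihom d (1 + 0) (0 + 1) :: 'a yzpoly set)" if "i < 2" "j < 2" for i j
    using that by (intro bihom_mult bihom_vars) simp_all
  from this[of 0 1] this[of 1 0] show "skew12 \<in> (bihom d 1 1 :: 'a yzpoly set)"
    unfolding skew12_def by (intro psubspace_diff[OF bihom_subspace]) simp_all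
qed

lemma w2_ghom: "2 \<le> d \<Longrightarrow> w2 (j + 1) 1 j \<in> ghom d (j + 2)"
  using bihom_ghom[OF bihom_mult[OF bihom_power[OF bihom_vars(1)] skew12_bihom], of 0 d j]
  by (simp add: w2_def)


section \<open>Density of the general linear group\<close>

lemma lin_expand:
  assumes "A \<in> lin d"
  shows "(\<Sum>i<d. gscale (lookup (fst A) i) (gx i)) = A"
proof -
  have "(\<Sum>i<d. gscale (lookup (fst A) i) (gx i)) = (\<Sum>i\<in>keys (fst A). gscale (lookup (fst A) i) (gx i))"
    by (rule sum.mono_neutral_right) (use assms in \<open>auto simp: lin_def mem_gcarrier in_keys_iff\<close>)
  also have "\<dots> = A" using gelem_decomp[of A] assms by (simp add: lin_def)
  finally show ?thesis .
qed

lemma invertible_mat_det_nonzero: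
  assumes "g \<in> carrier_mat d d" "det g \<noteq> (0 :: 'k::field)"
  shows "invertible_mat g"
proof -
  from det_non_zero_imp_unit[OF assms, of "()"] obtain h where
    "h \<in> carrier_mat d d" "h * g = 1\<^sub>m d" "g * h = 1\<^sub>m d"
    by (auto simp: Units_def ring_mat_simps)
  then show ?thesis using assms(1) unfolding invertible_mat_def inverts_mat_def
    by (auto intro!: exI[of _ h])
qed

text \<open>The matrix \<open>g + c 1\<close> is invertible unless \<open>- c\<close> is an eigenvalue of \<open>g\<close>.\<close>

lemma GLd_dense:
  fixes A B :: "'k::field_char_0 gelem"
  assumes d: "2 \<le> d" and A: "A \<in> lin d" and B: "B \<in> lin d"
  obtains S where "infinite S"
    "\<And>c. c \<in> S \<Longrightarrow> \<exists>g\<in>GLd d. gl_tuple d g 0 = A + gscale c (gx 0) \<and> gl_tuple d g 1 = B + gscale c (gx 1)"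
proof
  \<comment> \<open>Column 0 holds the coordinates of \<open>A\<close> and every other column those
    of \<open>B\<close>; the conclusion reads off columns 0 and 1.\<close>
  define h where "h = mat d d (\<lambda>(i, j). lookup (fst (if j = 0 then A else B)) i)"
  have h: "h \<in> carrier_mat d d" by (simp add: h_def)
  let ?R = "{x. poly (char_poly h) x = 0}"
  have "char_poly h \<noteq> 0" using degree_monic_char_poly[OF h] by auto
  then have "finite (uminus ` ?R)" by (simp add: poly_roots_finite)
  then show "infinite (UNIV - uminus ` ?R)" by (simp add: infinite_UNIV_char_0 Diff_infinite_finite)
  fix c assume c: "c \<in> UNIV - uminus ` ?R"
  let ?g = "char_matrix h (- c)"
  have "poly (char_poly h) (- c) \<noteq> 0" using c by force
  then have "det ?g \<noteq> 0" using eigenvalue_det[OF h] eigenvalue_root_char_poly[OF h] by blast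
  then have g: "?g \<in> GLd d" using h by (simp add: GLd_def invertible_mat_det_nonzero[of _ d])
  have tuple: "gl_tuple d ?g j = (if j = 0 then A else B) + gscale c (gx j)" if "j < d" for j
  proof -
    have "gl_tuple d ?g j = (\<Sum>i<d. gscale (lookup (fst (if j = 0 then A else B)) i) (gx i) +
        (if i = j then gscale c (gx j) else 0))"
      unfolding gl_tuple_def
    proof (rule sum.cong[OF refl])
      fix i assume "i \<in> {..<d}"
      then have "?g $$ (i, j) = lookup (fst (if j = 0 then A else B)) i + (if i = j then c else 0)"
        using that h by (simp add: char_matrix_def) (simp add: h_def)
      then show "gscale (?g $$ (i, j)) (gx i) =
        gscale (lookup (fst (if j = 0 then A else B)) i) (gx i) + (if i = j then gscale c (gx j) else 0)"
        by (simp add: gscale_add_left)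
    qed
    also have "\<dots> = (if j = 0 then A else B) + gscale c (gx j)"
      using lin_expand[OF A] lin_expand[OF B] that by (simp add: sum.distrib)
    finally show ?thesis .
  qed
  show "\<exists>g\<in>GLd d. gl_tuple d g 0 = A + gscale c (gx 0) \<and> gl_tuple d g 1 = B + gscale c (gx 1)"
    using g tuple[of 0] tuple[of 1] d by auto
qed


section \<open>The T-ideal of the variety\<close>

definition poly_part :: "'k::comm_ring_1 gelem set \<Rightarrow> 'k yzpoly set" where
  "poly_part T = {p. gpoly p \<in> T}"

lemma mem_poly_part: "p \<in> poly_part T \<longleftrightarrow> gpoly p \<in> T"
  by (simp add: poly_part_def)

lemma
  assumes T: "T_ideal (G d) T"
  shows poly_part_subspace: "psubspace (poly_part T)"
    and poly_part_lft: "A \<in> gcarrier d \<Longrightarrow> p \<in> poly_part T \<Longrightarrow> lft A * p \<in> poly_part T"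
    and poly_part_rgt: "A \<in> gcarrier d \<Longrightarrow> p \<in> poly_part T \<Longrightarrow> rgt A * p \<in> poly_part T"
    and poly_part_subst: "p \<in> poly_part T \<Longrightarrow> (\<And>i. i < d \<Longrightarrow> \<tau> i \<in> gcarrier d) \<Longrightarrow>
      psubst (subst_var \<tau>) p \<in> poly_part T"
proof -
  have T': "aideal (G d) T" using T by (simp add: T_ideal_def)
  show "psubspace (poly_part T)"
    using aidealD[OF T'] by (simp add: psubspace_def poly_part_def gpoly_add flip: gscale_gpoly)
  show "A \<in> gcarrier d \<Longrightarrow> p \<in> poly_part T \<Longrightarrow> lft A * p \<in> poly_part T"
    using aidealD(5)[OF T', of A "gpoly p"] by (simp add: poly_part_def gmult_eq)
  show "A \<in> gcarrier d \<Longrightarrow> p \<in> poly_part T \<Longrightarrow> rgt A * p \<in> poly_part T"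
    using aidealD(6)[OF T', of A "gpoly p"] by (simp add: poly_part_def gmult_eq mult.commute)
  show "p \<in> poly_part T \<Longrightarrow> (\<And>i. i < d \<Longrightarrow> \<tau> i \<in> gcarrier d) \<Longrightarrow>
      psubst (subst_var \<tau>) p \<in> poly_part T"
    using T_ideal_subst_endo[OF T, of \<tau> "gpoly p"] by (simp add: poly_part_def subst_endo_gpoly)
qed

lemma poly_part_py: "T_ideal (G d) T \<Longrightarrow> i < d \<Longrightarrow> p \<in> poly_part T \<Longrightarrow> py i * p \<in> poly_part T"
  using poly_part_lft[of d T "gx i" p] by simp

lemma poly_part_pz: "T_ideal (G d) T \<Longrightarrow> i < d \<Longrightarrow> p \<in> poly_part T \<Longrightarrow> pz i * p \<in> poly_part T"
  using poly_part_rgt[of d T "gx i" p] by simp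

lemma poly_part_mon:
  assumes T: "T_ideal (G d) T" and "p \<in> poly_part T" "set as \<subseteq> {..<d}" "set bs \<subseteq> {..<d}"
  shows "ymon as * zmon bs * p \<in> poly_part T"
proof -
  have z: "zmon bs * p \<in> poly_part T" using assms(4)
    by (induction bs) (auto simp: assms(2) poly_part_pz[OF T] mult.assoc)
  show ?thesis using assms(3)
    by (induction as) (auto simp: z poly_part_py[OF T] mult.assoc)
qed

text \<open>It is applied to polynomials in the first two indices; the value 0 elsewhere keeps the
  whole tuple in the carrier.\<close>

definition pair_subst :: "'k gelem \<Rightarrow> 'k gelem \<Rightarrow> nat \<Rightarrow> 'k::comm_ring_1 gelem" where
  "pair_subst A B i = (if i = 0 then A else if i = 1 then B else 0)"

lemma pair_subst_simps [simp]: "pair_subst A B 0 = A" "pair_subst A B (Suc 0) = B"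
  by (simp_all add: pair_subst_def)

lemma poly_part_pair_subst:
  "T_ideal (G d) T \<Longrightarrow> p \<in> poly_part T \<Longrightarrow> A \<in> gcarrier d \<Longrightarrow> B \<in> gcarrier d \<Longrightarrow>
     psubst (subst_var (pair_subst A B)) p \<in> poly_part T"
  by (rule poly_part_subst) (auto simp: pair_subst_def)

lemma psubst_skew12: "psubst (subst_var \<tau>) skew12 = skew (\<tau> 0) (\<tau> 1)"
  by (simp add: skew12_def skew_def psubst_simps)

lemma gpoly_yz_carrier: "i < d \<Longrightarrow> j < d \<Longrightarrow> gpoly (py i * pz j) \<in> gcarrier d"
  using gcarrier_mult[of "gx i" d "gx j"] by (simp add: gmult_eq)

section \<open>Relations that follow from the defining identity of the variety\<close>

locale vbeta =
  fixes d :: nat and \<beta>\<^sub>1 \<beta>\<^sub>2 :: "'k::field_char_0"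
  assumes d2: "2 \<le> d" and \<beta>: "\<beta>\<^sub>1 * \<beta>\<^sub>2 * (\<beta>\<^sub>1 + \<beta>\<^sub>2) * (\<beta>\<^sub>1 - \<beta>\<^sub>2) \<noteq> 0"
begin

lemma \<beta>_nonzero: "\<beta>\<^sub>1 \<noteq> 0" "\<beta>\<^sub>2 \<noteq> 0" "\<beta>\<^sub>1 + \<beta>\<^sub>2 \<noteq> 0"
  using \<beta> by auto

lemma d_pos: "0 < d" "1 < d" "Suc 0 < d"
  using d2 by auto

abbreviation TB :: "'k gelem set" where "TB \<equiv> T_beta d \<beta>\<^sub>1 \<beta>\<^sub>2"

abbreviation IB :: "'k yzpoly set" where "IB \<equiv> poly_part TB"

abbreviation cls :: "'k gelem \<Rightarrow> 'k gelem set" where "cls \<equiv> gv d \<beta>\<^sub>1 \<beta>\<^sub>2"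

lemma beta_poly_carrier: "beta_poly \<beta>\<^sub>1 \<beta>\<^sub>2 \<in> gcarrier d"
proof -
  have "gpoly skew12 \<in> ghom d (1 + 1)" by (rule bihom_ghom[OF skew12_bihom[OF d2]]) simp_all
  from ghom_carrier[OF this] have s: "skew12 \<in> poly_part (gcarrier d)" by (simp add: mem_poly_part)
  note V = poly_part_subspace[OF T_ideal_gcarrier]
  have "pconst \<beta>\<^sub>1 * (py 0 * skew12) + pconst \<beta>\<^sub>2 * (pz 0 * skew12) \<in> poly_part (gcarrier d)"
    by (intro psubspaceD[OF V] poly_part_py[OF T_ideal_gcarrier] poly_part_pz[OF T_ideal_gcarrier] s d_pos)
  then show ?thesis by (simp add: beta_poly_def mem_poly_part algebra_simps)
qed

lemma TB_T_ideal: "T_ideal (G d) TB"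
  unfolding T_beta_def
  by (rule T_ideal_T_ideal_gen) (simp_all add: T_ideal_gcarrier beta_poly_carrier)

lemma TB_aideal: "aideal (G d) TB"
  using TB_T_ideal by (simp add: T_ideal_def)

lemmas IB_subspace = poly_part_subspace[OF TB_T_ideal]
lemmas IB_scale = psubspaceD(3)[OF IB_subspace]
lemmas IB_diff = psubspace_diff[OF IB_subspace]
lemmas IB_cancel = psubspace_cancel[OF IB_subspace]
lemmas IB_lft = poly_part_lft[OF TB_T_ideal]
lemmas IB_rgt = poly_part_rgt[OF TB_T_ideal]

lemma TB_collapse: "a \<in> TB \<Longrightarrow> collapse a = 0"
proof -
  have "TB \<subseteq> {a \<in> gcarrier d. collapse a = 0}"
    unfolding T_beta_def using beta_poly_carrier
    by (intro T_ideal_gen_least T_ideal_collapse) (simp add: beta_poly_def psubst_mult)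
  then show "a \<in> TB \<Longrightarrow> collapse a = 0" by blast
qed

lemma IB_relation:
  assumes "A \<in> gcarrier d" "B \<in> gcarrier d" "C \<in> gcarrier d"
  shows "(pconst \<beta>\<^sub>1 * lft A + pconst \<beta>\<^sub>2 * rgt A) * skew B C \<in> IB"
proof (rule skew_polarization[OF IB_subspace gcarrier_add _ assms])
  fix A B :: "'k gelem" assume AB: "A \<in> gcarrier d" "B \<in> gcarrier d"
  have "(pconst \<beta>\<^sub>1 * py 0 + pconst \<beta>\<^sub>2 * pz 0) * skew12 \<in> IB"
    using T_ideal_gen_superset[of "{beta_poly \<beta>\<^sub>1 \<beta>\<^sub>2}" "G d"]
    by (simp add: mem_poly_part T_beta_def beta_poly_def)
  from poly_part_pair_subst[OF TB_T_ideal this AB]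
  show "(pconst \<beta>\<^sub>1 * lft A + pconst \<beta>\<^sub>2 * rgt A) * skew A B \<in> IB"
    by (simp add: psubst_simps psubst_skew12)
qed

text \<open>For a polynomial in the first place of \<open>IB_relation\<close> the two operators
  coincide, and the linear factor becomes \<open>\<beta>\<^sub>1 + \<beta>\<^sub>2\<close> times
  that polynomial.\<close>

lemma IB_poly_skew:
  assumes "gpoly p \<in> gcarrier d" "B \<in> gcarrier d" "C \<in> gcarrier d"
  shows "p * skew B C \<in> IB"
proof -
  have "(pconst (\<beta>\<^sub>1 + \<beta>\<^sub>2)) * (p * skew B C) \<in> IB"
    using IB_relation[OF assms] by (simp add: pconst_add algebra_simps)
  then show ?thesis by (rule IB_cancel) (rule \<beta>_nonzero)
qed

text \<open>A polynomial as second entry of the commutator can be factored out, which leaves the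
  difference between the left and right operators of \<open>B\<close>.\<close>

lemma IB_poly_diff:
  assumes "gpoly p \<in> gcarrier d" "A \<in> gcarrier d" "B \<in> gcarrier d"
  shows "(pconst \<beta>\<^sub>1 * lft A + pconst \<beta>\<^sub>2 * rgt A) * (p * (lft B - rgt B)) \<in> IB"
  using IB_relation[OF assms(2,3,1)] by (simp add: skew_def algebra_simps)

lemma IB_poly_poly_diff:
  assumes "gpoly p \<in> gcarrier d" "gpoly q \<in> gcarrier d" "B \<in> gcarrier d"
  shows "q * (p * (lft B - rgt B)) \<in> IB"
  using IB_poly_skew[OF assms(2,3,1)] by (simp add: skew_def algebra_simps)

text \<open>The mixed product \<open>lft A * rgt B\<close> is the polynomial of
  \<open>gmult A B\<close>, so \<open>IB_poly_skew\<close> covers it. Multiplying the defining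
  relation by a left or right operator then isolates the two unmixed products.\<close>

lemma IB_quadratic_skew:
  assumes "A \<in> gcarrier d" "B \<in> gcarrier d" "C \<in> gcarrier d" "D \<in> gcarrier d"
  shows "lft A * rgt B * skew C D \<in> IB" "lft A * lft B * skew C D \<in> IB" "rgt A * rgt B * skew C D \<in> IB"
proof -
  have lr: "lft A * rgt B * skew C D \<in> IB" if "A \<in> gcarrier d" "B \<in> gcarrier d" for A B
    using IB_poly_skew[of "lft A * rgt B" C D] gcarrier_mult[OF that] assms(3,4) by (simp add: gmult_eq)
  show "lft A * rgt B * skew C D \<in> IB" by (rule lr[OF assms(1,2)])
  have "lft B * ((pconst \<beta>\<^sub>1 * lft A + pconst \<beta>\<^sub>2 * rgt A) * skew C D) -
      pconst \<beta>\<^sub>2 * (lft B * rgt A * skew C D) \<in> IB"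
    by (intro IB_diff IB_scale lr IB_lft IB_relation assms)
  then have "pconst \<beta>\<^sub>1 * (lft A * lft B * skew C D) \<in> IB" by (simp add: algebra_simps)
  then show "lft A * lft B * skew C D \<in> IB" by (rule IB_cancel) (rule \<beta>_nonzero)
  have "rgt B * ((pconst \<beta>\<^sub>1 * lft A + pconst \<beta>\<^sub>2 * rgt A) * skew C D) -
      pconst \<beta>\<^sub>1 * (lft A * rgt B * skew C D) \<in> IB"
    by (intro IB_diff IB_scale lr IB_rgt IB_relation assms)
  then have "pconst \<beta>\<^sub>2 * (rgt A * rgt B * skew C D) \<in> IB" by (simp add: algebra_simps)
  then show "rgt A * rgt B * skew C D \<in> IB" by (rule IB_cancel) (rule \<beta>_nonzero)
qed

lemma IB_kills_skew:
  assumes "2 \<le> n"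
  shows "kills_skew d n IB"
  unfolding kills_skew_def
proof (intro allI impI)
  fix qs :: "'k yzpoly list" and A B :: "'k gelem"
  assume qs: "set qs \<subseteq> lin_forms d" "length qs = n" and AB: "A \<in> lin d" "B \<in> lin d"
  obtain p q rs where eq: "qs = p # q # rs"
    using qs(2) assms by (cases qs; cases "tl qs") auto
  have pq: "p * q * skew A B \<in> IB"
  proof -
    have "p \<in> lft ` lin d \<union> rgt ` lin d" "q \<in> lft ` lin d \<union> rgt ` lin d"
      using qs(1) by (simp_all add: eq lin_forms_def)
    then show ?thesis
      using IB_quadratic_skew[OF _ _ lin_carrier[OF AB(1)] lin_carrier[OF AB(2)]]
      by (elim UnE imageE) (simp_all add: lin_carrier mult.commute[of "rgt _" "lft _"])
  qed
  have "set rs \<subseteq> lin_forms d" using qs(1) eq by simp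
  then have "prod_list rs * (p * q * skew A B) \<in> IB"
  proof (induction rs)
    case (Cons r rs)
    then have "prod_list rs * (p * q * skew A B) \<in> IB" "r \<in> lft ` lin d \<union> rgt ` lin d"
      by (simp_all add: lin_forms_def)
    then have "r * (prod_list rs * (p * q * skew A B)) \<in> IB"
      by (elim UnE imageE) (simp_all add: IB_lft IB_rgt lin_carrier)
    then show ?case by (simp add: mult.assoc)
  qed (simp add: pq)
  then show "prod_list qs * skew A B \<in> IB" by (simp add: eq mult_ac)
qed

text \<open>The first case has polynomials in two places of the relation. Multiplying the relation
  with one polynomial by \<open>py l\<close> or \<open>pz l\<close> and subtracting that case
  isolates the other two.\<close>

lemma IB_yz_diff:
  assumes "i < d" "j < d" "k < d" "l < d" "m < d"
  shows "py i * pz j * (py k * pz l) * (py m - pz m) \<in> IB"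
    "py i * pz j * (py k * py l) * (py m - pz m) \<in> IB"
    "py i * pz j * (pz k * pz l) * (py m - pz m) \<in> IB"
proof -
  note yz = gpoly_yz_carrier
  have *: "py i * pz j * (py k * pz l) * (py m - pz m) \<in> IB"
    if "i < d" "j < d" "k < d" "l < d" for i j k l
    using IB_poly_poly_diff[OF yz[OF that(3,4)] yz[OF that(1,2)] gcarrier_gx[OF assms(5)]]
    by (simp add: mult_ac)
  show "py i * pz j * (py k * pz l) * (py m - pz m) \<in> IB" by (intro * assms)
  let ?r = "(pconst \<beta>\<^sub>1 * py k + pconst \<beta>\<^sub>2 * pz k) * (py i * pz j * (py m - pz m))"
  have r: "?r \<in> IB"
    using IB_poly_diff[OF yz[OF assms(1,2)] gcarrier_gx[OF assms(3)] gcarrier_gx[OF assms(5)]]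
    by simp
  have "py l * ?r - pconst \<beta>\<^sub>2 * (py i * pz j * (py l * pz k) * (py m - pz m)) \<in> IB"
    by (intro IB_diff IB_scale * poly_part_py[OF TB_T_ideal] r assms)
  then have "pconst \<beta>\<^sub>1 * (py i * pz j * (py k * py l) * (py m - pz m)) \<in> IB"
    by (simp add: algebra_simps)
  then show "py i * pz j * (py k * py l) * (py m - pz m) \<in> IB"
    by (rule IB_cancel) (rule \<beta>_nonzero)
  have "pz l * ?r - pconst \<beta>\<^sub>1 * (py i * pz j * (py k * pz l) * (py m - pz m)) \<in> IB"
    by (intro IB_diff IB_scale * poly_part_pz[OF TB_T_ideal] r assms)
  then have "pconst \<beta>\<^sub>2 * (py i * pz j * (pz k * pz l) * (py m - pz m)) \<in> IB"
    by (simp add: algebra_simps)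
  then show "py i * pz j * (pz k * pz l) * (py m - pz m) \<in> IB"
    by (rule IB_cancel) (rule \<beta>_nonzero)
qed

text \<open>Beside one y and one z, at least two factors remain: two y's, two z's, or one of each.
  Each possibility exhibits a factor treated in \<open>IB_yz_diff\<close>.\<close>

lemma IB_mon_diff:
  assumes "set as \<subseteq> {..<d}" "set bs \<subseteq> {..<d}" "as \<noteq> []" "bs \<noteq> []" "4 \<le> length as + length bs"
    "m < d"
  shows "ymon as * zmon bs * (py m - pz m) \<in> IB"
proof -
  obtain a as' b bs' where 1: "as = a # as'" "bs = b # bs'" using assms(3,4) by (meson neq_Nil_conv)
  consider a' as'' b' bs'' where "as' = a' # as''" "bs' = b' # bs''"
    | a' a'' as'' where "as' = a' # a'' # as''" "bs' = []"
    | b' b'' bs'' where "bs' = b' # b'' # bs''" "as' = []"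
  proof (cases as'; cases bs')
    assume "as' = []" "bs' = []"
    then show thesis using assms(5) 1 by simp
  next
    fix b' cs assume "as' = []" "bs' = b' # cs"
    then show thesis using assms(5) 1 that(3) by (cases cs) auto
  next
    fix a' cs assume "bs' = []" "as' = a' # cs"
    then show thesis using assms(5) 1 that(2) by (cases cs) auto
  qed (use that(1) in blast)
  then show ?thesis
  proof cases
    case 1
    have "ymon as'' * zmon bs'' * (py a * pz b * (py a' * pz b') * (py m - pz m)) \<in> IB"
      by (intro poly_part_mon[OF TB_T_ideal] IB_yz_diff) (use assms 1 \<open>as = _\<close> \<open>bs = _\<close> in auto)
    then show ?thesis using 1 \<open>as = _\<close> \<open>bs = _\<close> by (simp add: mult_ac)
  next
    case 2
    have "ymon as'' * zmon [] * (py a * pz b * (py a' * py a'') * (py m - pz m)) \<in> IB"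
      by (intro poly_part_mon[OF TB_T_ideal] IB_yz_diff) (use assms 2 \<open>as = _\<close> \<open>bs = _\<close> in auto)
    then show ?thesis using 2 \<open>as = _\<close> \<open>bs = _\<close> by (simp add: mult_ac)
  next
    case 3
    have "ymon [] * zmon bs'' * (py a * pz b * (pz b' * pz b'') * (py m - pz m)) \<in> IB"
      by (intro poly_part_mon[OF TB_T_ideal] IB_yz_diff) (use assms 3 \<open>as = _\<close> \<open>bs = _\<close> in auto)
    then show ?thesis using 3 \<open>as = _\<close> \<open>bs = _\<close> by (simp add: mult_ac)
  qed
qed

end

section \<open>Consequences and submodules\<close>

context vbeta
begin

text \<open>The counterpart of \<open>GL_submodule\<close> among polynomials; containing
  \<open>IB\<close> takes the place of passing to the factor algebra.\<close>

definition gl_stable :: "'k yzpoly set \<Rightarrow> bool" where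
  "gl_stable V \<longleftrightarrow> psubspace V \<and> IB \<subseteq> V \<and>
     (\<forall>g\<in>GLd d. \<forall>p\<in>V. psubst (subst_var (gl_tuple d g)) p \<in> V)"

lemma gl_stable_subspace: "gl_stable V \<Longrightarrow> psubspace V"
  by (simp add: gl_stable_def)

lemma gl_stable_IB: "gl_stable V \<Longrightarrow> p \<in> IB \<Longrightarrow> p \<in> V"
  by (auto simp: gl_stable_def)

lemma cls_eq_iff: "cls a = cls b \<longleftrightarrow> a - b \<in> TB"
  unfolding gv_def by (rule acoset_eq_iff[OF TB_aideal])

lemma cls_ops:
  "a \<in> gcarrier d \<Longrightarrow> b \<in> gcarrier d \<Longrightarrow> aplus (GV d \<beta>\<^sub>1 \<beta>\<^sub>2) (cls a) (cls b) = cls (a + b)"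
  "a \<in> gcarrier d \<Longrightarrow> ascale (GV d \<beta>\<^sub>1 \<beta>\<^sub>2) c (cls a) = cls (gscale c a)"
  unfolding GV_def gv_def by (simp_all add: afactor_simps[OF TB_aideal])

lemma GV_carrier: "acarrier (GV d \<beta>\<^sub>1 \<beta>\<^sub>2) = cls ` gcarrier d" "azero (GV d \<beta>\<^sub>1 \<beta>\<^sub>2) = cls 0"
  by (simp_all add: GV_def gv_def afactor_carrier)

lemma gl_act_cls:
  "g \<in> GLd d \<Longrightarrow> a \<in> gcarrier d \<Longrightarrow> gl_act d g ` cls a = cls (subst_endo (gl_tuple d g) a)"
  unfolding gv_def by (rule gl_act_acoset[OF TB_T_ideal])

lemma gl_stable_preimage:
  assumes W: "GL_submodule d \<beta>\<^sub>1 \<beta>\<^sub>2 W"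
  shows "gl_stable {p. gpoly p \<in> gcarrier d \<and> cls (gpoly p) \<in> W}"
proof -
  have zero: "cls 0 \<in> W" and add: "\<And>u v. u \<in> W \<Longrightarrow> v \<in> W \<Longrightarrow> aplus (GV d \<beta>\<^sub>1 \<beta>\<^sub>2) u v \<in> W"
    and scale: "\<And>c u. u \<in> W \<Longrightarrow> ascale (GV d \<beta>\<^sub>1 \<beta>\<^sub>2) c u \<in> W"
    and gl: "\<And>g C. g \<in> GLd d \<Longrightarrow> C \<in> W \<Longrightarrow> gl_act d g ` C \<in> W"
    using W by (auto simp: GL_submodule_def asubspace_def GV_carrier)
  show ?thesis
    unfolding gl_stable_def psubspace_def
  proof (intro conjI ballI allI subsetI CollectI; (elim CollectE conjE)?)
    fix p q assume "gpoly p \<in> gcarrier d" "cls (gpoly p) \<in> W" "gpoly q \<in> gcarrier d" "cls (gpoly q) \<in> W"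
    then show "gpoly (p + q) \<in> gcarrier d" "cls (gpoly (p + q)) \<in> W"
      using add[of "cls (gpoly p)" "cls (gpoly q)"] by (simp_all add: gpoly_add gcarrier_add cls_ops)
  next
    fix c p assume "gpoly p \<in> gcarrier d" "cls (gpoly p) \<in> W"
    then show "gpoly (pconst c * p) \<in> gcarrier d" "cls (gpoly (pconst c * p)) \<in> W"
      using scale[of "cls (gpoly p)" c] by (simp_all add: gcarrier_scale cls_ops flip: gscale_gpoly)
  next
    fix p assume "p \<in> IB"
    then have p: "gpoly p \<in> TB" by (simp add: mem_poly_part)
    then show "gpoly p \<in> gcarrier d" using aidealD(1)[OF TB_aideal] by blast
    have "cls (gpoly p) = cls 0" using p by (simp add: cls_eq_iff)
    then show "cls (gpoly p) \<in> W" using zero by simp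
  next
    fix g :: "'k mat" and p assume g: "g \<in> GLd d" and p: "gpoly p \<in> gcarrier d" "cls (gpoly p) \<in> W"
    show "gpoly (psubst (subst_var (gl_tuple d g)) p) \<in> gcarrier d"
      using subst_endo_carrier[OF gl_tuple_carrier p(1)] by (simp add: subst_endo_gpoly)
    show "cls (gpoly (psubst (subst_var (gl_tuple d g)) p)) \<in> W"
      using gl[OF g p(2)] gl_act_cls[OF g p(1)] by (simp add: subst_endo_gpoly)
  qed (simp_all add: zero)
qed

lemma T_ideal_GV_carrier: "T_ideal (GV d \<beta>\<^sub>1 \<beta>\<^sub>2) (acarrier (GV d \<beta>\<^sub>1 \<beta>\<^sub>2))"
  unfolding GV_def by (rule T_ideal_afactor_carrier[OF TB_aideal])

lemma T_ideal_gen_GV: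
  "f \<in> gcarrier d \<Longrightarrow> T_ideal (GV d \<beta>\<^sub>1 \<beta>\<^sub>2) (T_ideal_gen (GV d \<beta>\<^sub>1 \<beta>\<^sub>2) {cls f})"
  by (rule T_ideal_T_ideal_gen[OF T_ideal_GV_carrier]) (simp add: GV_carrier)

lemma T_ideal_pullback:
  assumes "T_ideal (GV d \<beta>\<^sub>1 \<beta>\<^sub>2) T"
  shows "T_ideal (G d) {a \<in> gcarrier d. cls a \<in> T}" "TB \<subseteq> {a \<in> gcarrier d. cls a \<in> T}"
  unfolding gv_def using T_ideal_preimage[OF TB_T_ideal] assms by (simp_all add: GV_def)

lemma collapse_consequence:
  assumes "f \<in> gcarrier d" "collapse f = 0" "cls a \<in> T_ideal_gen (GV d \<beta>\<^sub>1 \<beta>\<^sub>2) {cls f}"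
  shows "collapse a = 0"
proof -
  have "T_ideal (GV d \<beta>\<^sub>1 \<beta>\<^sub>2) (cls ` {a \<in> gcarrier d. collapse a = 0})"
    unfolding GV_def gv_def by (rule T_ideal_afactor_collapse[OF TB_aideal TB_collapse])
  then have "T_ideal_gen (GV d \<beta>\<^sub>1 \<beta>\<^sub>2) {cls f} \<subseteq> cls ` {a \<in> gcarrier d. collapse a = 0}"
    by (rule T_ideal_gen_least) (use assms(1,2) in simp)
  then obtain b where "cls a = cls b" "collapse b = 0" using assms(3) by blast
  then have "collapse (a - b) = 0" using TB_collapse cls_eq_iff by blast
  then show ?thesis using \<open>collapse b = 0\<close> collapse_simps(1)[of "a - b" b] by simp
qed

text \<open>A matrix acts as a degree preserving endomorphism. Hence the consequences of degree
  \<open>k\<close> are one of the submodules intersected in \<open>GL_submodule_gen\<close> as soon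
  as they contain the list.\<close>

lemma consequences_submodule:
  assumes f: "f \<in> gcarrier d" and k: "2 \<le> k"
  shows "GL_submodule d \<beta>\<^sub>1 \<beta>\<^sub>2 (consequences d \<beta>\<^sub>1 \<beta>\<^sub>2 k f)"
proof -
  let ?T = "T_ideal_gen (GV d \<beta>\<^sub>1 \<beta>\<^sub>2) {cls f}"
  note T = T_ideal_gen_GV[OF f]
  have sub: "asubspace (GV d \<beta>\<^sub>1 \<beta>\<^sub>2) (?T \<inter> cls ` ghom d k)"
    unfolding asubspace_def
  proof (intro conjI ballI allI)
    show "?T \<inter> cls ` ghom d k \<subseteq> acarrier (GV d \<beta>\<^sub>1 \<beta>\<^sub>2)"
      using T_idealD(1)[OF T] by blast
    show "azero (GV d \<beta>\<^sub>1 \<beta>\<^sub>2) \<in> ?T \<inter> cls ` ghom d k"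
      using T_idealD(2)[OF T] imageI[OF ghom_0, of cls d k] by (simp add: GV_carrier)
  next
    fix u v assume "u \<in> ?T \<inter> cls ` ghom d k" "v \<in> ?T \<inter> cls ` ghom d k"
    then obtain a b where *: "u \<in> ?T" "v \<in> ?T" "u = cls a" "v = cls b" "a \<in> ghom d k" "b \<in> ghom d k"
      by blast
    then have "aplus (GV d \<beta>\<^sub>1 \<beta>\<^sub>2) u v = cls (a + b)" by (simp add: cls_ops ghom_carrier)
    then show "aplus (GV d \<beta>\<^sub>1 \<beta>\<^sub>2) u v \<in> ?T \<inter> cls ` ghom d k"
      using T_idealD(3)[OF T *(1,2)] ghom_add[OF *(5,6)] by simp
  next
    fix c u assume "u \<in> ?T \<inter> cls ` ghom d k"
    then obtain a where *: "u \<in> ?T" "u = cls a" "a \<in> ghom d k" by blast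
    then have "ascale (GV d \<beta>\<^sub>1 \<beta>\<^sub>2) c u = cls (gscale c a)" by (simp add: cls_ops ghom_carrier)
    then show "ascale (GV d \<beta>\<^sub>1 \<beta>\<^sub>2) c u \<in> ?T \<inter> cls ` ghom d k"
      using T_idealD(4)[OF T *(1), of c] ghom_scale[OF *(3)] by simp
  qed
  have gl: "gl_act d g ` C \<in> ?T \<inter> cls ` ghom d k" if g: "g \<in> GLd d" and C: "C \<in> ?T \<inter> cls ` ghom d k" for g C
  proof -
    obtain a where a: "cls a \<in> ?T" "C = cls a" "a \<in> ghom d k" using C by blast
    have "subst_endo (gl_tuple d g) a \<in> {a \<in> gcarrier d. cls a \<in> ?T}"
      by (rule T_ideal_subst_endo[OF T_ideal_pullback(1)[OF T] gl_tuple_carrier])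
         (use a ghom_carrier[OF a(3)] in simp)
    then show ?thesis
      using a ghom_gl[OF a(3) k] by (simp add: gl_act_cls[OF g ghom_carrier])
  qed
  show ?thesis unfolding GL_submodule_def consequences_def using sub gl by blast
qed

text \<open>Both inclusions become statements about \<open>G d\<close> and polynomials. The premise
  \<open>upper\<close> speaks of all homogeneous elements, restricted to the kernel of
  \<open>collapse\<close> when \<open>f\<close> lies in it; nothing else about being a consequence
  is used for the upper bound.\<close>

lemma consequences_equivI:
  assumes k: "2 \<le> k" and f: "f \<in> gcarrier d" and L: "\<And>l. l \<in> L \<Longrightarrow> l \<in> ghom d k"
    and lower: "\<And>T l. T_ideal (G d) T \<Longrightarrow> TB \<subseteq> T \<Longrightarrow> f \<in> T \<Longrightarrow> l \<in> L \<Longrightarrow> l \<in> T"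
    and upper: "\<And>V a. gl_stable V \<Longrightarrow> (\<And>l. l \<in> L \<Longrightarrow> snd l \<in> V) \<Longrightarrow> a \<in> ghom d k \<Longrightarrow>
      (collapse f = 0 \<Longrightarrow> collapse a = 0) \<Longrightarrow> snd a \<in> V"
  shows "consequences_equiv d \<beta>\<^sub>1 \<beta>\<^sub>2 k f L"
  unfolding consequences_equiv_def
proof (intro equalityI subsetI)
  let ?T = "T_ideal_gen (GV d \<beta>\<^sub>1 \<beta>\<^sub>2) {cls f}"
  fix C assume "C \<in> consequences d \<beta>\<^sub>1 \<beta>\<^sub>2 k f"
  then obtain a where a: "C = cls a" "cls a \<in> ?T" "a \<in> ghom d k"
    unfolding consequences_def by blast
  have "cls a \<in> W" if W: "GL_submodule d \<beta>\<^sub>1 \<beta>\<^sub>2 W" and LW: "cls ` L \<subseteq> W" for W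
  proof -
    have "snd a \<in> {p. gpoly p \<in> gcarrier d \<and> cls (gpoly p) \<in> W}"
    proof (rule upper[OF gl_stable_preimage[OF W] _ a(3)])
      fix l assume l: "l \<in> L"
      then show "snd l \<in> {p. gpoly p \<in> gcarrier d \<and> cls (gpoly p) \<in> W}"
        using LW ghom_gpoly[OF L[OF l] k, symmetric] ghom_carrier[OF L[OF l]] by auto
    next
      assume "collapse f = 0"
      then show "collapse a = 0" by (rule collapse_consequence[OF f _ a(2)])
    qed
    then show ?thesis using ghom_gpoly[OF a(3) k, symmetric] by simp
  qed
  then show "C \<in> GL_submodule_gen d \<beta>\<^sub>1 \<beta>\<^sub>2 (cls ` L)"
    unfolding GL_submodule_gen_def a(1) by blast
next
  let ?T = "T_ideal_gen (GV d \<beta>\<^sub>1 \<beta>\<^sub>2) {cls f}"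
  fix C assume C: "C \<in> GL_submodule_gen d \<beta>\<^sub>1 \<beta>\<^sub>2 (cls ` L)"
  note P = T_ideal_pullback[OF T_ideal_gen_GV[OF f]]
  have "f \<in> {a \<in> gcarrier d. cls a \<in> ?T}"
    using f T_ideal_gen_superset[of "{cls f}"] by simp
  then have "l \<in> {a \<in> gcarrier d. cls a \<in> ?T}" if "l \<in> L" for l
    by (rule lower[OF P _ that])
  then have "cls ` L \<subseteq> consequences d \<beta>\<^sub>1 \<beta>\<^sub>2 k f"
    unfolding consequences_def using L by blast
  then show "C \<in> consequences d \<beta>\<^sub>1 \<beta>\<^sub>2 k f"
    using C consequences_submodule[OF f k] unfolding GL_submodule_gen_def by blast
qed

text \<open>By density, the tuple starting with \<open>A + gscale c (gx 0)\<close> and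
  \<open>B + gscale c (gx 1)\<close> comes from an invertible matrix for infinitely many
  \<open>c\<close>. The constant coefficient in \<open>c\<close> is the substitution of
  \<open>A\<close> and \<open>B\<close> themselves, which need not extend to an invertible
  matrix.\<close>

lemma gl_orbit:
  fixes q :: "'k yzpoly poly"
  assumes V: "gl_stable V" and p: "p \<in> V" and AB: "A \<in> lin d" "B \<in> lin d"
    and q: "\<And>c \<tau>. \<tau> 0 = A + gscale c (gx 0) \<Longrightarrow> \<tau> 1 = B + gscale c (gx 1) \<Longrightarrow>
      psubst (subst_var \<tau>) p = poly q (pconst c)"
  shows "coeff q 0 \<in> V"
proof -
  from GLd_dense[OF d2 AB] obtain S where S: "infinite S"
    "\<And>c. c \<in> S \<Longrightarrow> \<exists>g\<in>GLd d. gl_tuple d g 0 = A + gscale c (gx 0) \<and> gl_tuple d g 1 = B + gscale c (gx 1)"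
    by blast
  show ?thesis
  proof (rule coeff_in_psubspace[OF gl_stable_subspace[OF V] S(1)])
    fix c assume "c \<in> S"
    from S(2)[OF this] obtain g where "g \<in> GLd d" "gl_tuple d g 0 = A + gscale c (gx 0)"
      "gl_tuple d g 1 = B + gscale c (gx 1)" by blast
    then show "poly q (pconst c) \<in> V"
      using q[of "gl_tuple d g" c, symmetric] V p by (simp add: gl_stable_def)
  qed
qed

lemma gl_orbit_one_var:
  assumes V: "gl_stable V" and A: "A \<in> lin d"
    and p: "py 0 ^ a * pz 0 ^ b * (pconst e1 * py 0 + pconst e2 * pz 0) \<in> V"
  shows "lft A ^ a * rgt A ^ b * (pconst e1 * lft A + pconst e2 * rgt A) \<in> V"
proof -
  let ?q = "[:lft A, py 0:] ^ a * [:rgt A, pz 0:] ^ b *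
    [:pconst e1 * lft A + pconst e2 * rgt A, pconst e1 * py 0 + pconst e2 * pz 0:]"
  have "coeff ?q 0 \<in> V"
    by (rule gl_orbit[OF V p A A]) (simp add: psubst_simps poly_power algebra_simps)
  then show ?thesis unfolding coeff_mult_0' coeff_linear_power by simp
qed

lemma gl_orbit_skew:
  assumes V: "gl_stable V" and AB: "A \<in> lin d" "B \<in> lin d" and p: "py 0 ^ a * skew12 \<in> V"
  shows "lft A ^ a * skew A B \<in> V"
proof -
  let ?q = "[:lft A, py 0:] ^ a *
    ([:lft A, py 0:] * [:rgt B, pz 1:] - [:lft B, py 1:] * [:rgt A, pz 0:])"
  have "coeff ?q 0 \<in> V"
    by (rule gl_orbit[OF V p AB])
       (simp add: psubst_simps psubst_skew12 skew_def poly_power algebra_simps)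
  then show ?thesis unfolding coeff_mult_0' coeff_linear_power by (simp add: skew_def mult.commute)
qed

lemma kills_skew_mono: "gl_stable V \<Longrightarrow> 2 \<le> n \<Longrightarrow> kills_skew d n V"
  using IB_kills_skew[of n] gl_stable_IB[of V] unfolding kills_skew_def by blast

lemma kills_skew_0:
  assumes V: "gl_stable V" and p: "skew12 \<in> V"
  shows "kills_skew d 0 V"
  using gl_orbit_skew[OF V, of _ _ 0] p by (simp add: kills_skew_def)

text \<open>The cyclic polarization with coefficients 1 and 0 separates the left operator from the
  commutator. The defining relation then passes from left to right operators because
  \<open>\<beta>\<^sub>2\<close> is nonzero.\<close>

lemma kills_skew_1:
  assumes V: "gl_stable V" and p: "py 0 * skew12 \<in> V"
  shows "kills_skew d 1 V"
  unfolding kills_skew_def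
proof (intro allI impI)
  fix qs :: "'k yzpoly list" and A B :: "'k gelem"
  assume qs: "set qs \<subseteq> lin_forms d" "length qs = 1" and AB: "A \<in> lin d" "B \<in> lin d"
  note V' = gl_stable_subspace[OF V]
  have l: "lft C * skew A B \<in> V" if "C \<in> lin d" for C
  proof -
    have "(pconst 1 * lft C + pconst 0 * rgt C) * skew A B \<in> V"
      by (rule skew_polarization[OF V' lin_add _ that AB])
         (use gl_orbit_skew[OF V, of _ _ 1] p in simp_all)
    then show ?thesis by simp
  qed
  have r: "rgt C * skew A B \<in> V" if C: "C \<in> lin d" for C
  proof -
    have "(pconst \<beta>\<^sub>1 * lft C + pconst \<beta>\<^sub>2 * rgt C) * skew A B - pconst \<beta>\<^sub>1 * (lft C * skew A B) \<in> V"
      by (intro psubspace_diff[OF V'] psubspaceD(3)[OF V'] l C gl_stable_IB[OF V] IB_relation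
          lin_carrier AB)
    then have "pconst \<beta>\<^sub>2 * (rgt C * skew A B) \<in> V" by (simp add: algebra_simps)
    then show ?thesis by (rule psubspace_cancel[OF V']) (rule \<beta>_nonzero)
  qed
  obtain q where q: "qs = [q]" using qs(2) by (auto simp: length_Suc_conv)
  then have "q \<in> lft ` lin d \<union> rgt ` lin d" using qs(1) by (simp add: lin_forms_def)
  then show "prod_list qs * skew A B \<in> V" unfolding q by (elim UnE imageE) (simp_all add: l r)
qed

lemma polarized:
  assumes V: "gl_stable V" and ks: "kills_skew d n V"
    and p: "py 0 ^ a * pz 0 ^ b * (pconst e1 * py 0 + pconst e2 * pz 0) \<in> V"
    and "set as \<subseteq> {..<d}" "set bs \<subseteq> {..<d}" "i < d" "length as = a" "length bs = b" "a + b = Suc n"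
  shows "(pconst e1 * py i + pconst e2 * pz i) * (ymon as * zmon bs) \<in> V"
  by (rule polarization[OF gl_stable_subspace[OF V] ks])
     (use assms gl_orbit_one_var[OF V _ p] in auto)

text \<open>One y serves as the distinguished linear factor, with coefficients 1 and 0; a nonempty
  \<open>as\<close> provides it.\<close>

lemma polarized_mon:
  assumes V: "gl_stable V" and ks: "kills_skew d n V" and p: "py 0 ^ a * pz 0 ^ b \<in> V"
    and "set as \<subseteq> {..<d}" "set bs \<subseteq> {..<d}" "as \<noteq> []" "length as = a" "length bs = b" "a + b = n + 2"
  shows "ymon as * zmon bs \<in> V"
proof -
  obtain i as' where as: "as = i # as'" using assms(6) by (cases as) auto
  have "(pconst 1 * py i + pconst 0 * pz i) * (ymon as' * zmon bs) \<in> V"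
    by (rule polarized[OF V ks, of "length as'" b])
       (use p assms as in \<open>auto simp: mult_ac\<close>)
  then show ?thesis by (simp add: as mult.assoc)
qed

lemma polarized_diff:
  assumes V: "gl_stable V" and ks: "kills_skew d n V" and p: "py 0 ^ a * pz 0 ^ b * (py 0 - pz 0) \<in> V"
    and "set as \<subseteq> {..<d}" "set bs \<subseteq> {..<d}" "i < d" "length as = a" "length bs = b" "a + b = Suc n"
  shows "ymon as * zmon bs * (py i - pz i) \<in> V"
proof -
  have "(pconst 1 * py i + pconst (- 1) * pz i) * (ymon as * zmon bs) \<in> V"
    by (rule polarized[OF V ks _ assms(4-9)]) (use p in \<open>simp add: pconst_uminus\<close>)
  then show ?thesis by (simp add: pconst_uminus algebra_simps)
qed

end

section \<open>The list of consequences\<close>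

lemma snd_gpoly [simp]: "snd (gpoly p) = p"
  by (simp add: gpoly_def)

lemma skew12_eq: "skew12 = skew (gx 0) (gx 1)"
  by (simp add: skew12_def skew_def)

context vbeta
begin

lemma w1_hom: "1 \<le> j \<Longrightarrow> j < n \<Longrightarrow> (w1 n j :: 'k gelem) \<in> ghom d n"
  by (rule w1_ghom[OF d_pos(1)])

lemma w1_carrier: "1 \<le> j \<Longrightarrow> j < n \<Longrightarrow> (w1 n j :: 'k gelem) \<in> gcarrier d"
  by (rule ghom_carrier[OF w1_hom])

lemma w2_carrier: "(w2 (j + 1) 1 j :: 'k gelem) \<in> gcarrier d"
  using w2_ghom[OF d2] ghom_carrier by blast

lemma w2_hom:
  "(w2 1 1 0 :: 'k gelem) \<in> ghom d 2" "(w2 2 1 1 :: 'k gelem) \<in> ghom d 3"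
  "(w2 3 1 2 :: 'k gelem) \<in> ghom d 4"
  using w2_ghom[OF d2, of 0] w2_ghom[OF d2, of 1] w2_ghom[OF d2, of 2]
  by (simp_all add: eval_nat_numeral)

lemma collapse_snd: "a \<in> ghom d k \<Longrightarrow> 2 \<le> k \<Longrightarrow> collapse a = psubst collapse_var (snd a)"
  by (metis ghom_gpoly collapse_simps(5))

lemma relation_yz:
  assumes "i < d" "j < d" "k < d" "l < d"
  shows "(pconst \<beta>\<^sub>1 * py k + pconst \<beta>\<^sub>2 * pz k) * (py i * pz j * (py l - pz l)) \<in> IB"
  using IB_poly_diff[OF gpoly_yz_carrier[OF assms(1,2)] gcarrier_gx[OF assms(3)]
      gcarrier_gx[OF assms(4)]] by simp

lemma length_cases_2:
  assumes "as \<noteq> []" "bs \<noteq> []" "length as + length bs = 2"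
  shows "length as = 1 \<and> length bs = 1"
  using assms by (cases as; cases bs) auto

lemma consequences_x1: "consequences_equiv d \<beta>\<^sub>1 \<beta>\<^sub>2 2 (gx 0) {w1 2 1, w2 1 1 0}"
proof (rule consequences_equivI)
  show "l \<in> ghom d 2" if "l \<in> {w1 2 1, w2 1 1 0}" for l :: "'k gelem"
    using that w1_hom w2_hom by auto
  show "l \<in> T" if T: "T_ideal (G d) T" and f: "gx 0 \<in> T" and l: "l \<in> {w1 2 1, w2 1 1 0}" for T l
  proof -
    have T': "aideal (G d) T" using T by (simp add: T_ideal_def)
    have "gpoly (py 0 * pz i) \<in> T" "gpoly (py i * pz 0) \<in> T" if "i < d" for i
      using aidealD(5,6)[OF T' gcarrier_gx[OF that] f] by (simp_all add: gmult_eq)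
    from this[of 0] this[of 1] have "gpoly (py 0 * pz 0) \<in> T" "gpoly (py 0 * pz 1 - py 1 * pz 0) \<in> T"
      using d_pos aideal_diff[OF T'] by (simp_all add: gpoly_diff)
    then show ?thesis using l by (auto simp: w1_def w2_def skew12_def)
  qed
  show "snd a \<in> V" if V: "gl_stable V" and L: "\<And>l. l \<in> {w1 2 1, w2 1 1 0} \<Longrightarrow> snd l \<in> V"
    and a: "a \<in> ghom d 2" for V a
  proof (rule ghom_span[OF gl_stable_subspace[OF V] a])
    have p: "py 0 ^ 1 * pz 0 ^ 1 \<in> V" using L[of "w1 2 1"] by (simp add: w1_def)
    have s: "skew12 \<in> V" using L[of "w2 1 1 0"] by (simp add: w2_def)
    fix as bs :: "nat list"
    assume *: "set as \<subseteq> {..<d}" "set bs \<subseteq> {..<d}" "as \<noteq> []" "bs \<noteq> []" "length as + length bs = 2"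
    show "ymon as * zmon bs \<in> V"
      by (rule polarized_mon[OF V kills_skew_0[OF V s] p *(1-3)])
         (use length_cases_2[OF *(3-5)] in simp_all)
  qed
qed (use d_pos in simp_all)

lemma consequences_y1z1:
  "consequences_equiv d \<beta>\<^sub>1 \<beta>\<^sub>2 3 (w1 2 1) {w1 3 2, w1 3 1, w2 2 1 1}"
proof (rule consequences_equivI)
  show "l \<in> ghom d 3" if "l \<in> {w1 3 2, w1 3 1, w2 2 1 1}" for l :: "'k gelem"
    using that w1_hom w2_hom by auto
  show "l \<in> T" if T: "T_ideal (G d) T" and f: "w1 2 1 \<in> T" and l: "l \<in> {w1 3 2, w1 3 1, w2 2 1 1}" for T l
  proof -
    let ?P = "poly_part T"
    note V = poly_part_subspace[OF T]
    have f': "py 0 * pz 0 \<in> ?P" using f by (simp add: mem_poly_part w1_def)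
    have sym: "lft A * rgt B + lft B * rgt A \<in> ?P" if "A \<in> gcarrier d" "B \<in> gcarrier d" for A B
    proof -
      have sq: "lft A * rgt A \<in> ?P" if "A \<in> gcarrier d" for A
        using poly_part_pair_subst[OF T f' that that] by (simp add: psubst_mult)
      have "lft (A + B) * rgt (A + B) - lft A * rgt A - lft B * rgt B \<in> ?P"
        by (intro psubspace_diff[OF V] sq gcarrier_add that)
      then show ?thesis by (simp add: algebra_simps)
    qed
    \<comment> \<open>The pairs are \<open>gx 0\<close> with the product of \<open>gx 0\<close> and
      \<open>gx 1\<close>, and \<open>gx 1\<close> with the square of \<open>gx 0\<close>. Their
      terms \<open>py 0 * pz 0 * pz 1\<close> cancel and leave \<open>py 0 * skew12\<close>.\<close>
    have "py 0 * (py 0 * pz 1) + py 0 * pz 1 * pz 0 - (py 1 * (py 0 * pz 0) + py 0 * pz 0 * pz 1) \<in> ?P"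
      using psubspace_diff[OF V
          sym[OF gcarrier_gx gpoly_yz_carrier, of 0 0 1] sym[OF gcarrier_gx gpoly_yz_carrier, of 1 0 0]]
        d_pos by simp
    then have "py 0 * skew12 \<in> ?P" by (simp add: skew12_def algebra_simps)
    then show ?thesis
      using l poly_part_py[OF T d_pos(1) f'] poly_part_pz[OF T d_pos(1) f']
      by (auto simp: w1_def w2_def mem_poly_part eval_nat_numeral mult_ac)
  qed
  show "snd a \<in> V" if V: "gl_stable V" and L: "\<And>l. l \<in> {w1 3 2, w1 3 1, w2 2 1 1} \<Longrightarrow> snd l \<in> V"
    and a: "a \<in> ghom d 3" for V a
  proof (rule ghom_span[OF gl_stable_subspace[OF V] a])
    have p: "py 0 ^ 2 * pz 0 ^ 1 \<in> V" "py 0 ^ 1 * pz 0 ^ 2 \<in> V"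
      using L[of "w1 3 2"] L[of "w1 3 1"] by (simp_all add: w1_def)
    have s: "py 0 * skew12 \<in> V" using L[of "w2 2 1 1"] by (simp add: w2_def)
    fix as bs :: "nat list"
    assume *: "set as \<subseteq> {..<d}" "set bs \<subseteq> {..<d}" "as \<noteq> []" "bs \<noteq> []" "length as + length bs = 3"
    then consider "length as = 2" "length bs = 1" | "length as = 1" "length bs = 2"
      by (cases as; cases bs; cases "tl as"; cases "tl bs") auto
    then show "ymon as * zmon bs \<in> V"
    proof cases
      case 1
      then show ?thesis
        by (intro polarized_mon[OF V kills_skew_1[OF V s] p(1) *(1-3)]) simp_all
    next
      case 2
      then show ?thesis
        by (intro polarized_mon[OF V kills_skew_1[OF V s] p(2) *(1-3)]) simp_all
    qed
  qed
qed (use w1_carrier in simp_all)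

lemma consequences_skew12:
  "consequences_equiv d \<beta>\<^sub>1 \<beta>\<^sub>2 3 (w2 1 1 0) {w1 3 2 - w1 3 1, w2 2 1 1}"
proof (rule consequences_equivI)
  show "l \<in> ghom d 3" if "l \<in> {w1 3 2 - w1 3 1, w2 2 1 1}" for l :: "'k gelem"
    using that w1_hom w2_hom by (auto intro: ghom_diff)
  show "l \<in> T" if T: "T_ideal (G d) T" and f: "w2 1 1 0 \<in> T"
    and l: "l \<in> {w1 3 2 - w1 3 1, w2 2 1 1}" for T l
  proof -
    let ?P = "poly_part T"
    have f': "skew12 \<in> ?P" using f by (simp add: mem_poly_part w2_def)
    \<comment> \<open>Replacing \<open>gx 1\<close> by the square of \<open>gx 0\<close> turns the
      commutator into \<open>py 0 * pz 0 * (py 0 - pz 0)\<close>.\<close>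
    have "skew (gx 0) (gpoly (py 0 * pz 0)) \<in> ?P"
      using poly_part_pair_subst[OF T f' gcarrier_gx gpoly_yz_carrier, of 0 0 0] d_pos
      by (simp add: psubst_skew12)
    then show ?thesis
      using l poly_part_py[OF T d_pos(1) f']
      by (auto simp: w1_def w2_def mem_poly_part skew_def eval_nat_numeral mult_ac simp flip: gpoly_diff)
  qed
  show "snd a \<in> V" if V: "gl_stable V"
    and L: "\<And>l. l \<in> {w1 3 2 - w1 3 1, w2 2 1 1} \<Longrightarrow> snd l \<in> V"
    and a: "a \<in> ghom d 3" and c: "collapse (w2 1 1 0 :: 'k gelem) = 0 \<Longrightarrow> collapse a = 0" for V a
  proof -
    have p: "py 0 ^ 1 * pz 0 ^ 1 * (py 0 - pz 0) \<in> V"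
      using L[of "w1 3 2 - w1 3 1"] by (simp add: w1_def eval_nat_numeral algebra_simps flip: gpoly_diff)
    have s: "py 0 * skew12 \<in> V" using L[of "w2 2 1 1"] by (simp add: w2_def)
    note ks = kills_skew_1[OF V s]
    show ?thesis
    proof (rule collapse_kernel[OF gl_stable_subspace[OF V] ks _ _ a])
      fix as bs :: "nat list" and i
      assume *: "set as \<subseteq> {..<d}" "set bs \<subseteq> {..<d}" "i < d" "as \<noteq> []" "bs \<noteq> []"
        "Suc (length as + length bs) = 3"
      show "ymon as * zmon bs * (py i - pz i) \<in> V"
        by (rule polarized_diff[OF V ks p *(1-3)]) (use length_cases_2[OF *(4,5)] *(6) in simp_all)
    next
      show "psubst collapse_var (snd a) = 0"
        using c collapse_snd[OF a] by (simp add: w2_def psubst_mult)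
    qed simp
  qed
qed (use w2_carrier[of 0] in simp_all)

lemma length_cases_4:
  assumes "as \<noteq> []" "bs \<noteq> []" "length as + length bs = 4"
  obtains "length as = 3" "length bs = 1" | "length as = 2" "length bs = 2"
    | i j k l where "as = [i]" "bs = [j, k, l]"
proof -
  have "length as \<noteq> 0" "length bs \<noteq> 0" using assms(1,2) by simp_all
  then consider "length as = 3" "length bs = 1" | "length as = 2" "length bs = 2"
    | "length as = 1" "length bs = 3"
    using assms(3) by linarith
  then show thesis
    using that by cases (auto simp: length_Suc_conv eval_nat_numeral)
qed

lemma consequences_w3:
  assumes \<gamma>: "\<gamma>\<^sub>1 + \<gamma>\<^sub>2 \<noteq> 0"
  shows "consequences_equiv d \<beta>\<^sub>1 \<beta>\<^sub>2 4 (gscale \<gamma>\<^sub>1 (w1 3 2) + gscale \<gamma>\<^sub>2 (w1 3 1)) {w1 4 3, w1 4 2, w2 3 1 2}"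
proof (rule consequences_equivI)
  show "l \<in> ghom d 4" if "l \<in> {w1 4 3, w1 4 2, w2 3 1 2}" for l :: "'k gelem"
    using that w1_hom w2_hom by auto
  show "l \<in> T" if T: "T_ideal (G d) T" and TB: "TB \<subseteq> T"
    and f: "gscale \<gamma>\<^sub>1 (w1 3 2) + gscale \<gamma>\<^sub>2 (w1 3 1) \<in> T" and l: "l \<in> {w1 4 3, w1 4 2, w2 3 1 2}" for T l
  proof -
    let ?P = "poly_part T"
    note V = poly_part_subspace[OF T]
    have IB: "p \<in> ?P" if "p \<in> IB" for p using that TB by (auto simp: mem_poly_part)
    define y z where "y = (py 0 :: 'k yzpoly)" and "z = (pz 0 :: 'k yzpoly)"
    define g1 g2 where "g1 = pconst \<gamma>\<^sub>1" and "g2 = pconst \<gamma>\<^sub>2"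
    define F where "F = g1 * (y ^ 2 * z) + g2 * (y * z ^ 2)"
    have F: "F \<in> ?P"
      using f by (simp add: F_def y_def z_def g1_def g2_def mem_poly_part w1_def gscale_gpoly gpoly_add)
    have yF: "y * F \<in> ?P" and zF: "z * F \<in> ?P"
      using poly_part_py[OF T d_pos(1) F] poly_part_pz[OF T d_pos(1) F] by (simp_all add: y_def z_def)
    \<comment> \<open>The derivative of \<open>F\<close> in the direction
      \<open>gpoly (y * z)\<close>: a polynomial adds the same multiple of \<open>y * z\<close> to
      both operators.\<close>
    let ?q = "[:g1:] * ([:y, y * z:] ^ 2 * [:z, y * z:] ^ 1) + [:g2:] * ([:y, y * z:] ^ 1 * [:z, y * z:] ^ 2)"
    have "poly ?q (pconst c) \<in> ?P" for c
    proof -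
      let ?A = "gx 0 + gscale c (gpoly (y * z))"
      have "?A \<in> gcarrier d"
        unfolding y_def z_def by (intro gcarrier_add gcarrier_scale gpoly_yz_carrier gcarrier_gx d_pos)
      from poly_part_pair_subst[OF T F this this] show ?thesis
        by (simp add: F_def psubst_simps g1_def g2_def y_def z_def algebra_simps)
    qed
    then have "coeff ?q 1 \<in> ?P" by (intro coeff_in_psubspace[OF V infinite_UNIV_char_0]) simp
    then have D: "g1 * (2 * y ^ 2 * z ^ 2 + y ^ 3 * z) + g2 * (2 * y ^ 2 * z ^ 2 + y * z ^ 3) \<in> ?P"
      unfolding coeff_add coeff_mult_1 coeff_mult_0' coeff_linear_power
      by (simp add: eval_nat_numeral algebra_simps)
    \<comment> \<open>Subtracting \<open>y * F\<close> and \<open>z * F\<close> cancels the outer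
      monomials \<open>y ^ 3 * z\<close> and \<open>y * z ^ 3\<close> of the derivative and keeps
      one copy of the middle one for each coefficient.\<close>
    have "pconst (\<gamma>\<^sub>1 + \<gamma>\<^sub>2) * (y ^ 2 * z ^ 2) \<in> ?P"
      using psubspace_diff[OF V psubspace_diff[OF V D yF] zF]
      by (simp add: F_def pconst_add g1_def g2_def eval_nat_numeral algebra_simps)
    then have e2: "y ^ 2 * z ^ 2 \<in> ?P" by (rule psubspace_cancel[OF V]) (rule \<gamma>)
    have e3: "pconst \<gamma>\<^sub>1 * (y ^ 3 * z) \<in> ?P"
      using psubspace_diff[OF V yF psubspaceD(3)[OF V e2, of \<gamma>\<^sub>2]]
      by (simp add: F_def g1_def g2_def eval_nat_numeral algebra_simps)
    have e1: "pconst \<gamma>\<^sub>2 * (y * z ^ 3) \<in> ?P"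
      using psubspace_diff[OF V zF psubspaceD(3)[OF V e2, of \<gamma>\<^sub>1]]
      by (simp add: F_def g1_def g2_def eval_nat_numeral algebra_simps)
    have "y ^ 3 * z \<in> ?P"
    proof (cases "\<gamma>\<^sub>1 = 0")
      case True
      then have "y * z ^ 3 \<in> ?P" using psubspace_cancel[OF V e1] \<gamma> by simp
      \<comment> \<open>The defining relation in degree 4 is linear in \<open>y ^ 3 * z\<close>,
        \<open>y ^ 2 * z ^ 2\<close> and \<open>y * z ^ 3\<close>, and it yields the first from the
        other two.\<close>
      then have "(pconst \<beta>\<^sub>1 * y + pconst \<beta>\<^sub>2 * z) * (y * z * (y - z)) + pconst \<beta>\<^sub>1 * (y ^ 2 * z ^ 2) -
          pconst \<beta>\<^sub>2 * (y ^ 2 * z ^ 2) + pconst \<beta>\<^sub>2 * (y * z ^ 3) \<in> ?P"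
        using relation_yz[OF d_pos(1) d_pos(1) d_pos(1) d_pos(1)] e2 unfolding y_def z_def
        by (intro psubspaceD[OF V] psubspace_diff[OF V]) (auto intro: IB)
      then have "pconst \<beta>\<^sub>1 * (y ^ 3 * z) \<in> ?P" by (simp add: eval_nat_numeral algebra_simps)
      then show ?thesis by (rule psubspace_cancel[OF V]) (rule \<beta>_nonzero)
    qed (use psubspace_cancel[OF V e3] in blast)
    \<comment> \<open>The third listed element already lies in the T-ideal of the variety.\<close>
    moreover have "py 0 ^ 2 * skew12 \<in> ?P"
      using IB[OF IB_quadratic_skew(2)[of "gx 0" "gx 0" "gx 0" "gx 1"]] d_pos
      by (simp add: skew12_eq power2_eq_square)
    ultimately show ?thesis
      using l e2 by (auto simp: w1_def w2_def mem_poly_part y_def z_def)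
  qed
  show "snd a \<in> V" if V: "gl_stable V" and L: "\<And>l. l \<in> {w1 4 3, w1 4 2, w2 3 1 2} \<Longrightarrow> snd l \<in> V"
    and a: "a \<in> ghom d 4" for V a
  proof (rule ghom_span[OF gl_stable_subspace[OF V] a])
    note V' = gl_stable_subspace[OF V]
    have p: "py 0 ^ 3 * pz 0 ^ 1 \<in> V" "py 0 ^ 2 * pz 0 ^ 2 \<in> V"
      using L[of "w1 4 3"] L[of "w1 4 2"] by (simp_all add: w1_def)
    have ks: "kills_skew d 2 V" by (rule kills_skew_mono[OF V]) simp
    have m3: "ymon as * zmon bs \<in> V"
      if "set as \<subseteq> {..<d}" "set bs \<subseteq> {..<d}" "length as = 3" "length bs = 1" for as bs
      by (rule polarized_mon[OF V ks p(1)]) (use that in auto)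
    have m2: "ymon as * zmon bs \<in> V"
      if "set as \<subseteq> {..<d}" "set bs \<subseteq> {..<d}" "length as = 2" "length bs = 2" for as bs
      by (rule polarized_mon[OF V ks p(2)]) (use that in auto)
    fix as bs :: "nat list"
    assume *: "set as \<subseteq> {..<d}" "set bs \<subseteq> {..<d}" "as \<noteq> []" "bs \<noteq> []" "length as + length bs = 4"
    show "ymon as * zmon bs \<in> V"
      using *(3-5)
    proof (cases rule: length_cases_4)
      case (3 i j k l)
      then have ijkl: "i < d" "j < d" "k < d" "l < d" using * by auto
      \<comment> \<open>The relation expresses a monomial with one y and three z's through monomials
        with fewer z's, which polarization has already supplied.\<close>
      have "pconst \<beta>\<^sub>1 * (ymon [k, i, l] * zmon [j]) - pconst \<beta>\<^sub>1 * (ymon [k, i] * zmon [j, l]) +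
          pconst \<beta>\<^sub>2 * (ymon [i, l] * zmon [j, k]) -
          (pconst \<beta>\<^sub>1 * py k + pconst \<beta>\<^sub>2 * pz k) * (py i * pz j * (py l - pz l)) \<in> V"
        by (intro psubspace_diff[OF V'] psubspaceD(2,3)[OF V'] m3 m2 gl_stable_IB[OF V] relation_yz)
           (use ijkl in simp_all)
      then have "pconst \<beta>\<^sub>2 * (ymon as * zmon bs) \<in> V" by (simp add: 3 algebra_simps)
      then show ?thesis by (rule psubspace_cancel[OF V']) (rule \<beta>_nonzero)
    qed (use * m3 m2 in auto)
  qed
qed (auto intro!: gcarrier_add gcarrier_scale w1_carrier)

text \<open>The common upper bound for \<open>w1 3 2 - w1 3 1\<close> and \<open>w2 2 1 1\<close>.
  Polarization supplies the differences with two y's and one z in front; the relation of the variety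
  trades a y for a z and supplies those with one y and two z's.\<close>

lemma upper_w4_diff:
  assumes V: "gl_stable V" and L: "snd (w1 4 3 - w1 4 2) \<in> V"
    and a: "a \<in> ghom d 4" and c: "collapse a = 0"
  shows "snd a \<in> V"
proof -
  note V' = gl_stable_subspace[OF V]
  have p: "py 0 ^ 2 * pz 0 ^ 1 * (py 0 - pz 0) \<in> V"
    using L by (simp add: w1_def eval_nat_numeral algebra_simps flip: gpoly_diff)
  have ks: "kills_skew d 2 V" by (rule kills_skew_mono[OF V]) simp
  show ?thesis
  proof (rule collapse_kernel[OF V' ks _ _ a])
    fix as bs :: "nat list" and m
    assume *: "set as \<subseteq> {..<d}" "set bs \<subseteq> {..<d}" "m < d" "as \<noteq> []" "bs \<noteq> []"
      "Suc (length as + length bs) = 4"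
    have "length as \<noteq> 0" "length bs \<noteq> 0" using *(4,5) by simp_all
    then consider "length as = 2" "length bs = 1" | "length as = 1" "length bs = 2"
      using *(6) by linarith
    then show "ymon as * zmon bs * (py m - pz m) \<in> V"
    proof cases
      case 1
      then show ?thesis by (intro polarized_diff[OF V ks p *(1-3)]) simp_all
    next
      case 2
      then obtain i j k where ijk: "as = [i]" "bs = [j, k]"
        by (auto simp: length_Suc_conv eval_nat_numeral)
      then have "i < d" "j < d" "k < d" using * by auto
      then have "(pconst \<beta>\<^sub>1 * py k + pconst \<beta>\<^sub>2 * pz k) * (py i * pz j * (py m - pz m)) -
          pconst \<beta>\<^sub>1 * (ymon [k, i] * zmon [j] * (py m - pz m)) \<in> V"
        using *(3)
        by (intro psubspace_diff[OF V'] psubspaceD(3)[OF V'] gl_stable_IB[OF V] relation_yz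
            polarized_diff[OF V ks p]) simp_all
      then have "pconst \<beta>\<^sub>2 * (ymon as * zmon bs * (py m - pz m)) \<in> V"
        by (simp add: ijk algebra_simps)
      then show ?thesis by (rule psubspace_cancel[OF V']) (rule \<beta>_nonzero)
    qed
  next
    show "psubst collapse_var (snd a) = 0" using c collapse_snd[OF a] by simp
  qed simp
qed

lemma consequences_w3_diff:
  "consequences_equiv d \<beta>\<^sub>1 \<beta>\<^sub>2 4 (w1 3 2 - w1 3 1) {w1 4 3 - w1 4 2}"
proof (rule consequences_equivI)
  show "l \<in> ghom d 4" if "l \<in> {w1 4 3 - w1 4 2}" for l :: "'k gelem"
    using that w1_hom by (auto intro: ghom_diff)
  show "l \<in> T" if T: "T_ideal (G d) T" and f: "w1 3 2 - w1 3 1 \<in> T" and l: "l \<in> {w1 4 3 - w1 4 2}" for T l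
  proof -
    have "py 0 ^ 2 * pz 0 - py 0 * pz 0 ^ 2 \<in> poly_part T"
      using f by (simp add: w1_def mem_poly_part gpoly_diff)
    from poly_part_py[OF T d_pos(1) this] show ?thesis
      using l by (simp add: w1_def mem_poly_part eval_nat_numeral algebra_simps flip: gpoly_diff)
  qed
  show "snd a \<in> V" if V: "gl_stable V" and L: "\<And>l. l \<in> {w1 4 3 - w1 4 2} \<Longrightarrow> snd l \<in> V"
    and a: "a \<in> ghom d 4" and c: "collapse (w1 3 2 - w1 3 1 :: 'k gelem) = 0 \<Longrightarrow> collapse a = 0" for V a
  proof -
    have "collapse (w1 3 2 - w1 3 1 :: 'k gelem) = 0"
      by (simp add: w1_def psubst_simps eval_nat_numeral algebra_simps flip: gpoly_diff)
    from upper_w4_diff[OF V L a c[OF this]] show ?thesis by simp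
  qed
qed (auto intro!: gcarrier_diff w1_carrier)

lemma consequences_w21:
  "consequences_equiv d \<beta>\<^sub>1 \<beta>\<^sub>2 4 (w2 2 1 1) {w1 4 3 - w1 4 2}"
proof (rule consequences_equivI)
  show "l \<in> ghom d 4" if "l \<in> {w1 4 3 - w1 4 2}" for l :: "'k gelem"
    using that w1_hom by (auto intro: ghom_diff)
  show "l \<in> T" if T: "T_ideal (G d) T" and f: "w2 2 1 1 \<in> T" and l: "l \<in> {w1 4 3 - w1 4 2}" for T l
  proof -
    have "py 0 * skew12 \<in> poly_part T" using f by (simp add: w2_def mem_poly_part)
    \<comment> \<open>The square of \<open>gx 0\<close> is substituted for \<open>gx 1\<close>,
      which turns the skew polynomial into a difference of pure powers.\<close>
    from poly_part_pair_subst[OF T this gcarrier_gx gpoly_yz_carrier, of 0 0 0]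
    have "py 0 * skew (gx 0) (gpoly (py 0 * pz 0)) \<in> poly_part T"
      using d_pos by (simp add: psubst_mult psubst_skew12)
    then show ?thesis
      using l by (simp add: w1_def mem_poly_part skew_def eval_nat_numeral algebra_simps flip: gpoly_diff)
  qed
  show "snd a \<in> V" if V: "gl_stable V" and L: "\<And>l. l \<in> {w1 4 3 - w1 4 2} \<Longrightarrow> snd l \<in> V"
    and a: "a \<in> ghom d 4" and c: "collapse (w2 2 1 1 :: 'k gelem) = 0 \<Longrightarrow> collapse a = 0" for V a
  proof -
    have "collapse (w2 2 1 1 :: 'k gelem) = 0" by (simp add: w2_def psubst_simps)
    from upper_w4_diff[OF V L a c[OF this]] show ?thesis by simp
  qed
qed (use w2_carrier[of 1] in \<open>simp_all add: numeral_2_eq_2\<close>)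

text \<open>In degree at least 5, \<open>IB_mon_diff\<close> changes a z into the y of the same
  index while another z remains. All monomials thus reduce to those with a single z, which come from
  the given one by polarization.\<close>

lemma upper_high_degree:
  assumes V: "gl_stable V" and k: "5 \<le> k" and p: "py 0 ^ (k - 1) * pz 0 \<in> V" and a: "a \<in> ghom d k"
  shows "snd a \<in> V"
proof (rule ghom_span[OF gl_stable_subspace[OF V] a])
  fix as bs :: "nat list"
  assume "set as \<subseteq> {..<d}" "set bs \<subseteq> {..<d}" "as \<noteq> []" "bs \<noteq> []" "length as + length bs = k"
  then show "ymon as * zmon bs \<in> V"
  proof (induction bs arbitrary: as)
    case (Cons b bs)
    show ?case
    proof (cases "bs = []")
      case True
      have "kills_skew d (k - 2) V" by (rule kills_skew_mono[OF V]) (use k in simp)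
      then show ?thesis
        by (rule polarized_mon[OF V, where a = "k - 1" and b = 1]) (use p Cons.prems k True in auto)
    next
      case False
      have "ymon (b # as) * zmon bs \<in> V"
        using Cons.prems False by (intro Cons.IH) auto
      moreover have "ymon as * zmon bs * (py b - pz b) \<in> V"
        using Cons.prems False k by (intro gl_stable_IB[OF V] IB_mon_diff) auto
      ultimately have "ymon (b # as) * zmon bs - ymon as * zmon bs * (py b - pz b) \<in> V"
        by (rule psubspace_diff[OF gl_stable_subspace[OF V]])
      then show ?thesis by (simp add: algebra_simps)
    qed
  qed simp
qed

lemma consequences_w4:
  assumes \<gamma>: "\<gamma>\<^sub>1 + \<gamma>\<^sub>2 \<noteq> 0"
  shows "consequences_equiv d \<beta>\<^sub>1 \<beta>\<^sub>2 5 (gscale \<gamma>\<^sub>1 (w1 4 2) + gscale \<gamma>\<^sub>2 (w1 4 1)) {w1 5 4}"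
proof (rule consequences_equivI)
  show "l \<in> ghom d 5" if "l \<in> {w1 5 4}" for l :: "'k gelem"
    using that w1_hom by auto
  show "l \<in> T" if T: "T_ideal (G d) T" and TB: "TB \<subseteq> T"
    and f: "gscale \<gamma>\<^sub>1 (w1 4 2) + gscale \<gamma>\<^sub>2 (w1 4 1) \<in> T" and l: "l \<in> {w1 5 4}" for T l
  proof -
    let ?P = "poly_part T"
    note V = poly_part_subspace[OF T]
    have IB: "p \<in> ?P" if "p \<in> IB" for p using that TB by (auto simp: mem_poly_part)
    define y z where "y = (py 0 :: 'k yzpoly)" and "z = (pz 0 :: 'k yzpoly)"
    have "pconst \<gamma>\<^sub>1 * (y ^ 2 * z ^ 2) + pconst \<gamma>\<^sub>2 * (y * z ^ 3) \<in> ?P"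
      using f by (simp add: y_def z_def mem_poly_part w1_def gscale_gpoly gpoly_add)
    then have F: "y * (pconst \<gamma>\<^sub>1 * (y ^ 2 * z ^ 2) + pconst \<gamma>\<^sub>2 * (y * z ^ 3)) \<in> ?P"
      unfolding y_def by (rule poly_part_py[OF T d_pos(1)])
    have d1: "y * z * (y * y) * (y - z) \<in> ?P" and d2: "y * z * (y * z) * (y - z) \<in> ?P"
      unfolding y_def z_def by (intro IB IB_yz_diff d_pos)+
    \<comment> \<open>The coefficients telescope: the last summand cancels
      \<open>y ^ 2 * z ^ 3\<close>, the middle one cancels the collected multiples of
      \<open>y ^ 3 * z ^ 2\<close>, and only \<open>y ^ 4 * z\<close> survives.\<close>
    have "y * (pconst \<gamma>\<^sub>1 * (y ^ 2 * z ^ 2) + pconst \<gamma>\<^sub>2 * (y * z ^ 3)) +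
        pconst (\<gamma>\<^sub>1 + \<gamma>\<^sub>2) * (y * z * (y * y) * (y - z)) + pconst \<gamma>\<^sub>2 * (y * z * (y * z) * (y - z)) \<in> ?P"
      by (intro psubspaceD(2,3)[OF V] F d1 d2)
    then have "pconst (\<gamma>\<^sub>1 + \<gamma>\<^sub>2) * (y ^ 4 * z) \<in> ?P"
      by (simp add: pconst_add eval_nat_numeral algebra_simps)
    then have "y ^ 4 * z \<in> ?P" by (rule psubspace_cancel[OF V]) (rule \<gamma>)
    then show ?thesis using l by (simp add: w1_def y_def z_def mem_poly_part)
  qed
  show "snd a \<in> V" if V: "gl_stable V" and L: "\<And>l. l \<in> {w1 5 4} \<Longrightarrow> snd l \<in> V"
    and a: "a \<in> ghom d 5" for V a
    by (rule upper_high_degree[OF V _ _ a]) (use L[of "w1 5 4"] in \<open>simp_all add: w1_def\<close>)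
qed (auto intro!: gcarrier_add gcarrier_scale w1_carrier)

text \<open>The element lies in the kernel of \<open>collapse\<close>, and so do its consequences.
  In degree 5 the hypotheses of \<open>collapse_kernel\<close> hold for \<open>IB\<close> itself, so
  this kernel is zero in the factor algebra.\<close>

lemma consequences_w4_diff: "consequences d \<beta>\<^sub>1 \<beta>\<^sub>2 5 (w1 4 2 - w1 4 1) = {azero (GV d \<beta>\<^sub>1 \<beta>\<^sub>2)}"
proof -
  have f: "(w1 4 2 - w1 4 1 :: 'k gelem) \<in> gcarrier d" by (auto intro!: gcarrier_diff w1_carrier)
  have f0: "collapse (w1 4 2 - w1 4 1 :: 'k gelem) = 0"
    by (simp add: w1_def psubst_simps eval_nat_numeral algebra_simps flip: gpoly_diff)
  have "C = azero (GV d \<beta>\<^sub>1 \<beta>\<^sub>2)" if "C \<in> consequences d \<beta>\<^sub>1 \<beta>\<^sub>2 5 (w1 4 2 - w1 4 1)" for C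
  proof -
    obtain a where a: "C = cls a" "cls a \<in> T_ideal_gen (GV d \<beta>\<^sub>1 \<beta>\<^sub>2) {cls (w1 4 2 - w1 4 1)}"
      "a \<in> ghom d 5"
      using \<open>C \<in> _\<close> unfolding consequences_def by blast
    from collapse_consequence[OF f f0 a(2)] have "psubst collapse_var (snd a) = 0"
      using collapse_snd[OF a(3)] by simp
    then have "snd a \<in> IB"
      by (intro collapse_kernel[OF IB_subspace IB_kills_skew[of 3] _ _ a(3)]) (auto intro!: IB_mon_diff)
    then have "a \<in> TB" using ghom_gpoly[OF a(3)] by (simp add: mem_poly_part)
    then have "cls a = cls 0" by (simp add: cls_eq_iff)
    then show ?thesis using a(1) by (simp add: GV_carrier)
  qed
  moreover have "azero (GV d \<beta>\<^sub>1 \<beta>\<^sub>2) \<in> consequences d \<beta>\<^sub>1 \<beta>\<^sub>2 5 (w1 4 2 - w1 4 1)"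
    using consequences_submodule[OF f, of 5] by (simp add: GL_submodule_def asubspace_def)
  ultimately show ?thesis by blast
qed

lemma consequences_wn:
  assumes n: "5 \<le> n"
  shows "consequences_equiv d \<beta>\<^sub>1 \<beta>\<^sub>2 (n + 1) (w1 n (n - 1)) {w1 (n + 1) n}"
proof (rule consequences_equivI)
  show "l \<in> ghom d (n + 1)" if "l \<in> {w1 (n + 1) n}" for l :: "'k gelem"
    using that w1_hom n by auto
  show "l \<in> T" if T: "T_ideal (G d) T" and f: "w1 n (n - 1) \<in> T" and l: "l \<in> {w1 (n + 1) n}" for T l
  proof -
    have "py 0 ^ (n - 1) * pz 0 \<in> poly_part T" using f n by (simp add: w1_def mem_poly_part)
    from poly_part_py[OF T d_pos(1) this] show ?thesis
      using l n by (cases n) (simp_all add: w1_def mem_poly_part mult.assoc)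
  qed
  show "snd a \<in> V" if V: "gl_stable V" and L: "\<And>l. l \<in> {w1 (n + 1) n} \<Longrightarrow> snd l \<in> V"
    and a: "a \<in> ghom d (n + 1)" for V a
    by (rule upper_high_degree[OF V _ _ a]) (use n L[of "w1 (n + 1) n"] in \<open>simp_all add: w1_def\<close>)
qed (use n w1_carrier in simp_all)

end

theorem theorem4p7:
  fixes d :: nat and \<beta>\<^sub>1 \<beta>\<^sub>2 :: "'k::field_char_0"
  assumes "2 \<le> d"
    and "\<beta>\<^sub>1 * \<beta>\<^sub>2 * (\<beta>\<^sub>1 + \<beta>\<^sub>2) * (\<beta>\<^sub>1 - \<beta>\<^sub>2) \<noteq> 0"
  shows "(consequences_equiv d \<beta>\<^sub>1 \<beta>\<^sub>2 2 (gx 0) {w1 2 1, w2 1 1 0}) \<and>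
     (consequences_equiv d \<beta>\<^sub>1 \<beta>\<^sub>2 3 (w1 2 1) {w1 3 2, w1 3 1, w2 2 1 1}) \<and>
     (consequences_equiv d \<beta>\<^sub>1 \<beta>\<^sub>2 3 (w2 1 1 0) {w1 3 2 - w1 3 1, w2 2 1 1}) \<and>
     (\<forall>\<gamma>\<^sub>1 \<gamma>\<^sub>2. \<gamma>\<^sub>1 + \<gamma>\<^sub>2 \<noteq> 0 \<longrightarrow>
        consequences_equiv d \<beta>\<^sub>1 \<beta>\<^sub>2 4 (gscale \<gamma>\<^sub>1 (w1 3 2) + gscale \<gamma>\<^sub>2 (w1 3 1))
          {w1 4 3, w1 4 2, w2 3 1 2}) \<and>
     (consequences_equiv d \<beta>\<^sub>1 \<beta>\<^sub>2 4 (w1 3 2 - w1 3 1) {w1 4 3 - w1 4 2}) \<and>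
     (consequences_equiv d \<beta>\<^sub>1 \<beta>\<^sub>2 4 (w2 2 1 1) {w1 4 3 - w1 4 2}) \<and>
     (\<forall>\<gamma>\<^sub>1 \<gamma>\<^sub>2. \<gamma>\<^sub>1 + \<gamma>\<^sub>2 \<noteq> 0 \<longrightarrow>
        consequences_equiv d \<beta>\<^sub>1 \<beta>\<^sub>2 5 (gscale \<gamma>\<^sub>1 (w1 4 2) + gscale \<gamma>\<^sub>2 (w1 4 1)) {w1 5 4}) \<and>
     (consequences d \<beta>\<^sub>1 \<beta>\<^sub>2 5 (w1 4 2 - w1 4 1) = {azero (GV d \<beta>\<^sub>1 \<beta>\<^sub>2)}) \<and>
     (\<forall>n\<ge>5. consequences_equiv d \<beta>\<^sub>1 \<beta>\<^sub>2 (n + 1) (w1 n (n - 1)) {w1 (n + 1) n})"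
proof -
  interpret vbeta d \<beta>\<^sub>1 \<beta>\<^sub>2 by unfold_locales (fact assms)+
  show ?thesis
    using consequences_x1 consequences_y1z1 consequences_skew12 consequences_w3 consequences_w3_diff
      consequences_w21 consequences_w4 consequences_w4_diff consequences_wn
    by blast
qed

end
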